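(* Assume that every nonzero entry of $\theta$ is irrational. Let $\rho$ be a classical pseudodifferential symbol of order $-4$ on $\mathbb{T}_\theta^4$. Then $P_\rho$ (acting on $\mathcal{H}_0$) belongs to $\mathcal{L}^{1,\infty}(\mathcal{H}_0)$, is measurable, and $$\int\!\!\!\!\!\!-\,P_\rho=\frac14\,\mathrm{res}(P_\rho).$$
   Context: Noncommutative 4-torus: $\theta=(\theta_{kl})$ real skew-symmetric $4\times4$; $C(\mathbb{T}_\theta^4)$ the universal unital $C^*$-algebra generated by unitaries $U_1,\dots,U_4$ with $U_kU_l=e^{2\pi i\theta_{kl}}U_lU_k$; $C^\infty(\mathbb{T}_\theta^4)$ the $*$-subalgebra of $\sum_{\ell}a_\ell U^\ell$ ($U^\ell=U_1^{\ell_1}\cdots U_4^{\ell_4}$) with rapidly decreasing coefficients; $\varphi_0(\sum a_\ell U^\ell)=a_0$; $\mathcal{H}_0$ the completion for $(a,b)=\varphi_0(b^*a)$; $\delta_j(U_k)=\delta_{jk}U_k$, $\delta^i=\delta_1^{i_1}\cdots\delta_4^{i_4}$, $\partial^j=\partial_{\xi_1}^{j_1}\cdots\partial_{\xi_4}^{j_4}$. A smooth $\rho:\mathbb{R}^4\to C^\infty(\mathbb{T}_\theta^4)$ is a symbol of order $m$ if $\|\partial^j\delta^i(\rho(\xi))\|\le c_{ij}(1+|\xi|)^{m-|j|}$ for all $i,j$ and $\lambda^{-m}\rho(\lambda\xi)$ converges as $\lambda\to\infty$ to a smooth function of $\xi\ne0$; $P_\rho(a)=(2\pi)^{-4}\int\int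 e^{-is\cdot\xi}\rho(\xi)\alpha_s(a)\,ds\,d\xi$ with $\alpha_s(U^\ell)=e^{is\cdot\ell}U^\ell$. A symbol is classical of order $m$ if $\rho\sim\sum_{j\ge0}\rho_{m-j}$ with $\rho_{m-j}$ smooth on $\mathbb{R}^4\setminus\{0\}$ and positively homogeneous of order $m-j$. $\mathrm{res}(P_\rho)=\int_{\mathbb{S}^3}\varphi_0(\rho_{-4}(\xi))\,d\Omega$ with $d\Omega$ the standard measure on $\mathbb{S}^3$. Dixmier trace: for compact $T$ let $\mu_n(T)$ be the decreasing eigenvalues of $|T|$; $\mathcal{L}^{1,\infty}=\{T:\sum_{n\le N}\mu_n(T)=O(\log N)\}$; for a state $\omega$ on $C_b[e,\infty)$ vanishing on functions vanishing at infinity, $\mathrm{Tr}_\omega(T)=\omega\big(\frac{1}{\log\Lambda}\int_e^\Lambda\frac{\mathrm{Trace}_r(T)}{\log r}\frac{dr}{r}\big)$ for $T\ge0$ ($\mathrm{Trace}_r$ the piecewise affine interpolation of partial sums $\sum_{n\le N}\mu_n(T)$), extended linearly; $T$ is measurable if $\mathrm{Tr}_\omega(T)$ does not depend on $\omega$, and then $\int\!\!\!\!\!\!-\,T$ denotes this value. *)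

theory Defs
  imports "HOL-Analysis.Analysis" "HOL-Library.Landau_Symbols"
begin

type_synonym lat = "int ^ 4"              \<comment> \<open>exponents l of U^l = U_1^l1 ... U_4^l4\<close>
type_synonym coeffs = "lat \<Rightarrow> complex"     \<comment> \<open>coefficient sequences (a_l) of sum a_l U^l\<close>
type_synonym freq = "real ^ 4"
type_synonym multi = "nat ^ 4"

definition ivec :: "lat \<Rightarrow> freq" where
  "ivec l = (\<chi> k. real_of_int (l $ k))"

definition lnorm :: "lat \<Rightarrow> real" where
  "lnorm l = norm (ivec l)"

definition msize :: "multi \<Rightarrow> nat" where
  "msize j = (\<Sum>k\<in>UNIV. j $ k)"

definition skew4 :: "real^4^4 \<Rightarrow> bool" where
  "skew4 \<theta> \<longleftrightarrow> (\<forall>k l. \<theta> $ k $ l = - \<theta> $ l $ k)"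

text \<open>U^a U^b = twist a b U^(a+b), computed from U_k U_l = e^(2 pi i theta_kl) U_l U_k.\<close>
definition twist :: "real^4^4 \<Rightarrow> lat \<Rightarrow> lat \<Rightarrow> complex" where
  "twist \<theta> a b = exp (2 * of_real pi * \<i> * complex_of_real
      (\<Sum>k\<in>UNIV. \<Sum>l\<in>UNIV. if k < l then \<theta> $ l $ k * of_int (a $ l) * of_int (b $ k) else 0))"

section \<open>The Hilbert space H_0 = l^2(Z^4) (GNS space of phi_0, U^l \<mapsto> delta_l)\<close>

definition l2 :: "coeffs set" where
  "l2 = {x. (\<lambda>l. (cmod (x l))^2) summable_on UNIV}"

definition l2norm :: "coeffs \<Rightarrow> real" where
  "l2norm x = sqrt (\<Sum>\<^sub>\<infinity>l. (cmod (x l))^2)"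

definition l2inner :: "coeffs \<Rightarrow> coeffs \<Rightarrow> complex" where
  "l2inner x y = (\<Sum>\<^sub>\<infinity>l. x l * cnj (y l))"

definition lmult :: "real^4^4 \<Rightarrow> coeffs \<Rightarrow> coeffs \<Rightarrow> coeffs" where
  "lmult \<theta> a x = (\<lambda>n. \<Sum>\<^sub>\<infinity>m. a m * x (n - m) * twist \<theta> m (n - m))"

text \<open>C*-norm of C(T_theta^4): the norm in the (faithful, Z^4 amenable) regular representation.\<close>
definition cnorm :: "real^4^4 \<Rightarrow> coeffs \<Rightarrow> real" where
  "cnorm \<theta> a = (SUP x\<in>{x\<in>l2. l2norm x \<le> 1}. l2norm (lmult \<theta> a x))"

definition rapid :: "coeffs \<Rightarrow> bool" where
  "rapid a \<longleftrightarrow> (\<forall>k::nat. bdd_above (range (\<lambda>l. (1 + lnorm l)^k * cmod (a l))))"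

definition pk :: "nat \<Rightarrow> coeffs \<Rightarrow> real" where
  "pk k a = (SUP l. (1 + lnorm l)^k * cmod (a l))"

definition delta :: "multi \<Rightarrow> coeffs \<Rightarrow> coeffs" where
  "delta i a = (\<lambda>l. (\<Prod>k\<in>UNIV. of_int (l $ k) ^ (i $ k)) * a l)"

definition phi0 :: "coeffs \<Rightarrow> complex" where
  "phi0 a = a 0"

definition frechet_tendsto :: "('b \<Rightarrow> coeffs) \<Rightarrow> coeffs \<Rightarrow> 'b filter \<Rightarrow> bool" where
  "frechet_tendsto f L F \<longleftrightarrow> (\<forall>k. ((\<lambda>x. pk k (\<lambda>l. f x l - L l)) \<longlongrightarrow> 0) F)"

text \<open>D alpha is the partial derivative d^alpha of D 0 on the open set S; all continuous.\<close>
definition smooth_family :: "freq set \<Rightarrow> (multi \<Rightarrow> freq \<Rightarrow> coeffs) \<Rightarrow> bool" where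
  "smooth_family S D \<longleftrightarrow> open S \<and>
     (\<forall>\<alpha>. \<forall>\<xi>\<in>S. rapid (D \<alpha> \<xi>)) \<and>
     (\<forall>\<alpha>. \<forall>\<xi>\<in>S. frechet_tendsto (D \<alpha>) (D \<alpha> \<xi>) (at \<xi>)) \<and>
     (\<forall>\<alpha> j. \<forall>\<xi>\<in>S. frechet_tendsto
        (\<lambda>h::real. \<lambda>l. (D \<alpha> (\<xi> + h *\<^sub>R axis j 1) l - D \<alpha> \<xi> l) / complex_of_real h)
        (D (\<alpha> + axis j 1) \<xi>) (at 0))"

definition symbol :: "real^4^4 \<Rightarrow> real \<Rightarrow> (freq \<Rightarrow> coeffs) \<Rightarrow> bool" where
  "symbol \<theta> m \<rho> \<longleftrightarrow>
     (\<exists>D. smooth_family UNIV D \<and> D 0 = \<rho> \<and>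
        (\<forall>i j. \<exists>c. \<forall>\<xi>. cnorm \<theta> (delta i (D j \<xi>)) \<le> c * (1 + norm \<xi>) powr (m - real (msize j)))) \<and>
     (\<exists>\<sigma> D\<sigma>. smooth_family (UNIV - {0}) D\<sigma> \<and> (\<forall>\<xi>. \<xi> \<noteq> 0 \<longrightarrow> D\<sigma> 0 \<xi> = \<sigma> \<xi>) \<and>
        (\<forall>\<xi>. \<xi> \<noteq> 0 \<longrightarrow>
           ((\<lambda>t::real. cnorm \<theta> (\<lambda>l. complex_of_real (t powr (- m)) * \<rho> (t *\<^sub>R \<xi>) l - \<sigma> \<xi> l))
              \<longlongrightarrow> 0) at_top))"

text \<open>rho ~ sum_k rhos k, rhos k = rho_(m-k) positively homogeneous of order m-k, smooth off 0,
  and rho - sum_(k<N) rho_(m-k) satisfies the order m-N symbol estimates (for |xi| >= 1).\<close>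
definition classical_symbol ::
  "real^4^4 \<Rightarrow> real \<Rightarrow> (freq \<Rightarrow> coeffs) \<Rightarrow> (nat \<Rightarrow> freq \<Rightarrow> coeffs) \<Rightarrow> bool" where
  "classical_symbol \<theta> m \<rho> \<rho>s \<longleftrightarrow> symbol \<theta> m \<rho> \<and>
     (\<exists>D Ds. smooth_family UNIV D \<and> D 0 = \<rho> \<and>
        (\<forall>k. smooth_family (UNIV - {0}) (Ds k) \<and> (\<forall>\<xi>. \<xi> \<noteq> 0 \<longrightarrow> Ds k 0 \<xi> = \<rho>s k \<xi>)) \<and>
        (\<forall>k. \<forall>t>0. \<forall>\<xi>. \<xi> \<noteq> 0 \<longrightarrow>
            \<rho>s k (t *\<^sub>R \<xi>) = (\<lambda>l. complex_of_real (t powr (m - real k)) * \<rho>s k \<xi> l)) \<and>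
        (\<forall>N i j. \<exists>c. \<forall>\<xi>. 1 \<le> norm \<xi> \<longrightarrow>
            cnorm \<theta> (delta i (\<lambda>l. D j \<xi> l - (\<Sum>k<N. Ds k j \<xi> l)))
              \<le> c * (1 + norm \<xi>) powr (m - real N - real (msize j))))"

text \<open>P_rho(U^l) = rho(l) U^l (the oscillatory integral evaluated by Fourier inversion),
  extended to H_0: matrix coefficient <P delta_l, delta_n> = coefficient of U^n in rho(l) U^l.\<close>
definition Pop :: "real^4^4 \<Rightarrow> (freq \<Rightarrow> coeffs) \<Rightarrow> coeffs \<Rightarrow> coeffs" where
  "Pop \<theta> \<rho> x = (\<lambda>n. \<Sum>\<^sub>\<infinity>l. \<rho> (ivec l) (n - l) * twist \<theta> (n - l) l * x l)"

text \<open>Integral over S^3 w.r.t. the standard surface measure, via polar coordinates: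
  int_{S^3} g dOmega = 4 * int_{|xi|<1} g(xi/|xi|) dxi.\<close>
definition sphere3_integral :: "(freq \<Rightarrow> complex) \<Rightarrow> complex" where
  "sphere3_integral g = 4 * integral (ball 0 1) (\<lambda>\<xi>. g ((1 / norm \<xi>) *\<^sub>R \<xi>))"

definition res :: "(freq \<Rightarrow> coeffs) \<Rightarrow> complex" where
  "res \<rho>_minus4 = sphere3_integral (\<lambda>\<xi>. phi0 (\<rho>_minus4 \<xi>))"

definition h0_bounded :: "(coeffs \<Rightarrow> coeffs) \<Rightarrow> bool" where
  "h0_bounded T \<longleftrightarrow> (\<forall>x\<in>l2. T x \<in> l2) \<and>
     (\<forall>x\<in>l2. \<forall>y\<in>l2. \<forall>c. T (\<lambda>l. c * x l + y l) = (\<lambda>l. c * T x l + T y l)) \<and>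
     (\<exists>K. \<forall>x\<in>l2. l2norm (T x) \<le> K * l2norm x)"

definition l2cauchy :: "(nat \<Rightarrow> coeffs) \<Rightarrow> bool" where
  "l2cauchy s \<longleftrightarrow> (\<forall>e>0. \<exists>N. \<forall>m\<ge>N. \<forall>n\<ge>N. l2norm (\<lambda>l. s m l - s n l) < e)"

definition h0_compact :: "(coeffs \<Rightarrow> coeffs) \<Rightarrow> bool" where
  "h0_compact T \<longleftrightarrow> h0_bounded T \<and>
     (\<forall>x::nat \<Rightarrow> coeffs. (\<forall>k. x k \<in> l2 \<and> l2norm (x k) \<le> 1) \<longrightarrow>
        (\<exists>r::nat \<Rightarrow> nat. strict_mono r \<and> l2cauchy (\<lambda>k. T (x (r k)))))"

definition h0_positive :: "(coeffs \<Rightarrow> coeffs) \<Rightarrow> bool" where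
  "h0_positive T \<longleftrightarrow> h0_bounded T \<and>
     (\<forall>x\<in>l2. Im (l2inner (T x) x) = 0 \<and> 0 \<le> Re (l2inner (T x) x))"

definition is_adjoint :: "(coeffs \<Rightarrow> coeffs) \<Rightarrow> (coeffs \<Rightarrow> coeffs) \<Rightarrow> bool" where
  "is_adjoint T S \<longleftrightarrow> h0_bounded S \<and> (\<forall>x\<in>l2. \<forall>y\<in>l2. l2inner (T x) y = l2inner x (S y))"

definition absop :: "(coeffs \<Rightarrow> coeffs) \<Rightarrow> (coeffs \<Rightarrow> coeffs)" where
  "absop T = (SOME S. h0_positive S \<and> (\<exists>T'. is_adjoint T T' \<and> (\<forall>x\<in>l2. S (S x) = T' (T x))))"

definition orthonormal_set :: "coeffs set \<Rightarrow> bool" where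
  "orthonormal_set F \<longleftrightarrow> F \<subseteq> l2 \<and> (\<forall>x\<in>F. \<forall>y\<in>F. l2inner x y = (if x = y then 1 else 0))"

definition hdim :: "coeffs set \<Rightarrow> enat" where
  "hdim V = (SUP F\<in>{F. finite F \<and> F \<subseteq> V \<and> orthonormal_set F}. enat (card F))"

definition ecard :: "'a set \<Rightarrow> enat" where
  "ecard A = (if finite A then enat (card A) else \<infinity>)"

definition eigenspace_op :: "(coeffs \<Rightarrow> coeffs) \<Rightarrow> real \<Rightarrow> coeffs set" where
  "eigenspace_op S c = {x\<in>l2. S x = (\<lambda>l. complex_of_real c * x l)}"

definition singvals :: "(coeffs \<Rightarrow> coeffs) \<Rightarrow> nat \<Rightarrow> real" where
  "singvals T = (SOME \<mu>. antimono \<mu> \<and> (\<forall>n. 0 \<le> \<mu> n) \<and>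
      (\<forall>c>0. ecard {n. \<mu> n = c} = hdim (eigenspace_op (absop T) c)))"

definition partial_trace :: "(coeffs \<Rightarrow> coeffs) \<Rightarrow> nat \<Rightarrow> real" where
  "partial_trace T N = (\<Sum>n<N. singvals T n)"

definition L1inf :: "(coeffs \<Rightarrow> coeffs) \<Rightarrow> bool" where
  "L1inf T \<longleftrightarrow> h0_compact T \<and> partial_trace T \<in> O(\<lambda>N. ln (real N))"

definition trace_r :: "(coeffs \<Rightarrow> coeffs) \<Rightarrow> real \<Rightarrow> real" where
  "trace_r T r = (let N = nat \<lfloor>r\<rfloor> in
      partial_trace T N + (r - real N) * (partial_trace T (Suc N) - partial_trace T N))"

definition dix_avg :: "(coeffs \<Rightarrow> coeffs) \<Rightarrow> real \<Rightarrow> real" where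
  "dix_avg T \<Lambda> = (1 / ln \<Lambda>) * integral {exp 1..\<Lambda>} (\<lambda>r. trace_r T r / ln r / r)"

definition Cb :: "(real \<Rightarrow> complex) set" where
  "Cb = {f. continuous_on {exp 1..} f \<and> bounded (f ` {exp 1..})}"

definition dixmier_state :: "((real \<Rightarrow> complex) \<Rightarrow> complex) \<Rightarrow> bool" where
  "dixmier_state \<omega> \<longleftrightarrow>
     (\<forall>f\<in>Cb. \<forall>g\<in>Cb. \<forall>c. \<omega> (\<lambda>t. c * f t + g t) = c * \<omega> f + \<omega> g) \<and>
     (\<forall>f\<in>Cb. (\<forall>t\<ge>exp 1. Im (f t) = 0 \<and> 0 \<le> Re (f t)) \<longrightarrow> Im (\<omega> f) = 0 \<and> 0 \<le> Re (\<omega> f)) \<and>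
     \<omega> (\<lambda>t. 1) = 1 \<and>
     (\<forall>f\<in>Cb. (f \<longlongrightarrow> 0) at_top \<longrightarrow> \<omega> f = 0)"

definition trpos :: "((real \<Rightarrow> complex) \<Rightarrow> complex) \<Rightarrow> (coeffs \<Rightarrow> coeffs) \<Rightarrow> complex" where
  "trpos \<omega> T = \<omega> (\<lambda>\<Lambda>. complex_of_real (dix_avg T \<Lambda>))"

definition dixmier_trace :: "((real \<Rightarrow> complex) \<Rightarrow> complex) \<Rightarrow> (coeffs \<Rightarrow> coeffs) \<Rightarrow> complex" where
  "dixmier_trace \<omega> T = (SOME c. \<exists>T1 T2 T3 T4.
      (\<forall>S\<in>{T1, T2, T3, T4}. h0_positive S \<and> L1inf S) \<and>
      (\<forall>x\<in>l2. T x = (\<lambda>l. T1 x l - T2 x l + \<i> * (T3 x l - T4 x l))) \<and>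
      c = trpos \<omega> T1 - trpos \<omega> T2 + \<i> * (trpos \<omega> T3 - trpos \<omega> T4))"

definition dix_measurable :: "(coeffs \<Rightarrow> coeffs) \<Rightarrow> bool" where
  "dix_measurable T \<longleftrightarrow> L1inf T \<and>
     (\<forall>\<omega> \<omega>'. dixmier_state \<omega> \<and> dixmier_state \<omega>' \<longrightarrow> dixmier_trace \<omega> T = dixmier_trace \<omega>' T)"

text \<open>The common value for measurable T.\<close>
definition ncint :: "(coeffs \<Rightarrow> coeffs) \<Rightarrow> complex" where
  "ncint T = dixmier_trace (SOME \<omega>. dixmier_state \<omega>) T"

end

theory Submission
  imports Defs
begin

text \<open>
  In the basis of the \<open>U\<^sup>l\<close>, the operator \<open>P\<^sub>\<rho>\<close> has the matrix entries
  \<open>\<rho>(l)\<^sub>n\<^sub>-\<^sub>l\<close> up to phases; they decay rapidly in \<open>n - l\<close> and like \<open>|l|\<close> to the power \<open>-4\<close>.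
  For a positive operator \<open>A\<close> with such a matrix, the sum of the first \<open>N\<close> eigenvalues differs by
  a bounded amount from the sum of the diagonal entries over the ball of radius comparable to
  \<open>N\<close> to the power \<open>1/4\<close>: one inequality is the Ky Fan principle, the other one is the
  Cauchy-Schwarz inequality applied to the basis vectors outside the ball. Hence the Dixmier trace only sees the
  diagonal \<open>\<phi>\<^sub>0(\<rho>(l))\<close>, whose sum over the ball of radius \<open>R\<close> is \<open>log R\<close> times the
  residue up to lower order terms; \<open>log R\<close> is asymptotically a quarter of \<open>log N\<close>, which gives the factor \<open>1/4\<close>.
  A general \<open>P\<^sub>\<rho>\<close> becomes a combination of such positive operators after
  adding a large multiple of the diagonal operator with entries \<open>1 / (1 + |l|)\<^sup>4\<close> to its real and imaginary parts.
  Independence of the chosen decomposition is the additivity of the Dixmier trace.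
\<close>

section \<open>The Hilbert space as a type\<close>

text \<open>\<open>absop\<close>, \<open>singvals\<close>, \<open>dixmier_trace\<close> and the
  state inside \<open>ncint\<close> are all picked by \<open>SOME\<close>. Before any of them can be
  computed, a candidate must be exhibited, and then all candidates must be shown to give the same
  value. This shapes the first half: eigenvectors of compact positive operators, a square root of
  \<open>T* T\<close> built from them, the fact that a decreasing null sequence is fixed by its
  multiplicities, independence of the decomposition into positive parts, and a state found by
  compactness. The comparison of positive roots goes through their eigenspaces for positive
  eigenvalues, because \<open>singvals\<close> reads nothing else.

  For an operator that is not positive, its modulus has no explicit matrix. What survives is that
  the modulus and the operator have the same norm on every vector; this transports the decay on
  basis vectors, and membership in the trace ideal follows from the upper estimate alone.

  The ball radius is balanced so that the Cauchy-Schwarz error \<open>sqrt N / R ^ 2\<close> stays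
  bounded while its volume stays within the \<open>N\<close> vectors that Ky Fan allows. A bounded
  error is harmless after division by \<open>log N\<close>.\<close>

lemma l2_iff_bdd: "x \<in> l2 \<longleftrightarrow> (\<exists>B. \<forall>F. finite F \<longrightarrow> (\<Sum>l\<in>F. (cmod (x l))\<^sup>2) \<le> B)"
proof
  assume "x \<in> l2"
  then have s: "(\<lambda>l. (cmod (x l))^2) summable_on UNIV" by (simp add: l2_def)
  show "\<exists>B. \<forall>F. finite F \<longrightarrow> (\<Sum>l\<in>F. (cmod (x l))\<^sup>2) \<le> B"
    by (intro exI[of _ "\<Sum>\<^sub>\<infinity>l. (cmod (x l))^2"] allI impI finite_sum_le_infsum[OF s]) auto
next
  assume "\<exists>B. \<forall>F. finite F \<longrightarrow> (\<Sum>l\<in>F. (cmod (x l))\<^sup>2) \<le> B"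
  then obtain B where "\<And>F. finite F \<Longrightarrow> (\<Sum>l\<in>F. (cmod (x l))\<^sup>2) \<le> B" by blast
  then show "x \<in> l2" unfolding l2_def
    by (auto intro!: nonneg_bounded_partial_sums_imp_summable_on[where C=B] eventually_finite_subsets_at_top_weakI)
qed

lemma l2_summable_product:
  assumes "x \<in> l2" "y \<in> l2"
  shows "(\<lambda>l. norm (x l * cnj (y l))) summable_on UNIV"
  using abs_summable_product[of x UNIV "\<lambda>l. cnj (y l)"] assms
  by (simp add: l2_def norm_power flip: power2_eq_square)

lemma l2_summable_inner:
  assumes "x \<in> l2" "y \<in> l2"
  shows "(\<lambda>l. x l * cnj (y l)) summable_on UNIV"
  using l2_summable_product[OF assms] by (rule abs_summable_summable)

lemma l2_zero: "(\<lambda>l. 0) \<in> l2"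
  by (simp add: l2_def)

lemma l2_scale: "x \<in> l2 \<Longrightarrow> (\<lambda>l. c * x l) \<in> l2"
  unfolding l2_def by (simp add: norm_mult power_mult_distrib summable_on_cmult_right)

lemma l2_add:
  assumes "x \<in> l2" "y \<in> l2" shows "(\<lambda>l. x l + y l) \<in> l2"
proof -
  have "(\<lambda>l. 2 * (cmod (x l))\<^sup>2 + 2 * (cmod (y l))\<^sup>2) summable_on UNIV"
    using assms unfolding l2_def by (intro summable_on_add summable_on_cmult_right) auto
  moreover have "(cmod (x l + y l))\<^sup>2 \<le> 2 * (cmod (x l))\<^sup>2 + 2 * (cmod (y l))\<^sup>2" for l
  proof -
    have "(cmod (x l + y l))\<^sup>2 \<le> (cmod (x l) + cmod (y l))\<^sup>2"
      by (intro power_mono norm_triangle_ineq) auto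
    also have "\<dots> \<le> 2 * (cmod (x l))\<^sup>2 + 2 * (cmod (y l))\<^sup>2"
      using sum_squares_bound[of "cmod (x l)" "cmod (y l)"] by (simp add: power2_sum)
    finally show ?thesis .
  qed
  ultimately show ?thesis unfolding l2_def
    by (auto intro: summable_on_comparison_test)
qed

lemma l2_uminus: "x \<in> l2 \<Longrightarrow> (\<lambda>l. - x l) \<in> l2"
  using l2_scale[of x "-1"] by simp

lemma l2_diff: "x \<in> l2 \<Longrightarrow> y \<in> l2 \<Longrightarrow> (\<lambda>l. x l - y l) \<in> l2"
  using l2_add[OF _ l2_uminus, of x y] by simp

text \<open>A type gives access to the library theory of inner product spaces. Its classes are real,
  so the complex structure is carried by \<open>scaleC\<close> and \<open>cinner\<close>, and
  \<open>inner\<close> is the real part of \<open>cinner\<close>.\<close>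

typedef ell2 = l2
  using l2_zero by blast

setup_lifting type_definition_ell2

instantiation ell2 :: real_vector
begin
lift_definition zero_ell2 :: ell2 is "\<lambda>l. 0" by (rule l2_zero)
lift_definition plus_ell2 :: "ell2 \<Rightarrow> ell2 \<Rightarrow> ell2" is "\<lambda>x y l. x l + y l" by (rule l2_add)
lift_definition minus_ell2 :: "ell2 \<Rightarrow> ell2 \<Rightarrow> ell2" is "\<lambda>x y l. x l - y l" by (rule l2_diff)
lift_definition uminus_ell2 :: "ell2 \<Rightarrow> ell2" is "\<lambda>x l. - x l" by (rule l2_uminus)
lift_definition scaleR_ell2 :: "real \<Rightarrow> ell2 \<Rightarrow> ell2" is "\<lambda>c x l. complex_of_real c * x l" by (rule l2_scale)
instance
  by (standard; transfer) (auto simp: algebra_simps)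
end

lift_definition scaleC :: "complex \<Rightarrow> ell2 \<Rightarrow> ell2" (infixr \<open>*\<^sub>C\<close> 75) is "\<lambda>c x l. c * x l" by (rule l2_scale)

lift_definition cinner :: "ell2 \<Rightarrow> ell2 \<Rightarrow> complex" is l2inner .

lemma cinner_add_left: "cinner (x + y) z = cinner x z + cinner y z"
  by transfer (simp add: l2inner_def distrib_right infsum_add l2_summable_inner)

lemma cinner_scaleC_left: "cinner (c *\<^sub>C x) y = c * cinner x y"
  by transfer (simp add: l2inner_def mult.assoc infsum_cmult_right')

lemma cinner_commute: "cinner x y = cnj (cinner y x)"
  by transfer (simp add: l2inner_def mult.commute flip: infsum_cnj)

lemma cinner_add_right: "cinner x (y + z) = cinner x y + cinner x z"
  by (metis cinner_add_left cinner_commute complex_cnj_add)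

lemma cinner_scaleC_right: "cinner x (c *\<^sub>C y) = cnj c * cinner x y"
  by (metis cinner_scaleC_left cinner_commute complex_cnj_mult)

lemma scaleR_conv_scaleC: "r *\<^sub>R x = complex_of_real r *\<^sub>C (x :: ell2)"
  by transfer simp

lemma cinner_self: "cinner x x = complex_of_real (\<Sum>\<^sub>\<infinity>l. (cmod (Rep_ell2 x l))\<^sup>2)"
proof -
  have "cinner x x = (\<Sum>\<^sub>\<infinity>l. complex_of_real ((cmod (Rep_ell2 x l))\<^sup>2))"
    by (simp only: cinner.rep_eq l2inner_def complex_norm_square)
  moreover have "((\<lambda>l. complex_of_real ((cmod (Rep_ell2 x l))\<^sup>2)) has_sum complex_of_real (\<Sum>\<^sub>\<infinity>l. (cmod (Rep_ell2 x l))\<^sup>2)) UNIV"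
    using Rep_ell2[of x] by (intro has_sum_of_real has_sum_infsum) (simp add: l2_def)
  ultimately show ?thesis by (simp add: infsumI)
qed

instantiation ell2 :: real_inner
begin
definition inner_ell2 :: "ell2 \<Rightarrow> ell2 \<Rightarrow> real" where "inner_ell2 x y = Re (cinner x y)"
lift_definition norm_ell2 :: "ell2 \<Rightarrow> real" is l2norm .
definition dist_ell2 :: "ell2 \<Rightarrow> ell2 \<Rightarrow> real" where "dist_ell2 x y = norm (x - y)"
definition sgn_ell2 :: "ell2 \<Rightarrow> ell2" where "sgn_ell2 x = x /\<^sub>R norm x"
definition uniformity_ell2 :: "(ell2 \<times> ell2) filter" where
  "uniformity_ell2 = (INF e\<in>{0<..}. principal {(x, y). dist x y < e})"
definition open_ell2 :: "ell2 set \<Rightarrow> bool" where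
  "open_ell2 U = (\<forall>x\<in>U. \<forall>\<^sub>F (x', y) in uniformity. x' = x \<longrightarrow> y \<in> U)"
instance
proof
  fix x y z :: ell2 and r :: real
  show "inner x y = inner y x"
    unfolding inner_ell2_def by (metis cinner_commute complex_cnj cnj.sel(1))
  show "inner (x + y) z = inner x z + inner y z"
    by (simp add: inner_ell2_def cinner_add_left)
  show "inner (r *\<^sub>R x) y = r * inner x y"
    by (simp add: inner_ell2_def scaleR_conv_scaleC cinner_scaleC_left)
  show "0 \<le> inner x x"
    by (simp add: inner_ell2_def cinner_self infsum_nonneg)
  show "(inner x x = 0) = (x = 0)"
  proof
    assume "inner x x = 0"
    then have 0: "(\<Sum>\<^sub>\<infinity>l. (cmod (Rep_ell2 x l))\<^sup>2) = 0"
      by (simp add: inner_ell2_def cinner_self)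
    have "(\<lambda>l. (cmod (Rep_ell2 x l))\<^sup>2) summable_on UNIV" using Rep_ell2[of x] by (simp add: l2_def)
    then have "Rep_ell2 x l = 0" for l
      using nonneg_infsum_le_0D[of "\<lambda>l. (cmod (Rep_ell2 x l))\<^sup>2" UNIV l] 0 by auto
    then show "x = 0" by transfer auto
  next
    assume "x = 0"
    then show "inner x x = 0" by (simp add: inner_ell2_def cinner_self zero_ell2.rep_eq)
  qed
  show "norm x = sqrt (inner x x)"
    by (simp add: inner_ell2_def cinner_self norm_ell2.rep_eq l2norm_def)
qed (simp_all add: dist_ell2_def sgn_ell2_def uniformity_ell2_def open_ell2_def)
end

lemma cinner_zero_left [simp]: "cinner 0 y = 0"
  using cinner_add_left[of 0 0 y] by simp

lemma cinner_zero_right [simp]: "cinner y 0 = 0"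
  using cinner_add_right[of y 0 0] by simp

lemma cinner_minus_left: "cinner (- x) y = - cinner x y"
  using cinner_add_left[of x "-x" y] by (simp add: eq_neg_iff_add_eq_0 add.commute)

lemma cinner_minus_right: "cinner x (- y) = - cinner x y"
  using cinner_add_right[of x y "-y"] by (simp add: eq_neg_iff_add_eq_0 add.commute)

lemma cinner_diff_left: "cinner (x - y) z = cinner x z - cinner y z"
  using cinner_add_left[of x "-y" z] by (simp add: cinner_minus_left)

lemma cinner_diff_right: "cinner x (y - z) = cinner x y - cinner x z"
  using cinner_add_right[of x y "-z"] by (simp add: cinner_minus_right)

lemma cinner_sum_left: "cinner (sum f A) y = (\<Sum>i\<in>A. cinner (f i) y)"
  by (induction A rule: infinite_finite_induct) (auto simp: cinner_add_left)

lemma cinner_sum_right: "cinner y (sum f A) = (\<Sum>i\<in>A. cinner y (f i))"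
  by (induction A rule: infinite_finite_induct) (auto simp: cinner_add_right)

lemma cinner_norm: "cinner x x = complex_of_real ((norm x)\<^sup>2)"
  using inner_ge_zero[of x]
  by (simp add: norm_eq_sqrt_inner inner_ell2_def cinner_self)

lemma scaleC_add_right: "c *\<^sub>C (x + y) = c *\<^sub>C x + c *\<^sub>C y"
  by transfer (simp add: algebra_simps)

lemma scaleC_add_left: "(c + d) *\<^sub>C x = c *\<^sub>C x + d *\<^sub>C x"
  by transfer (simp add: algebra_simps)

lemma scaleC_scaleC: "c *\<^sub>C d *\<^sub>C x = (c * d) *\<^sub>C x"
  by transfer (simp add: algebra_simps)

lemma scaleC_zero_left [simp]: "0 *\<^sub>C x = 0" and scaleC_one [simp]: "1 *\<^sub>C x = x"
  by (transfer; simp)+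

lemma scaleC_zero_right [simp]: "c *\<^sub>C 0 = 0"
  by transfer simp

lemma scaleC_sum_right: "c *\<^sub>C sum f A = (\<Sum>i\<in>A. c *\<^sub>C f i)"
  by (induction A rule: infinite_finite_induct) (auto simp: scaleC_add_right)

lemma norm_scaleC: "norm (c *\<^sub>C x) = cmod c * norm x"
proof -
  have "complex_of_real ((norm (c *\<^sub>C x))\<^sup>2) = complex_of_real ((cmod c * norm x)\<^sup>2)"
    unfolding cinner_norm[symmetric] cinner_scaleC_left cinner_scaleC_right
    by (simp only: cinner_norm power_mult_distrib of_real_mult complex_norm_square[of c]) (simp add: mult_ac)
  then have "(norm (c *\<^sub>C x))\<^sup>2 = (cmod c * norm x)\<^sup>2" using of_real_eq_iff by blast
  then show ?thesis by (simp add: power2_eq_iff_nonneg)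
qed

text \<open>The real Cauchy-Schwarz inequality controls only a real part, so \<open>x\<close> is
  first rotated by the phase that makes the product real and nonnegative.\<close>

lemma cmod_cinner_le: "cmod (cinner x y) \<le> norm x * norm y"
proof (cases "cinner x y = 0")
  case False
  define c where "c = cnj (cinner x y) / cmod (cinner x y)"
  have "cmod c = 1" using False by (simp add: c_def norm_divide)
  have "complex_of_real (cmod (cinner x y)) = c * cinner x y"
    using False complex_norm_square[of "cinner x y"]
    by (simp add: c_def mult.commute power2_eq_square nonzero_eq_divide_eq)
  then have "cmod (cinner x y) = Re (cinner (c *\<^sub>C x) y)"
    by (metis Re_complex_of_real cinner_scaleC_left)
  also have "\<dots> \<le> norm (c *\<^sub>C x) * norm y"
    using norm_cauchy_schwarz[of "c *\<^sub>C x" y] by (simp add: inner_ell2_def)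
  finally show ?thesis using \<open>cmod c = 1\<close> by (simp add: norm_scaleC)
qed simp

lemma norm_ell2_sq: "(norm x)\<^sup>2 = (\<Sum>\<^sub>\<infinity>l. (cmod (Rep_ell2 x l))\<^sup>2)"
  by (simp add: norm_ell2.rep_eq l2norm_def infsum_nonneg)

lemma has_sum_norm_sq: "((\<lambda>l. (cmod (Rep_ell2 x l))\<^sup>2) has_sum (norm x)\<^sup>2) UNIV"
  unfolding norm_ell2_sq using Rep_ell2[of x] by (simp add: l2_def)

lemma sum_le_norm_sq: "finite F \<Longrightarrow> (\<Sum>l\<in>F. (cmod (Rep_ell2 x l))\<^sup>2) \<le> (norm x)\<^sup>2"
  by (rule finite_sum_le_has_sum[OF has_sum_norm_sq]) auto

lemma cmod_Rep_le: "cmod (Rep_ell2 x l) \<le> norm x"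
  using sum_le_norm_sq[of "{l}" x] by (simp add: power2_le_iff_abs_le)

lemma norm_sq_le_bounded_sums:
  assumes "\<And>F. finite F \<Longrightarrow> (\<Sum>l\<in>F. (cmod (Rep_ell2 x l))\<^sup>2) \<le> B"
  shows "(norm x)\<^sup>2 \<le> B"
  by (rule has_sum_le_finite_sums[OF has_sum_norm_sq]) (use assms in auto)

instance ell2 :: complete_space
proof
  fix X :: "nat \<Rightarrow> ell2" assume X: "Cauchy X"
  have pc: "Cauchy (\<lambda>n. Rep_ell2 (X n) l)" for l
  proof (rule CauchyI)
    fix e :: real assume "0 < e"
    then obtain M where M: "\<And>m n. m \<ge> M \<Longrightarrow> n \<ge> M \<Longrightarrow> norm (X m - X n) < e"
      using CauchyD[OF X] by blast
    show "\<exists>M. \<forall>m\<ge>M. \<forall>n\<ge>M. cmod (Rep_ell2 (X m) l - Rep_ell2 (X n) l) < e"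
      using le_less_trans[OF cmod_Rep_le[of "X _ - X _" l] M]
      by (intro exI[of _ M]) (simp add: minus_ell2.rep_eq)
  qed
  then have "\<forall>l. \<exists>z. (\<lambda>n. Rep_ell2 (X n) l) \<longlonglongrightarrow> z"
    unfolding Cauchy_convergent_iff convergent_def by blast
  then obtain y where y: "\<And>l. (\<lambda>n. Rep_ell2 (X n) l) \<longlonglongrightarrow> y l"
    by (auto dest!: choice)
  \<comment> \<open>The Cauchy bound is taken over a fixed finite set while \<open>n\<close> tends
    to infinity, as in Fatou's lemma. It yields both membership of the pointwise limit in
    \<open>l2\<close> and convergence in norm.\<close>
  have est: "\<exists>M. \<forall>m\<ge>M. \<forall>F. finite F \<longrightarrow> (\<Sum>l\<in>F. (cmod (Rep_ell2 (X m) l - y l))\<^sup>2) \<le> e\<^sup>2" if "e > 0" for e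
  proof -
    obtain M where M: "\<And>m n. m \<ge> M \<Longrightarrow> n \<ge> M \<Longrightarrow> norm (X m - X n) < e"
      using CauchyD[OF X] \<open>e > 0\<close> by blast
    have "(\<Sum>l\<in>F. (cmod (Rep_ell2 (X m) l - y l))\<^sup>2) \<le> e\<^sup>2" if "m \<ge> M" "finite F" for m F
    proof (rule LIMSEQ_le_const2)
      show "(\<lambda>n. \<Sum>l\<in>F. (cmod (Rep_ell2 (X m) l - Rep_ell2 (X n) l))\<^sup>2) \<longlonglongrightarrow> (\<Sum>l\<in>F. (cmod (Rep_ell2 (X m) l - y l))\<^sup>2)"
        by (intro tendsto_intros y)
      have "(\<Sum>l\<in>F. (cmod (Rep_ell2 (X m) l - Rep_ell2 (X n) l))\<^sup>2) \<le> e\<^sup>2" if "n \<ge> M" for n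
      proof -
        have "(\<Sum>l\<in>F. (cmod (Rep_ell2 (X m) l - Rep_ell2 (X n) l))\<^sup>2) \<le> (norm (X m - X n))\<^sup>2"
          using sum_le_norm_sq[OF \<open>finite F\<close>, of "X m - X n"] by (simp add: minus_ell2.rep_eq)
        also have "\<dots> \<le> e\<^sup>2" using M[OF \<open>m \<ge> M\<close> \<open>n \<ge> M\<close>] by (intro power_mono) auto
        finally show ?thesis .
      qed
      then show "\<exists>N. \<forall>n\<ge>N. (\<Sum>l\<in>F. (cmod (Rep_ell2 (X m) l - Rep_ell2 (X n) l))\<^sup>2) \<le> e\<^sup>2" by blast
    qed
    then show ?thesis by blast
  qed
  obtain M where M: "\<And>F. finite F \<Longrightarrow> (\<Sum>l\<in>F. (cmod (Rep_ell2 (X M) l - y l))\<^sup>2) \<le> 1\<^sup>2"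
    using est[of 1] by auto
  then have "(\<lambda>l. Rep_ell2 (X M) l - y l) \<in> l2" unfolding l2_iff_bdd by blast
  from l2_diff[OF Rep_ell2[of "X M"] this] have yl2: "y \<in> l2" by simp
  define Y where "Y = Abs_ell2 y"
  have RY: "Rep_ell2 Y = y" using yl2 by (simp add: Y_def Abs_ell2_inverse)
  have "X \<longlonglongrightarrow> Y"
  proof (rule LIMSEQ_I)
    fix r :: real assume "0 < r"
    then obtain M where M: "\<And>m F. m \<ge> M \<Longrightarrow> finite F \<Longrightarrow> (\<Sum>l\<in>F. (cmod (Rep_ell2 (X m) l - y l))\<^sup>2) \<le> (r/2)\<^sup>2"
      using est[of "r/2"] by auto
    have "norm (X m - Y) < r" if "m \<ge> M" for m
    proof -
      have "(norm (X m - Y))\<^sup>2 \<le> (r/2)\<^sup>2"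
        by (rule norm_sq_le_bounded_sums) (use M[OF that] in \<open>auto simp: minus_ell2.rep_eq RY\<close>)
      then have "norm (X m - Y) \<le> r/2" using \<open>0 < r\<close> by (simp add: power2_le_iff_abs_le)
      then show ?thesis using \<open>0 < r\<close> by simp
    qed
    then show "\<exists>no. \<forall>n\<ge>no. norm (X n - Y) < r" by blast
  qed
  then show "convergent X" by (auto simp: convergent_def)
qed

section \<open>Eigenvectors of compact positive operators\<close>

text \<open>A maximising sequence of the quadratic form on the unit ball of \<open>V\<close>
  consists of approximate eigenvectors, by \<open>est\<close> in the proof. Compactness makes its
  images converge along a subsequence, and \<open>m > 0\<close> lets the vectors themselves
  converge. If \<open>m = 0\<close>, the zero vector is returned, so that the greedy construction
  built on this never has to stop.\<close>

lemma compact_positive_max: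
  fixes S :: "'a::{real_inner,complete_space} \<Rightarrow> 'a"
  assumes bl: "bounded_linear S"
    and sa: "\<And>x y. inner (S x) y = inner x (S y)"
    and pos: "\<And>x. 0 \<le> inner (S x) x"
    and cpt: "\<And>x::nat \<Rightarrow> 'a. (\<And>k. norm (x k) \<le> 1) \<Longrightarrow> \<exists>r::nat\<Rightarrow>nat. strict_mono r \<and> Cauchy (\<lambda>k. S (x (r k)))"
    and V: "subspace V" "closed V" "\<And>x. x \<in> V \<Longrightarrow> S x \<in> V"
  obtains m x where "0 \<le> m" "x \<in> V" "\<And>y. y \<in> V \<Longrightarrow> inner (S y) y \<le> m * (norm y)\<^sup>2"
    "m = 0 \<and> x = 0 \<or> m > 0 \<and> norm x = 1 \<and> S x = m *\<^sub>R x"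
proof -
  interpret S: bounded_linear S by (rule bl)
  define B where "B = {y\<in>V. norm y \<le> 1}"
  define m where "m = (SUP y\<in>B. inner (S y) y)"
  have 0: "0 \<in> B" using V(1) by (simp add: B_def subspace_0)
  obtain K where K: "K > 0" "\<And>x. norm (S x) \<le> norm x * K" using S.pos_bounded by blast
  have bdd: "bdd_above ((\<lambda>y. inner (S y) y) ` B)"
  proof (rule bdd_aboveI2)
    fix y assume "y \<in> B"
    then have y: "norm y \<le> 1" by (simp add: B_def)
    have "inner (S y) y \<le> norm (S y) * norm y" by (rule norm_cauchy_schwarz)
    also have "\<dots> \<le> (1 * K) * 1"
      using K y by (intro mult_mono order_trans[OF K(2)]) (auto intro: mult_right_mono)
    finally show "inner (S y) y \<le> K" by simp
  qed
  have le_m: "inner (S y) y \<le> m" if "y \<in> B" for y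
    unfolding m_def using that bdd by (rule cSUP_upper)
  have m0: "0 \<le> m" using le_m[OF 0] by (simp add: S.zero)
  have quad: "inner (S y) y \<le> m * (norm y)\<^sup>2" if "y \<in> V" for y
  proof (cases "y = 0")
    case False
    have "(1 / norm y) *\<^sub>R y \<in> B"
      using that False V(1) by (simp add: B_def subspace_scale)
    from le_m[OF this] False show ?thesis
      by (simp add: S.scaleR field_simps power2_eq_square)
  qed (simp add: S.zero)
  show ?thesis
  proof (cases "m = 0")
    case True
    show ?thesis by (rule that[of 0 0]) (use True quad V(1) in \<open>auto simp: subspace_0\<close>)
  next
    case False
    with m0 have mpos: "m > 0" by simp
    have est: "(norm (S x - m *\<^sub>R x))\<^sup>2 \<le> m * (m - inner (S x) x)" if "x \<in> B" for x
    proof -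
      have xV: "x \<in> V" "norm x \<le> 1" using that by (auto simp: B_def)
      \<comment> \<open>Positivity is tested at \<open>x - S x / m\<close>. Since \<open>S x\<close>
        lies in \<open>V\<close>, the maximality of \<open>m\<close> bounds the last term, and what
        is left is \<open>norm (S x) ^ 2 \<le> m * inner (S x) x\<close>.\<close>
      have "0 \<le> inner (S (x - (1/m) *\<^sub>R S x)) (x - (1/m) *\<^sub>R S x)" by (rule pos)
      also have "\<dots> = inner (S x) x - 2 / m * (norm (S x))\<^sup>2 + 1 / m^2 * inner (S (S x)) (S x)"
        using sa[of "S x" x] unfolding power2_norm_eq_inner
        by (simp add: S.diff S.scaleR inner_diff_left inner_diff_right inner_commute power2_eq_square field_simps)
      also have "\<dots> \<le> inner (S x) x - 2 / m * (norm (S x))\<^sup>2 + 1 / m^2 * (m * (norm (S x))\<^sup>2)"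
        using quad[OF V(3)[OF xV(1)]] mpos by (intro add_left_mono mult_left_mono) auto
      also have "\<dots> = inner (S x) x - (norm (S x))\<^sup>2 / m"
        using mpos by (simp add: field_simps power2_eq_square)
      finally have *: "(norm (S x))\<^sup>2 \<le> m * inner (S x) x" using mpos by (simp add: field_simps)
      have "(norm (S x - m *\<^sub>R x))\<^sup>2 = (norm (S x))\<^sup>2 - 2 * m * inner (S x) x + m\<^sup>2 * (norm x)\<^sup>2"
        unfolding power2_norm_eq_inner
        by (simp add: inner_diff_left inner_diff_right inner_commute power2_eq_square algebra_simps)
      also have "\<dots> \<le> m * inner (S x) x - 2 * m * inner (S x) x + m\<^sup>2 * 1"
        using * xV(2) by (intro add_mono diff_right_mono mult_left_mono) (auto simp: power_le_one)
      finally show ?thesis by (simp add: algebra_simps power2_eq_square)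
    qed
    have "\<exists>x\<in>B. m - 1 / real (Suc k) < inner (S x) x" for k
      using less_cSUP_iff[OF _ bdd, of "m - 1 / real (Suc k)"] 0 by (auto simp: m_def)
    then obtain X where X: "\<And>k. X k \<in> B" "\<And>k. m - 1 / real (Suc k) < inner (S (X k)) (X k)"
      by metis
    have X1: "norm (X k) \<le> 1" "X k \<in> V" for k using X(1)[of k] by (auto simp: B_def)
    obtain r where r: "strict_mono r" "Cauchy (\<lambda>k. S (X (r k)))" using cpt[of X] X1 by blast
    then obtain y where y: "(\<lambda>k. S (X (r k))) \<longlonglongrightarrow> y" by (auto simp: Cauchy_convergent_iff convergent_def)
    have "(\<lambda>k. (norm (S (X k) - m *\<^sub>R X k))\<^sup>2) \<longlonglongrightarrow> 0"
    proof (rule tendsto_sandwich[where f="\<lambda>_. 0" and h="\<lambda>k. m * (1 / real (Suc k))"])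
      show "\<forall>\<^sub>F k in sequentially. (norm (S (X k) - m *\<^sub>R X k))\<^sup>2 \<le> m * (1 / real (Suc k))"
      proof (rule always_eventually, rule allI)
        fix k
        show "(norm (S (X k) - m *\<^sub>R X k))\<^sup>2 \<le> m * (1 / real (Suc k))"
          using est[OF X(1)[of k]] X(2)[of k] mpos mult_left_mono[of "m - inner (S (X k)) (X k)" "1 / real (Suc k)" m] by linarith
      qed
      show "(\<lambda>k. m * (1 / real (Suc k))) \<longlonglongrightarrow> 0"
        using tendsto_mult[OF tendsto_const[of m] LIMSEQ_inverse_real_of_nat] by (simp add: inverse_eq_divide)
    qed auto
    then have "(\<lambda>k. sqrt ((norm (S (X k) - m *\<^sub>R X k))\<^sup>2)) \<longlonglongrightarrow> sqrt 0" by (rule tendsto_real_sqrt)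
    then have "(\<lambda>k. S (X k) - m *\<^sub>R X k) \<longlonglongrightarrow> 0" by (simp add: tendsto_norm_zero_iff)
    from LIMSEQ_subseq_LIMSEQ[OF this r(1)] have "(\<lambda>k. S (X (r k)) - m *\<^sub>R X (r k)) \<longlonglongrightarrow> 0" by (simp add: o_def)
    from tendsto_diff[OF y this] have "(\<lambda>k. m *\<^sub>R X (r k)) \<longlonglongrightarrow> y" by simp
    from tendsto_scaleR[OF tendsto_const[of "1/m"] this]
    have lim: "(\<lambda>k. X (r k)) \<longlonglongrightarrow> (1/m) *\<^sub>R y" using mpos by simp
    define x where "x = (1/m) *\<^sub>R y"
    have xV: "x \<in> V" unfolding x_def
      by (rule closed_sequentially[OF V(2) _ lim]) (use X1 in auto)
    have "(\<lambda>k. S (X (r k))) \<longlonglongrightarrow> S x" unfolding x_def by (rule S.tendsto[OF lim])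
    with y have "S x = y" using LIMSEQ_unique by blast
    then have Sx: "S x = m *\<^sub>R x" using mpos by (simp add: x_def)
    have "norm x \<le> 1" using lim X1 unfolding x_def[symmetric]
      by (intro Lim_bounded[OF tendsto_norm[OF lim[folded x_def]], of 0]) auto
    have *: "(\<lambda>k. inner (S (X (r k))) (X (r k))) \<longlonglongrightarrow> inner (S x) x"
      by (intro tendsto_inner S.tendsto lim[folded x_def])
    have "(\<lambda>k. m - 1 / real (Suc (r k))) \<longlonglongrightarrow> m - 0"
      using LIMSEQ_subseq_LIMSEQ[OF LIMSEQ_inverse_real_of_nat r(1)] by (intro tendsto_intros) (simp add: o_def inverse_eq_divide)
    from LIMSEQ_le[OF this *] have "m - 0 \<le> inner (S x) x"
      using X(2) less_imp_le by blast
    then have "m \<le> m * (norm x)\<^sup>2" using quad[OF xV] by simp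
    then have "1 \<le> (norm x)\<^sup>2" using mpos by simp
    then have "norm x \<ge> 1" by (metis abs_norm_cancel one_power2 power2_le_iff_abs_le norm_ge_zero abs_le_square_iff abs_one)
    with \<open>norm x \<le> 1\<close> have "norm x = 1" by simp
    with that[of m x] m0 mpos xV quad Sx show ?thesis by blast
  qed
qed

definition compact_op :: "(ell2 \<Rightarrow> ell2) \<Rightarrow> bool" where
  "compact_op S \<longleftrightarrow> (\<forall>x::nat \<Rightarrow> ell2. (\<forall>k. norm (x k) \<le> 1) \<longrightarrow>
     (\<exists>r::nat\<Rightarrow>nat. strict_mono r \<and> Cauchy (\<lambda>k. S (x (r k)))))"

definition clinear_op :: "(ell2 \<Rightarrow> ell2) \<Rightarrow> bool" where
  "clinear_op S \<longleftrightarrow> bounded_linear S \<and> (\<forall>c x. S (c *\<^sub>C x) = c *\<^sub>C S x)"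

definition positive_op :: "(ell2 \<Rightarrow> ell2) \<Rightarrow> bool" where
  "positive_op S \<longleftrightarrow> clinear_op S \<and> (\<forall>x y. cinner (S x) y = cinner x (S y)) \<and> (\<forall>x. 0 \<le> inner (S x) x)"

text \<open>A vector \<open>e n\<close> with \<open>\<mu> n = 0\<close> is zero; this lets operators of finite rank be treated uniformly.
  The last clause is the greedy (min-max) choice of the eigenvectors; it replaces infinite expansions.\<close>
definition eigensystem :: "(ell2 \<Rightarrow> ell2) \<Rightarrow> (nat \<Rightarrow> real) \<Rightarrow> (nat \<Rightarrow> ell2) \<Rightarrow> bool" where
  "eigensystem S \<mu> e \<longleftrightarrow> antimono \<mu> \<and> (\<forall>n. 0 \<le> \<mu> n) \<and> \<mu> \<longlonglongrightarrow> 0 \<and>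
     (\<forall>n. S (e n) = \<mu> n *\<^sub>R e n) \<and>
     (\<forall>m n. cinner (e m) (e n) = (if m = n \<and> \<mu> n > 0 then 1 else 0)) \<and>
     (\<forall>N y. (\<forall>n<N. cinner y (e n) = 0) \<longrightarrow> inner (S y) y \<le> \<mu> N * (norm y)\<^sup>2)"

lemma subspace_cinner_zero: "subspace {y. \<forall>f\<in>F. cinner y f = 0}"
  by (auto simp: subspace_def cinner_add_left scaleR_conv_scaleC cinner_scaleC_left)

lemma bounded_linear_cinner_left: "bounded_linear (\<lambda>y. cinner y f)"
  by (rule bounded_linear_intro[of _ "norm f"])
     (auto simp: cinner_add_left scaleR_conv_scaleC cinner_scaleC_left cmod_cinner_le scaleR_conv_of_real)

lemma bounded_linear_cinner_right: "bounded_linear (\<lambda>y. cinner f y)"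
  by (rule bounded_linear_intro[of _ "norm f"])
     (auto simp: cinner_add_right scaleR_conv_scaleC cinner_scaleC_right cmod_cinner_le scaleR_conv_of_real mult.commute
       intro: order_trans[OF cmod_cinner_le])

lemmas tendsto_cinner_left = bounded_linear.tendsto[OF bounded_linear_cinner_left]
lemmas tendsto_cinner_right = bounded_linear.tendsto[OF bounded_linear_cinner_right]

lemma closed_cinner_zero: "closed {y. \<forall>f\<in>F. cinner y f = 0}"
proof -
  have "closed {y. cinner y f = 0}" for f
    using continuous_closed_vimage[of "{0}" "\<lambda>y. cinner y f"]
    by (simp add: linear_continuous_at bounded_linear_cinner_left vimage_def)
  then have "closed (\<Inter>f\<in>F. {y. cinner y f = 0})" by blast
  moreover have "(\<Inter>f\<in>F. {y. cinner y f = 0}) = {y. \<forall>f\<in>F. cinner y f = 0}" by auto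
  ultimately show ?thesis by simp
qed

text \<open>Each \<open>pick\<close> maximises the quadratic form on the complex orthogonal
  complement of the vectors already chosen. This complement is invariant because \<open>S\<close> is
  self-adjoint and the chosen vectors are eigenvectors; hence being eigenvectors is the invariant
  carried along the recursion.\<close>

lemma eigensystem_exists:
  assumes S: "positive_op S" "compact_op S"
  obtains \<mu> e where "eigensystem S \<mu> e"
proof -
  have bl: "bounded_linear S" and cl: "\<And>c x. S (c *\<^sub>C x) = c *\<^sub>C S x"
    and csa: "\<And>x y. cinner (S x) y = cinner x (S y)" and pos: "\<And>x. 0 \<le> inner (S x) x"
    using S(1) by (auto simp: positive_op_def clinear_op_def)
  have sa: "inner (S x) y = inner x (S y)" for x y by (simp add: inner_ell2_def csa)
  define V where "V = (\<lambda>F. {y. \<forall>f\<in>F. cinner y f = 0})"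
  define good where "good = (\<lambda>F (p :: real \<times> ell2). 0 \<le> fst p \<and> snd p \<in> V F \<and>
     (\<forall>y\<in>V F. inner (S y) y \<le> fst p * (norm y)\<^sup>2) \<and>
     (fst p = 0 \<and> snd p = 0 \<or> fst p > 0 \<and> norm (snd p) = 1 \<and> S (snd p) = fst p *\<^sub>R snd p))"
  define pick where "pick = (\<lambda>F. SOME p. good F p)"
  define G where "G = rec_nat {} (\<lambda>n F. insert (snd (pick F)) F)"
  define \<mu> where "\<mu> = (\<lambda>n. fst (pick (G n)))"
  define e where "e = (\<lambda>n. snd (pick (G n)))"
  have pick: "good F (pick F)" if F: "\<And>f. f \<in> F \<Longrightarrow> \<exists>c. S f = c *\<^sub>R f" for F
  proof -
    have inv: "S y \<in> V F" if y: "y \<in> V F" for y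
    proof -
      have "cinner (S y) f = 0" if "f \<in> F" for f
      proof -
        obtain c where "S f = c *\<^sub>R f" using F \<open>f \<in> F\<close> by blast
        then show ?thesis using y \<open>f \<in> F\<close> by (simp add: V_def csa scaleR_conv_scaleC cinner_scaleC_right)
      qed
      then show ?thesis by (simp add: V_def)
    qed
    obtain m x where "0 \<le> m" "x \<in> V F" "\<And>y. y \<in> V F \<Longrightarrow> inner (S y) y \<le> m * (norm y)\<^sup>2"
      "m = 0 \<and> x = 0 \<or> m > 0 \<and> norm x = 1 \<and> S x = m *\<^sub>R x"
      by (rule compact_positive_max[OF bl sa pos, of "V F"])
         (use S(2) inv in \<open>auto simp: compact_op_def V_def subspace_cinner_zero closed_cinner_zero\<close>)
    then have "good F (m, x)" by (auto simp: good_def)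
    then show ?thesis unfolding pick_def by (rule someI)
  qed
  have G0: "G 0 = {}" and GS: "G (Suc n) = insert (e n) (G n)" for n by (auto simp: G_def e_def)
  have Ge: "G n = e ` {..<n}" for n by (induction n) (auto simp: G0 GS lessThan_Suc)
  have Geig: "\<forall>f\<in>G n. \<exists>c. S f = c *\<^sub>R f" for n
  proof (induction n)
    case (Suc n)
    from pick[of "G n"] Suc have "good (G n) (pick (G n))" by blast
    then have "S (e n) = \<mu> n *\<^sub>R e n"
      using bounded_linear.linear[OF bl] by (auto simp: good_def e_def \<mu>_def linear_0)
    then show ?case using Suc by (auto simp: GS)
  qed (simp add: G0)
  have good: "good (G n) (\<mu> n, e n)" for n
    using pick[of "G n"] Geig[of n] by (auto simp: \<mu>_def e_def)
  have \<mu>0: "0 \<le> \<mu> n" for n using good[of n] by (simp add: good_def)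
  have eig: "S (e n) = \<mu> n *\<^sub>R e n" for n
    using good[of n] bounded_linear.linear[OF bl] by (auto simp: good_def linear_0)
  have ez: "\<mu> n = 0 \<Longrightarrow> e n = 0" for n using good[of n] by (auto simp: good_def)
  have en: "\<mu> n > 0 \<Longrightarrow> norm (e n) = 1" for n using good[of n] by (auto simp: good_def)
  have orth': "cinner (e n) (e m) = 0" if "m < n" for m n
    using good[of n] that by (auto simp: good_def V_def Ge)
  have orth: "cinner (e m) (e n) = (if m = n \<and> \<mu> n > 0 then 1 else 0)" for m n
  proof (cases m n rule: linorder_cases)
    case less then show ?thesis using orth'[of m n] cinner_commute[of "e m" "e n"] by simp
  next
    case greater then show ?thesis using orth'[of n m] by simp
  next
    case equal then show ?thesis using en[of n] ez[of n] \<mu>0[of n] by (auto simp: cinner_norm)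
  qed
  have quad: "inner (S y) y \<le> \<mu> N * (norm y)\<^sup>2" if "\<forall>n<N. cinner y (e n) = 0" for N y
    using good[of N] that by (auto simp: good_def V_def Ge)
  have anti: "antimono \<mu>"
  proof (rule decseq_SucI)
    fix n
    show "\<mu> (Suc n) \<le> \<mu> n"
    proof (cases "\<mu> (Suc n) = 0")
      case False
      then have "\<mu> (Suc n) > 0" using \<mu>0[of "Suc n"] by simp
      then have n1: "norm (e (Suc n)) = 1" by (rule en)
      \<comment> \<open>The next eigenvector is orthogonal to the first \<open>n\<close> ones, so it
        already competed when \<open>\<mu> n\<close> was chosen.\<close>
      have "inner (S (e (Suc n))) (e (Suc n)) \<le> \<mu> n * (norm (e (Suc n)))\<^sup>2"
        by (rule quad) (auto simp: orth)
      then show ?thesis by (simp add: eig n1 power2_norm_eq_inner[symmetric])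
    qed (use \<mu>0 in simp)
  qed
  have "\<exists>n. \<mu> n < c" if c: "c > 0" for c
  proof (rule ccontr)
    assume "\<not> (\<exists>n. \<mu> n < c)"
    then have ge: "\<mu> n \<ge> c" for n by (simp add: not_less)
    then have pos: "\<mu> n > 0" for n using c less_le_trans by blast
    have "norm (e k) \<le> 1" for k using en[OF pos] by simp
    then obtain r where r: "strict_mono r" "Cauchy (\<lambda>k. S (e (r k)))"
      using S(2) unfolding compact_op_def by blast
    obtain M where M: "\<And>m n. m \<ge> M \<Longrightarrow> n \<ge> M \<Longrightarrow> norm (S (e (r m)) - S (e (r n))) < c"
      using CauchyD[OF r(2) c] by blast
    have ne: "r M \<noteq> r (Suc M)" using r(1) by (metis lessI less_irrefl strict_mono_less)
    \<comment> \<open>Images of distinct eigenvectors are orthogonal and have norm at least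
      \<open>c\<close>, so no sequence of them can be Cauchy.\<close>
    have "(norm (S (e (r M)) - S (e (r (Suc M)))))\<^sup>2 = (\<mu> (r M))\<^sup>2 + (\<mu> (r (Suc M)))\<^sup>2"
      using ne pos unfolding power2_norm_eq_inner
      by (simp add: eig inner_diff_left inner_diff_right, simp add: inner_ell2_def orth power2_eq_square)
    also have "\<dots> \<ge> c\<^sup>2 + 0" using ge c by (intro add_mono power_mono) auto
    finally show False using M[of M "Suc M"] power_strict_mono[of "norm (S (e (r M)) - S (e (r (Suc M))))" c 2] c by auto
  qed
  then have lim: "\<mu> \<longlonglongrightarrow> 0"
  proof -
    assume *: "\<And>c. 0 < c \<Longrightarrow> \<exists>n. \<mu> n < c"
    show ?thesis
    proof (rule LIMSEQ_I)
      fix c :: real assume "0 < c"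
      then obtain n where n: "\<mu> n < c" using * by blast
      show "\<exists>no. \<forall>n\<ge>no. norm (\<mu> n - 0) < c"
        using \<mu>0 le_less_trans[OF antimonoD[OF anti] n] by (intro exI[of _ n]) auto
    qed
  qed
  show ?thesis by (rule that[of \<mu> e]) (use anti \<mu>0 lim eig orth quad in \<open>auto simp: eigensystem_def\<close>)
qed


section \<open>Finite orthonormal systems and the Ky Fan principle\<close>

definition orthonormal :: "ell2 set \<Rightarrow> bool" where
  "orthonormal F \<longleftrightarrow> (\<forall>x\<in>F. \<forall>y\<in>F. cinner x y = (if x = y then 1 else 0))"

lemma orthonormal_expansion:
  fixes x :: ell2 and e :: "'i \<Rightarrow> ell2"
  assumes I: "finite I" and orth: "\<And>i j. i \<in> I \<Longrightarrow> j \<in> I \<Longrightarrow> i \<noteq> j \<Longrightarrow> cinner (e i) (e j) = 0"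
    and unit: "\<And>i. i \<in> I \<Longrightarrow> norm (e i) = 1 \<or> e i = 0"
  defines "y \<equiv> x - (\<Sum>i\<in>I. cinner x (e i) *\<^sub>C e i)"
  shows orthonormal_remainder: "\<And>j. j \<in> I \<Longrightarrow> cinner y (e j) = 0"
    and orthonormal_Pythagoras: "(norm x)\<^sup>2 = (\<Sum>i\<in>I. (cmod (cinner x (e i)))\<^sup>2) + (norm y)\<^sup>2"
proof -
  let ?p = "\<Sum>i\<in>I. cinner x (e i) *\<^sub>C e i"
  show rem: "cinner y (e j) = 0" if "j \<in> I" for j
  proof -
    have "cinner ?p (e j) = (\<Sum>i\<in>I. if i = j then cinner x (e j) else 0)"
      unfolding cinner_sum_left
    proof (rule sum.cong[OF refl])
      fix i assume "i \<in> I"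
      then show "cinner (cinner x (e i) *\<^sub>C e i) (e j) = (if i = j then cinner x (e j) else 0)"
        using orth[OF \<open>i \<in> I\<close> that] unit[OF that] by (auto simp: cinner_scaleC_left cinner_norm)
    qed
    also have "\<dots> = cinner x (e j)" using I that by simp
    finally show ?thesis by (simp add: y_def cinner_diff_left)
  qed
  have yp: "cinner y ?p = 0"
    by (simp add: cinner_sum_right cinner_scaleC_right rem)
  have "complex_of_real ((norm x)\<^sup>2) = cinner x ?p + cinner x y"
    unfolding cinner_norm[symmetric] y_def by (simp flip: cinner_add_right)
  also have "cinner x y = cinner ?p y + cinner y y"
    unfolding y_def by (simp flip: cinner_add_left)
  also have "cinner ?p y = 0" using yp cinner_commute[of ?p y] by simp
  also have "cinner x ?p = complex_of_real (\<Sum>i\<in>I. (cmod (cinner x (e i)))\<^sup>2)"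
    unfolding cinner_sum_right of_real_sum
    by (intro sum.cong refl, subst complex_norm_square) (simp add: cinner_scaleC_right mult.commute)
  finally have "complex_of_real ((norm x)\<^sup>2) = complex_of_real ((\<Sum>i\<in>I. (cmod (cinner x (e i)))\<^sup>2) + (norm y)\<^sup>2)"
    by (simp add: cinner_norm)
  then show "(norm x)\<^sup>2 = (\<Sum>i\<in>I. (cmod (cinner x (e i)))\<^sup>2) + (norm y)\<^sup>2" using of_real_eq_iff by blast
qed

lemma orthonormal_norm: "orthonormal F \<Longrightarrow> f \<in> F \<Longrightarrow> norm f = 1"
proof -
  assume "orthonormal F" "f \<in> F"
  then have "complex_of_real ((norm f)\<^sup>2) = complex_of_real 1" unfolding cinner_norm[symmetric] by (simp add: orthonormal_def)
  then have "(norm f)\<^sup>2 = 1" using of_real_eq_iff by blast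
  then show ?thesis by (simp add: power2_eq_1_iff) (metis norm_ge_zero not_one_le_zero neg_0_le_iff_le)
qed

lemma Bessel:
  assumes "finite F" "orthonormal F"
  shows "(\<Sum>f\<in>F. (cmod (cinner x f))\<^sup>2) \<le> (norm x)\<^sup>2"
  using orthonormal_Pythagoras[of F "\<lambda>f. f" x] assms orthonormal_norm[OF assms(2)]
  by (auto simp: orthonormal_def)

lemma cmod_cinner_commute: "cmod (cinner x y) = cmod (cinner y x)"
  by (metis cinner_commute complex_mod_cnj)

text \<open>The span is expressed through expansions because \<open>trace_ge\<close> consumes it in
  that form; linear dependence in \<open>A\<close> merely makes \<open>G\<close> smaller.\<close>

lemma gram_schmidt:
  assumes "finite A"
  shows "\<exists>G. finite G \<and> card G \<le> card A \<and> orthonormal G \<and> (\<forall>a\<in>A. a = (\<Sum>g\<in>G. cinner a g *\<^sub>C g))"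
  using assms
proof (induction A)
  case empty
  show ?case by (intro exI[of _ "{}"]) (auto simp: orthonormal_def)
next
  case (insert a A)
  then obtain G where G: "finite G" "card G \<le> card A" "orthonormal G" "\<And>b. b\<in>A \<Longrightarrow> b = (\<Sum>g\<in>G. cinner b g *\<^sub>C g)" by blast
  define y where "y = a - (\<Sum>g\<in>G. cinner a g *\<^sub>C g)"
  have yG: "cinner y g = 0" if "g \<in> G" for g
    unfolding y_def by (rule orthonormal_remainder[OF G(1) _ _ that]) (use G(3) orthonormal_norm[OF G(3)] in \<open>auto simp: orthonormal_def\<close>)
  have yG': "cinner g y = 0" if "g \<in> G" for g
    using yG[OF that] cinner_commute[of g y] by simp
  show ?case
  proof (cases "y = 0")
    case True
    then show ?thesis using G insert.hyps by (intro exI[of _ G]) (auto simp: y_def)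
  next
    case False
    define u where "u = (1 / norm y) *\<^sub>R y"
    have uu: "cinner u u = 1" using False by (simp add: u_def cinner_norm)
    have uG: "cinner u g = 0" "cinner g u = 0" if "g \<in> G" for g
      using yG[OF that] cinner_commute[of g y] by (auto simp: u_def scaleR_conv_scaleC cinner_scaleC_left cinner_scaleC_right)
    have unG: "u \<notin> G" using uG uu by fastforce
    have on: "orthonormal (insert u G)" using G(3) uu uG by (auto simp: orthonormal_def)
    have "cinner a u *\<^sub>C u = y"
    proof -
      have "cinner a y = cinner y y"
        unfolding y_def[symmetric]
      proof -
        have "cinner (\<Sum>g\<in>G. cinner a g *\<^sub>C g) y = 0"
          using yG yG' by (simp add: cinner_sum_left cinner_scaleC_left)
        then have "cinner (a - y) y = 0" by (simp add: y_def)
        then show "cinner a y = cinner y y" by (simp add: cinner_diff_left)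
      qed
      then have "cinner a u = complex_of_real (norm y)"
        using False by (simp add: u_def scaleR_conv_scaleC cinner_scaleC_right cinner_norm power2_eq_square)
      then show ?thesis using False by (simp add: u_def flip: scaleR_conv_scaleC)
    qed
    then have "a = (\<Sum>g\<in>insert u G. cinner a g *\<^sub>C g)" using G(1) unG by (simp add: y_def)
    moreover have "b = (\<Sum>g\<in>insert u G. cinner b g *\<^sub>C g)" if "b \<in> A" for b
    proof -
      have "cinner b u = 0"
        by (subst G(4)[OF that]) (simp add: cinner_sum_left cinner_scaleC_left uG)
      then show ?thesis using G(1) unG G(4)[OF that] by simp
    qed
    ultimately show ?thesis using G insert.hyps on unG by (intro exI[of _ "insert u G"]) auto
  qed
qed

lemma finite_superlevel:
  fixes \<mu> :: "nat \<Rightarrow> real"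
  assumes "\<mu> \<longlonglongrightarrow> 0" "c > 0" shows "finite {n. c \<le> \<mu> n}"
proof -
  obtain N where N: "\<forall>n\<ge>N. \<mu> n < c"
    using order_tendstoD(2)[OF assms] unfolding eventually_sequentially by blast
  have "{n. c \<le> \<mu> n} \<subseteq> {..<N}"
  proof
    fix n assume "n \<in> {n. c \<le> \<mu> n}"
    then have "\<not> \<mu> n < c" by simp
    then have "\<not> N \<le> n" using N by blast
    then show "n \<in> {..<N}" by simp
  qed
  then show ?thesis by (rule finite_subset) simp
qed

context
  fixes S \<mu> e
  assumes pS: "positive_op S" and es: "eigensystem S \<mu> e"
begin

lemma eigensystem_D:
  shows es_nonneg: "0 \<le> \<mu> n" and es_antimono: "antimono \<mu>" and es_lim: "\<mu> \<longlonglongrightarrow> 0"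
    and es_eig: "S (e n) = \<mu> n *\<^sub>R e n"
    and es_orth: "cinner (e m) (e n) = (if m = n \<and> \<mu> n > 0 then 1 else 0)"
    and es_quad: "(\<And>n. n < N \<Longrightarrow> cinner y (e n) = 0) \<Longrightarrow> inner (S y) y \<le> \<mu> N * (norm y)\<^sup>2"
  using es by (auto simp: eigensystem_def)

lemma es_norm: "norm (e n) = (if \<mu> n > 0 then 1 else 0)"
proof -
  have "complex_of_real ((norm (e n))\<^sup>2) = complex_of_real ((if \<mu> n > 0 then 1 else 0)\<^sup>2)"
    unfolding cinner_norm[symmetric] es_orth by simp
  then have "(norm (e n))\<^sup>2 = (if \<mu> n > 0 then 1 else 0)\<^sup>2" using of_real_eq_iff by blast
  then show ?thesis by (subst (asm) power2_eq_iff_nonneg) auto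
qed

lemma es_unit: "norm (e n) = 1 \<or> e n = 0"
  using es_norm[of n] by (auto split: if_splits)

lemma positive_op_D:
  shows op_bl: "bounded_linear S" and op_scaleC: "S (c *\<^sub>C x) = c *\<^sub>C S x"
    and op_sa: "cinner (S x) y = cinner x (S y)" and op_pos: "0 \<le> inner (S x) x"
  using pS by (auto simp: positive_op_def clinear_op_def)

lemma quad_expansion:
  fixes x :: ell2
  assumes I: "finite I"
  defines "y \<equiv> x - (\<Sum>n\<in>I. cinner x (e n) *\<^sub>C e n)"
  shows "inner (S x) x = (\<Sum>n\<in>I. \<mu> n * (cmod (cinner x (e n)))\<^sup>2) + inner (S y) y"
proof -
  interpret S: bounded_linear S by (rule op_bl)
  let ?p = "\<Sum>n\<in>I. cinner x (e n) *\<^sub>C e n"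
  have rem: "cinner y (e n) = 0" if "n \<in> I" for n
    unfolding y_def by (rule orthonormal_remainder[OF I _ _ that]) (auto simp: es_orth es_unit)
  have Sp: "S ?p = (\<Sum>n\<in>I. (cinner x (e n) * \<mu> n) *\<^sub>C e n)"
    by (simp add: S.sum op_scaleC es_eig scaleR_conv_scaleC scaleC_scaleC)
  have "cinner (S x) x = cinner (S ?p) x + cinner (S y) x"
    by (simp add: y_def S.diff cinner_diff_left)
  also have "cinner (S y) x = cinner (S y) ?p + cinner (S y) y"
    unfolding y_def by (simp flip: cinner_add_right)
  also have "cinner (S y) ?p = 0"
    unfolding op_sa Sp by (simp add: cinner_sum_right cinner_scaleC_right rem)
  also have "cinner (S ?p) x = complex_of_real (\<Sum>n\<in>I. \<mu> n * (cmod (cinner x (e n)))\<^sup>2)"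
    unfolding Sp cinner_sum_left of_real_sum of_real_mult
  proof (intro sum.cong refl)
    fix n
    show "cinner ((cinner x (e n) * complex_of_real (\<mu> n)) *\<^sub>C e n) x = complex_of_real (\<mu> n) * complex_of_real ((cmod (cinner x (e n)))\<^sup>2)"
      unfolding complex_norm_square cinner_scaleC_left using cinner_commute[of "e n" x] by simp
  qed
  finally show ?thesis by (simp add: inner_ell2_def)
qed

lemma quad_ge: "finite I \<Longrightarrow> (\<Sum>n\<in>I. \<mu> n * (cmod (cinner x (e n)))\<^sup>2) \<le> inner (S x) x"
  using quad_expansion[of I x] op_pos by simp

lemma es_Bessel: "finite I \<Longrightarrow> (\<Sum>n\<in>I. (cmod (cinner x (e n)))\<^sup>2) \<le> (norm x)\<^sup>2"
  using orthonormal_Pythagoras[of I e x] by (auto simp: es_orth es_unit)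

text \<open>Splitting off the first \<open>N\<close> eigenvectors leaves a remainder to which the
  greedy clause applies with constant \<open>\<mu> N\<close>. Pythagoras then rewrites the norm of
  the remainder, which turns the weights into \<open>\<mu> n - \<mu> N\<close>.\<close>

lemma quad_le: "inner (S x) x \<le> \<mu> N * (norm x)\<^sup>2 + (\<Sum>n<N. (\<mu> n - \<mu> N) * (cmod (cinner x (e n)))\<^sup>2)"
proof -
  define y where "y = x - (\<Sum>n<N. cinner x (e n) *\<^sub>C e n)"
  have "cinner y (e n) = 0" if "n < N" for n
    unfolding y_def by (rule orthonormal_remainder) (use that in \<open>auto simp: es_orth es_unit\<close>)
  then have "inner (S y) y \<le> \<mu> N * (norm y)\<^sup>2" by (rule es_quad)
  moreover have "(norm x)\<^sup>2 = (\<Sum>n<N. (cmod (cinner x (e n)))\<^sup>2) + (norm y)\<^sup>2"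
    unfolding y_def by (rule orthonormal_Pythagoras) (auto simp: es_orth es_unit)
  moreover have "inner (S x) x = (\<Sum>n<N. \<mu> n * (cmod (cinner x (e n)))\<^sup>2) + inner (S y) y"
    unfolding y_def by (rule quad_expansion) auto
  ultimately show ?thesis
    by (simp add: algebra_simps sum_subtractf flip: sum_distrib_left)
qed

text \<open>In \<open>quad_le\<close> the weights \<open>\<mu> n - \<mu> N\<close> are nonnegative,
  and by Bessel each of them is multiplied by at most 1 after summation over \<open>F\<close>. The
  constants \<open>\<mu> N\<close> occur \<open>card F\<close> times, and
  \<open>card F \<le> N\<close> restores exactly what the weights lost.\<close>

lemma Ky_Fan:
  assumes F: "finite F" "orthonormal F" "card F \<le> N"
  shows "(\<Sum>f\<in>F. inner (S f) f) \<le> (\<Sum>n<N. \<mu> n)"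
proof -
  have "(\<Sum>f\<in>F. inner (S f) f) \<le> (\<Sum>f\<in>F. \<mu> N + (\<Sum>n<N. (\<mu> n - \<mu> N) * (cmod (cinner f (e n)))\<^sup>2))"
  proof (rule sum_mono)
    fix f assume "f \<in> F"
    then show "inner (S f) f \<le> \<mu> N + (\<Sum>n<N. (\<mu> n - \<mu> N) * (cmod (cinner f (e n)))\<^sup>2)"
      using quad_le[of f N] orthonormal_norm[OF F(2)] by simp
  qed
  also have "\<dots> = real (card F) * \<mu> N + (\<Sum>n<N. (\<mu> n - \<mu> N) * (\<Sum>f\<in>F. (cmod (cinner f (e n)))\<^sup>2))"
    by (simp add: sum.distrib sum_distrib_left sum.swap[of _ F])
  also have "\<dots> \<le> real N * \<mu> N + (\<Sum>n<N. (\<mu> n - \<mu> N) * 1)"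
  proof (intro add_mono mult_right_mono sum_mono mult_left_mono)
    fix n assume "n \<in> {..<N}"
    have "(\<Sum>f\<in>F. (cmod (cinner f (e n)))\<^sup>2) \<le> (norm (e n))\<^sup>2"
      using Bessel[OF F(1,2), of "e n"] by (simp add: cmod_cinner_commute)
    also have "\<dots> \<le> 1" using es_unit[of n] by auto
    finally show "(\<Sum>f\<in>F. (cmod (cinner f (e n)))\<^sup>2) \<le> 1" .
    show "0 \<le> \<mu> n - \<mu> N" using antimonoD[OF es_antimono, of n N] \<open>n \<in> {..<N}\<close> by auto
  qed (use F es_nonneg in auto)
  also have "\<dots> = (\<Sum>n<N. \<mu> n)" by (simp add: sum_subtractf)
  finally show ?thesis .
qed

lemma es_inj: "inj_on e {n. \<mu> n > 0}"
proof (rule inj_onI)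
  fix m n assume "m \<in> {n. \<mu> n > 0}" "n \<in> {n. \<mu> n > 0}" "e m = e n"
  then show "m = n" using es_orth[of m n] es_orth[of n n] by (auto split: if_splits)
qed

lemma es_orthonormal: "orthonormal (e ` {n\<in>I. \<mu> n > 0})"
  using es_inj by (auto simp: orthonormal_def es_orth inj_on_def)

lemma es_sum:
  assumes "finite I"
  shows "(\<Sum>f\<in>e ` {n\<in>I. \<mu> n > 0}. g f) = (\<Sum>n\<in>{n\<in>I. \<mu> n > 0}. g (e n))"
  by (subst sum.reindex) (auto intro: inj_on_subset[OF es_inj])

lemma es_quad_eig: "inner (S (e n)) (e n) = \<mu> n"
  using es_norm[of n] es_nonneg[of n] by (auto simp: es_eig power2_norm_eq_inner[symmetric] split: if_splits)

lemma es_trace: "(\<Sum>f\<in>e ` {n\<in>{..<N}. \<mu> n > 0}. inner (S f) f) = (\<Sum>n<N. \<mu> n)"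
  unfolding es_sum[OF finite_lessThan] es_quad_eig
  by (rule sum.mono_neutral_left) (use es_nonneg in \<open>auto simp: less_le\<close>)

text \<open>The counterpart of \<open>Ky_Fan\<close>: if \<open>G\<close> spans the first
  eigenvectors, then each nonzero one has total weight 1 over \<open>G\<close>, by Pythagoras with
  remainder 0. Exchanging the two sums leaves \<open>quad_ge\<close> at each
  \<open>g\<close>.\<close>

lemma trace_ge:
  assumes G: "finite G" "orthonormal G" and sp: "\<And>n. n < N \<Longrightarrow> e n = (\<Sum>g\<in>G. cinner (e n) g *\<^sub>C g)"
  shows "(\<Sum>n<N. \<mu> n) \<le> (\<Sum>g\<in>G. inner (S g) g)"
proof -
  have "(\<Sum>n<N. \<mu> n) = (\<Sum>n<N. \<mu> n * (\<Sum>g\<in>G. (cmod (cinner g (e n)))\<^sup>2))"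
  proof (rule sum.cong[OF refl])
    fix n assume "n \<in> {..<N}"
    have "(norm (e n))\<^sup>2 = (\<Sum>g\<in>G. (cmod (cinner (e n) g))\<^sup>2) + (norm (e n - (\<Sum>g\<in>G. cinner (e n) g *\<^sub>C g)))\<^sup>2"
      by (rule orthonormal_Pythagoras[OF G(1)]) (use G(2) orthonormal_norm[OF G(2)] in \<open>auto simp: orthonormal_def\<close>)
    also have "e n - (\<Sum>g\<in>G. cinner (e n) g *\<^sub>C g) = 0" using sp[of n] \<open>n \<in> {..<N}\<close> by simp
    finally show "\<mu> n = \<mu> n * (\<Sum>g\<in>G. (cmod (cinner g (e n)))\<^sup>2)"
      using es_norm[of n] es_nonneg[of n] by (auto simp: cmod_cinner_commute split: if_splits)
  qed
  also have "\<dots> = (\<Sum>g\<in>G. \<Sum>n<N. \<mu> n * (cmod (cinner g (e n)))\<^sup>2)"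
    by (simp add: sum_distrib_left sum.swap[of _ G])
  also have "\<dots> \<le> (\<Sum>g\<in>G. inner (S g) g)" by (intro sum_mono quad_ge) auto
  finally show ?thesis .
qed

text \<open>No eigenvector for \<open>c\<close> escapes the system: its remainder after projection
  to the \<open>e n\<close> with \<open>\<mu> n = c\<close> is still an eigenvector for
  \<open>c\<close> and orthogonal to every \<open>e n\<close>, so the greedy clause gives
  \<open>c * norm y ^ 2 \<le> \<mu> N * norm y ^ 2\<close> for all \<open>N\<close>, and
  \<open>\<mu>\<close> tends to 0. The cardinalities are then compared by double counting with
  Bessel.\<close>

lemma eigenspace_card:
  assumes c: "c > 0" and F: "finite F" "orthonormal F" "\<And>f. f \<in> F \<Longrightarrow> S f = c *\<^sub>R f"
  shows "card F \<le> card {n. \<mu> n = c}"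
proof -
  let ?I = "{n. \<mu> n = c}"
  have I: "finite ?I" by (rule finite_subset[OF _ finite_superlevel[OF es_lim c]]) auto
  have one: "(\<Sum>n\<in>?I. (cmod (cinner f (e n)))\<^sup>2) = 1" if f: "f \<in> F" for f
  proof -
    define y where "y = f - (\<Sum>n\<in>?I. cinner f (e n) *\<^sub>C e n)"
    interpret S: bounded_linear S by (rule op_bl)
    have fe: "cinner f (e n) = 0" if "\<mu> n \<noteq> c" for n
    proof -
      have "c * cinner f (e n) = \<mu> n * cinner f (e n)"
        using op_sa[of f "e n"] F(3)[OF f] by (simp add: es_eig scaleR_conv_scaleC cinner_scaleC_left cinner_scaleC_right)
      then have "(complex_of_real c - complex_of_real (\<mu> n)) * cinner f (e n) = 0" by (simp add: algebra_simps)
      then show ?thesis using that by auto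
    qed
    have rem: "cinner y (e n) = 0" for n
    proof (cases "\<mu> n = c")
      case True
      show ?thesis unfolding y_def by (rule orthonormal_remainder) (use True I in \<open>auto simp: es_orth es_unit\<close>)
    next
      case False
      then have "cinner (\<Sum>n\<in>?I. cinner f (e n) *\<^sub>C e n) (e n) = 0"
        unfolding cinner_sum_left cinner_scaleC_left by (intro sum.neutral) (auto simp: es_orth)
      then show ?thesis using fe[OF False] by (simp add: y_def cinner_diff_left)
    qed
    have "S (cinner f (e n) *\<^sub>C e n) = c *\<^sub>R (cinner f (e n) *\<^sub>C e n)" if "n \<in> ?I" for n
      using that by (simp add: op_scaleC es_eig scaleR_conv_scaleC scaleC_scaleC mult.commute)
    then have "S y = c *\<^sub>R y" using F(3)[OF f]
      by (simp add: y_def S.diff S.sum scaleR_diff_right scaleR_sum_right)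
    then have "c * (norm y)\<^sup>2 \<le> \<mu> N * (norm y)\<^sup>2" for N
      using es_quad[of N y] rem by (simp add: power2_norm_eq_inner)
    moreover have "(\<lambda>N. \<mu> N * (norm y)\<^sup>2) \<longlonglongrightarrow> 0 * (norm y)\<^sup>2"
      by (intro tendsto_intros es_lim)
    ultimately have "c * (norm y)\<^sup>2 \<le> 0" using LIMSEQ_le_const by fastforce
    then have "y = 0" using c by (simp add: mult_le_0_iff)
    moreover have "(norm f)\<^sup>2 = (\<Sum>n\<in>?I. (cmod (cinner f (e n)))\<^sup>2) + (norm y)\<^sup>2"
      unfolding y_def by (rule orthonormal_Pythagoras) (use I in \<open>auto simp: es_orth es_unit\<close>)
    ultimately show ?thesis using orthonormal_norm[OF F(2) f] by simp
  qed
  have "real (card F) = (\<Sum>f\<in>F. \<Sum>n\<in>?I. (cmod (cinner f (e n)))\<^sup>2)" using one by simp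
  also have "\<dots> = (\<Sum>n\<in>?I. \<Sum>f\<in>F. (cmod (cinner (e n) f))\<^sup>2)"
    by (subst sum.swap) (simp add: cmod_cinner_commute)
  also have "\<dots> \<le> (\<Sum>n\<in>?I. 1)"
  proof (rule sum_mono)
    fix n
    show "(\<Sum>f\<in>F. (cmod (cinner (e n) f))\<^sup>2) \<le> 1"
      using Bessel[OF F(1,2), of "e n"] es_norm[of n] by (auto split: if_splits)
  qed
  finally show ?thesis by simp
qed

end

section \<open>Eigenvalue sums of a sum of positive operators\<close>

lemma positive_op_add:
  assumes "positive_op A" "positive_op B" shows "positive_op (\<lambda>x. A x + B x)"
  using assms by (auto simp: positive_op_def clinear_op_def cinner_add_left cinner_add_right
      inner_add_left scaleC_add_right intro: bounded_linear_add)

text \<open>Both summands are tested on the leading eigenvectors of the sum, where each obeys Ky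
  Fan.\<close>

lemma eigensum_subadd:
  assumes A: "positive_op A" "eigensystem A \<mu> e" and B: "positive_op B" "eigensystem B \<nu> f"
    and C: "eigensystem (\<lambda>x. A x + B x) \<kappa> g"
  shows "(\<Sum>n<N. \<kappa> n) \<le> (\<Sum>n<N. \<mu> n) + (\<Sum>n<N. \<nu> n)"
proof -
  note pC = positive_op_add[OF A(1) B(1)]
  let ?F = "g ` {n\<in>{..<N}. \<kappa> n > 0}"
  have "card {n\<in>{..<N}. \<kappa> n > 0} \<le> card {..<N}" by (rule card_mono) auto
  then have F: "finite ?F" "orthonormal ?F" "card ?F \<le> N"
    using es_orthonormal[OF pC C, of "{..<N}"] card_image_le[of "{n\<in>{..<N}. \<kappa> n > 0}" g] by auto
  have "(\<Sum>n<N. \<kappa> n) = (\<Sum>f\<in>?F. inner (A f) f) + (\<Sum>f\<in>?F. inner (B f) f)"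
    unfolding es_trace[OF pC C, symmetric] by (simp add: inner_add_left sum.distrib)
  also have "\<dots> \<le> (\<Sum>n<N. \<mu> n) + (\<Sum>n<N. \<nu> n)"
    by (intro add_mono Ky_Fan[OF A F] Ky_Fan[OF B F])
  finally show ?thesis .
qed

text \<open>The factor 2 comes from joining the first \<open>N\<close> eigenvectors of both
  operators: an orthonormal basis of their span has at most \<open>2 * N\<close> elements and sees
  the full traces of both by \<open>trace_ge\<close>.\<close>

lemma eigensum_superadd:
  assumes A: "positive_op A" "eigensystem A \<mu> e" and B: "positive_op B" "eigensystem B \<nu> f"
    and C: "eigensystem (\<lambda>x. A x + B x) \<kappa> g"
  shows "(\<Sum>n<N. \<mu> n) + (\<Sum>n<N. \<nu> n) \<le> (\<Sum>n<2*N. \<kappa> n)"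
proof -
  note pC = positive_op_add[OF A(1) B(1)]
  let ?A = "e ` {..<N} \<union> f ` {..<N}"
  have "finite ?A" by simp
  from gram_schmidt[OF this] obtain G where
    "finite G \<and> card G \<le> card ?A \<and> orthonormal G \<and> (\<forall>a\<in>?A. a = (\<Sum>g\<in>G. cinner a g *\<^sub>C g))" ..
  then have G: "finite G" "card G \<le> card ?A" "orthonormal G"
    and sp: "\<forall>a\<in>?A. a = (\<Sum>g\<in>G. cinner a g *\<^sub>C g)" by blast+
  have "e n = (\<Sum>g\<in>G. cinner (e n) g *\<^sub>C g)" "f n = (\<Sum>g\<in>G. cinner (f n) g *\<^sub>C g)" if "n < N" for n
    using that by (intro bspec[OF sp]; simp)+
  note sp = this
  have "card ?A \<le> card (e ` {..<N}) + card (f ` {..<N})" by (rule card_Un_le)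
  also have "\<dots> \<le> N + N" using card_image_le[of "{..<N}" e] card_image_le[of "{..<N}" f] by simp
  finally have "card G \<le> 2 * N" using G(2) by simp
  have "(\<Sum>n<N. \<mu> n) + (\<Sum>n<N. \<nu> n) \<le> (\<Sum>g\<in>G. inner (A g) g) + (\<Sum>g\<in>G. inner (B g) g)"
    by (intro add_mono trace_ge[OF A G(1,3) sp(1)] trace_ge[OF B G(1,3) sp(2)])
  also have "\<dots> = (\<Sum>g\<in>G. inner (A g + B g) g)" by (simp add: inner_add_left sum.distrib)
  also have "\<dots> \<le> (\<Sum>n<2*N. \<kappa> n)" by (rule Ky_Fan[OF pC C G(1,3) \<open>card G \<le> 2 * N\<close>])
  finally show ?thesis .
qed

text \<open>Above a positive level there are only finitely many values, so the number of indices at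
  or above it is a finite sum of multiplicities and agrees for both sequences. These counts
  determine a decreasing sequence. Only \<open>\<mu>\<close> is known to tend to 0; finiteness for
  \<open>\<nu>\<close> is read off from \<open>ecard\<close>.\<close>

lemma antimono_multiplicity_unique:
  fixes \<mu> \<nu> :: "nat \<Rightarrow> real"
  assumes \<mu>: "antimono \<mu>" "\<And>n. 0 \<le> \<mu> n" "\<mu> \<longlonglongrightarrow> 0" and \<nu>: "antimono \<nu>" "\<And>n. 0 \<le> \<nu> n"
    and mult: "\<And>c. c > 0 \<Longrightarrow> ecard {n. \<nu> n = c} = ecard {n. \<mu> n = c}"
  shows "\<nu> = \<mu>"
proof -
  have fin\<mu>: "finite {n. c \<le> \<mu> n}" if "c > 0" for c by (rule finite_superlevel[OF \<mu>(3) that])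
  have fin1: "finite {n. \<mu> n = c}" if "c > 0" for c by (rule finite_subset[OF _ fin\<mu>[OF that]]) auto
  have fin2: "finite {n. \<nu> n = c}" and card2: "card {n. \<nu> n = c} = card {n. \<mu> n = c}" if "c > 0" for c
    using mult[OF that] fin1[OF that] by (auto simp: ecard_def split: if_splits)
  have ex: "\<exists>m. \<mu> m = c" if "c > 0" "\<nu> n = c" for c n
  proof (rule ccontr)
    assume "\<not> (\<exists>m. \<mu> m = c)"
    then have "card {n. \<nu> n = c} = 0" unfolding card2[OF that(1)] by auto
    then show False using fin2[OF that(1)] that(2) by auto
  qed
  have lev: "finite {n. c \<le> \<nu> n} \<and> card {n. c \<le> \<nu> n} = card {n. c \<le> \<mu> n}" if c: "c > 0" for c
  proof -
    let ?V = "\<mu> ` {n. c \<le> \<mu> n}"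
    have V: "finite ?V" "\<And>v. v \<in> ?V \<Longrightarrow> v > 0" using fin\<mu>[OF c] c by auto
    have 1: "{n. c \<le> \<mu> n} = (\<Union>v\<in>?V. {n. \<mu> n = v})" by auto
    have 2: "{n. c \<le> \<nu> n} = (\<Union>v\<in>?V. {n. \<nu> n = v})"
    proof (intro set_eqI iffI)
      fix n assume "n \<in> {n. c \<le> \<nu> n}"
      then have "c \<le> \<nu> n" by simp
      with c have "\<nu> n > 0" by simp
      then obtain m where "\<mu> m = \<nu> n" using ex[of "\<nu> n" n] by blast
      then show "n \<in> (\<Union>v\<in>?V. {n. \<nu> n = v})" using \<open>c \<le> \<nu> n\<close> by (auto intro!: exI[of _ m])
    qed auto
    have "card {n. c \<le> \<nu> n} = (\<Sum>v\<in>?V. card {n. \<nu> n = v})"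
      unfolding 2 by (rule card_UN_disjoint) (use V fin2 in auto)
    also have "\<dots> = (\<Sum>v\<in>?V. card {n. \<mu> n = v})" using V(2) card2 by (intro sum.cong) auto
    also have "\<dots> = card {n. c \<le> \<mu> n}"
      by (subst (2) 1, rule card_UN_disjoint[symmetric]) (use V fin1 in auto)
    finally have "card {n. c \<le> \<nu> n} = card {n. c \<le> \<mu> n}" .
    moreover have "finite {n. c \<le> \<nu> n}"
      unfolding 2 by (intro finite_UN_I V(1) fin2 V(2))
    ultimately show ?thesis by blast
  qed
  \<comment> \<open>At level \<open>b n\<close>, which is positive because
    \<open>0 \<le> a n < b n\<close>, the sequence \<open>a\<close> has at most \<open>n\<close>
    indices and \<open>b\<close> has at least \<open>n + 1\<close>.\<close>
  have half: False if ab: "antimono a" "antimono b" and n: "a n < b n" "0 \<le> a n" and fin: "\<And>c::real. c > 0 \<Longrightarrow> finite {n. c \<le> a n} \<and> finite {n. c \<le> b n} \<and> card {n. c \<le> a n} = card {n. c \<le> b n}"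
    for a b :: "nat \<Rightarrow> real" and n
  proof -
    have f: "finite {m. b n \<le> a m}" "finite {m. b n \<le> b m}" "card {m. b n \<le> a m} = card {m. b n \<le> b m}"
      using fin[of "b n"] n by auto
    have "{m. b n \<le> a m} \<subseteq> {..<n}"
    proof
      fix m assume "m \<in> {m. b n \<le> a m}"
      then show "m \<in> {..<n}" using antimonoD[OF ab(1), of n m] n by (cases "n \<le> m") auto
    qed
    from card_mono[OF finite_lessThan this] have "card {m. b n \<le> a m} \<le> n" by simp
    moreover have "{..n} \<subseteq> {m. b n \<le> b m}" using antimonoD[OF ab(2), of _ n] by auto
    from card_mono[OF f(2) this] have "Suc n \<le> card {m. b n \<le> b m}" by simp
    ultimately show False using f(3) by simp
  qed
  show ?thesis
  proof
    fix n
    have "\<not> \<nu> n < \<mu> n"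
      using half[OF \<nu>(1) \<mu>(1) _ \<nu>(2), of n] lev fin\<mu> by blast
    moreover have "\<not> \<mu> n < \<nu> n"
    proof
      assume "\<mu> n < \<nu> n"
      from half[OF \<mu>(1) \<nu>(1) this \<mu>(2)] show False using lev fin\<mu> by simp
    qed
    ultimately show "\<nu> n = \<mu> n" by simp
  qed
qed

section \<open>Square roots and singular values\<close>

lemma clinear_op_D:
  assumes "clinear_op S"
  shows clinear_op_bl: "bounded_linear S" and clinear_op_scaleC: "S (c *\<^sub>C x) = c *\<^sub>C S x"
  using assms by (auto simp: clinear_op_def)

text \<open>Positivity at \<open>x - S x / K\<close> with a norm bound \<open>K\<close>. It upgrades
  smallness of the quadratic form to smallness of \<open>S y\<close>, which is what the greedy
  clause of an eigensystem alone does not give.\<close>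

lemma positive_op_norm_bound:
  assumes "positive_op S"
  obtains K where "K > 0" "\<And>y. (norm (S y))\<^sup>2 \<le> K * inner (S y) y"
proof -
  have bl: "bounded_linear S" and sa: "\<And>x y. inner (S x) y = inner x (S y)" and pos: "\<And>x. 0 \<le> inner (S x) x"
    using assms by (auto simp: positive_op_def clinear_op_def inner_ell2_def)
  interpret S: bounded_linear S by (rule bl)
  obtain K where K: "K > 0" "\<And>x. norm (S x) \<le> norm x * K" using S.pos_bounded by blast
  have "(norm (S x))\<^sup>2 \<le> K * inner (S x) x" for x
  proof -
    have "0 \<le> inner (S (x - (1/K) *\<^sub>R S x)) (x - (1/K) *\<^sub>R S x)" by (rule pos)
    also have "\<dots> = inner (S x) x - 2 / K * (norm (S x))\<^sup>2 + 1 / K^2 * inner (S (S x)) (S x)"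
      using sa[of "S x" x] K(1) unfolding power2_norm_eq_inner
      by (simp add: S.diff S.scaleR inner_diff_left inner_diff_right inner_commute power2_eq_square field_simps)
    also have "inner (S (S x)) (S x) \<le> (norm (S x) * K) * norm (S x)"
      using K by (intro order_trans[OF norm_cauchy_schwarz] mult_right_mono) auto
    then have "1 / K^2 * inner (S (S x)) (S x) \<le> 1 / K^2 * ((norm (S x) * K) * norm (S x))"
      by (intro mult_left_mono) auto
    finally have "0 \<le> inner (S x) x - 2 / K * (norm (S x))\<^sup>2 + 1 / K^2 * ((norm (S x) * K) * norm (S x))"
      by simp
    then show ?thesis using K(1) by (simp add: field_simps power2_eq_square)
  qed
  then show ?thesis using that K(1) by blast
qed

lemma norm_sq_orthogonal_sum:
  fixes e :: "'i \<Rightarrow> ell2"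
  assumes "finite I" "\<And>i j. i \<in> I \<Longrightarrow> j \<in> I \<Longrightarrow> i \<noteq> j \<Longrightarrow> cinner (e i) (e j) = 0"
  shows "(norm (\<Sum>i\<in>I. a i *\<^sub>C e i))\<^sup>2 = (\<Sum>i\<in>I. (cmod (a i) * norm (e i))\<^sup>2)"
  using assms
proof (induction I)
  case (insert i I)
  let ?s = "\<Sum>j\<in>I. a j *\<^sub>C e j"
  have "cinner (a i *\<^sub>C e i) ?s = 0"
    unfolding cinner_sum_right
  proof (intro sum.neutral ballI)
    fix j assume "j \<in> I"
    then have "cinner (e i) (e j) = 0" using insert.hyps by (intro insert.prems) auto
    then show "cinner (a i *\<^sub>C e i) (a j *\<^sub>C e j) = 0" by (simp add: cinner_scaleC_left cinner_scaleC_right)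
  qed
  then have "inner (a i *\<^sub>C e i) ?s = 0" by (simp add: inner_ell2_def)
  then have "(norm (a i *\<^sub>C e i + ?s))\<^sup>2 = (norm (a i *\<^sub>C e i))\<^sup>2 + (norm ?s)\<^sup>2"
    unfolding power2_norm_eq_inner by (simp add: inner_add_left inner_add_right inner_commute)
  with insert show ?case by (simp add: norm_scaleC)
qed simp

text \<open>The root is the limit of the partial sums \<open>W N\<close> with coefficients
  \<open>sqrt (\<mu> n)\<close>; orthogonality bounds a tail from \<open>N\<close> on by
  \<open>w N * norm x\<close>, so they are Cauchy. That the limit squares to \<open>A\<close>
  follows from the greedy clause: on the remainder after \<open>N\<close> eigenvectors the form of
  \<open>A\<close> is at most \<open>\<mu> N\<close>, and \<open>positive_op_norm_bound\<close>
  turns this into a norm estimate.\<close>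

lemma positive_sqrt_exists:
  assumes A: "positive_op A" "compact_op A"
  obtains S where "positive_op S" "\<And>x. S (S x) = A x"
proof -
  obtain \<mu> e where es: "eigensystem A \<mu> e" using eigensystem_exists[OF A] .
  note [simp] = es_nonneg[OF A(1) es]
  define w where "w n = sqrt (\<mu> n)" for n
  have w0: "0 \<le> w n" and w2: "(w n)\<^sup>2 = \<mu> n" for n by (auto simp: w_def)
  define W where "W N x = (\<Sum>n<N. (w n * cinner x (e n)) *\<^sub>C e n)" for N x
  interpret A: bounded_linear A by (rule op_bl[OF A(1) es])
  have part: "(norm (\<Sum>n\<in>I. (w n * cinner x (e n)) *\<^sub>C e n))\<^sup>2 \<le> \<mu> N * (norm x)\<^sup>2"
    if I: "finite I" "\<And>n. n \<in> I \<Longrightarrow> N \<le> n" for I N x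
  proof -
    have "(norm (\<Sum>n\<in>I. (w n * cinner x (e n)) *\<^sub>C e n))\<^sup>2 = (\<Sum>n\<in>I. (cmod (w n * cinner x (e n)) * norm (e n))\<^sup>2)"
      by (rule norm_sq_orthogonal_sum[OF I(1)]) (simp add: es_orth[OF A(1) es])
    also have "\<dots> \<le> (\<Sum>n\<in>I. \<mu> N * (cmod (cinner x (e n)))\<^sup>2)"
    proof (rule sum_mono)
      fix n assume "n \<in> I"
      have "(cmod (w n * cinner x (e n)) * norm (e n))\<^sup>2 = \<mu> n * (cmod (cinner x (e n)))\<^sup>2 * (norm (e n))\<^sup>2"
        by (simp add: norm_mult power_mult_distrib w2)
      also have "\<dots> \<le> \<mu> n * (cmod (cinner x (e n)))\<^sup>2 * 1"
        using es_unit[OF A(1) es, of n] by (intro mult_left_mono) auto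
      also have "\<dots> \<le> \<mu> N * (cmod (cinner x (e n)))\<^sup>2"
        using antimonoD[OF es_antimono[OF A(1) es] I(2)[OF \<open>n \<in> I\<close>]] by (simp add: mult_right_mono)
      finally show "(cmod (w n * cinner x (e n)) * norm (e n))\<^sup>2 \<le> \<mu> N * (cmod (cinner x (e n)))\<^sup>2" .
    qed
    also have "\<dots> \<le> \<mu> N * (norm x)\<^sup>2"
      unfolding sum_distrib_left[symmetric] by (intro mult_left_mono es_Bessel[OF A(1) es I(1)]) simp
    finally show ?thesis .
  qed
  have Wdiff: "norm (W M x - W N x) \<le> w N * norm x" if "N \<le> M" for N M x
  proof -
    have "W M x - W N x = (\<Sum>n\<in>{N..<M}. (w n * cinner x (e n)) *\<^sub>C e n)"
      unfolding W_def using sum_diff_nat_ivl[of 0 N M "\<lambda>n. (w n * cinner x (e n)) *\<^sub>C e n"] that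
      by (simp add: lessThan_atLeast0)
    then have "(norm (W M x - W N x))\<^sup>2 \<le> (w N * norm x)\<^sup>2"
      using part[of "{N..<M}" N x] by (simp add: power_mult_distrib w2)
    then show ?thesis using w0 by (simp add: power2_le_iff_abs_le)
  qed
  have wlim: "w \<longlonglongrightarrow> 0" using tendsto_real_sqrt[OF es_lim[OF A(1) es]] by (simp add: w_def[abs_def])
  have "convergent (\<lambda>N. W N x)" for x
    unfolding Cauchy_convergent_iff[symmetric]
  proof (rule CauchyI')
    fix r :: real assume "0 < r"
    have "(\<lambda>N. w N * norm x) \<longlonglongrightarrow> 0 * norm x" by (intro tendsto_intros wlim)
    then obtain N0 where N0: "\<forall>N\<ge>N0. w N * norm x < r"
      using order_tendstoD(2)[of _ 0 sequentially r] \<open>0 < r\<close> by (auto simp: eventually_sequentially)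
    have "dist (W m x) (W n x) < r" if "m \<ge> N0" "m < n" for m n
      using Wdiff[of m n x] N0 that by (metis le_less_trans less_imp_le norm_minus_commute dist_norm)
    then show "\<exists>M. \<forall>m\<ge>M. \<forall>n>m. dist (W m x) (W n x) < r" by blast
  qed
  then have "\<forall>x. \<exists>y. (\<lambda>N. W N x) \<longlonglongrightarrow> y" by (simp add: convergent_def)
  then obtain S where S: "\<And>x. (\<lambda>N. W N x) \<longlonglongrightarrow> S x" by (auto dest!: choice)
  have Wnorm: "norm (W N x) \<le> w 0 * norm x" for N x
    using Wdiff[of 0 N x] by (simp add: W_def)
  have add: "S (x + y) = S x + S y" for x y
  proof (rule LIMSEQ_unique[OF S])
    have "W N (x + y) = W N x + W N y" for N
      by (simp add: W_def cinner_add_left distrib_left scaleC_add_left sum.distrib)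
    then show "(\<lambda>N. W N (x + y)) \<longlonglongrightarrow> S x + S y" using tendsto_add[OF S S] by simp
  qed
  have sC: "S (c *\<^sub>C x) = c *\<^sub>C S x" for c x
  proof (rule LIMSEQ_unique[OF S])
    have W: "W N (c *\<^sub>C x) = c *\<^sub>C W N x" for N
      by (simp add: W_def cinner_scaleC_left scaleC_sum_right scaleC_scaleC mult_ac)
    have "bounded_linear (\<lambda>x. c *\<^sub>C x)"
      by (rule bounded_linear_intro[of _ "cmod c"])
         (auto simp: scaleC_add_right scaleR_conv_scaleC scaleC_scaleC mult.commute norm_scaleC)
    from bounded_linear.tendsto[OF this S] show "(\<lambda>N. W N (c *\<^sub>C x)) \<longlonglongrightarrow> c *\<^sub>C S x"
      by (simp add: W)
  qed
  have nS: "norm (S x) \<le> w 0 * norm x" for x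
    by (rule LIMSEQ_le_const2[OF tendsto_norm[OF S]]) (use Wnorm in blast)
  have Wsa: "cinner (W N x) y = cinner x (W N y)" for N x y
    unfolding W_def cinner_sum_left cinner_sum_right cinner_scaleC_left cinner_scaleC_right
    by (intro sum.cong refl) (simp add: cinner_commute[of "e _" y])
  have Wpos: "0 \<le> Re (cinner (W N x) x)" for N x
  proof -
    have "0 \<le> Re (w n * cinner x (e n) * cinner (e n) x)" for n
    proof -
      have "w n * cinner x (e n) * cinner (e n) x = complex_of_real (w n * (cmod (cinner x (e n)))\<^sup>2)"
        unfolding of_real_mult complex_norm_square cinner_commute[of "e n" x] by simp
      then show ?thesis using w0 by (metis Re_complex_of_real mult_nonneg_nonneg zero_le_power2)
    qed
    then show ?thesis unfolding W_def cinner_sum_left cinner_scaleC_left Re_sum by (intro sum_nonneg) blast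
  qed
  have blS: "bounded_linear S"
    using add sC nS by (intro bounded_linear_intro[of _ "w 0"]) (auto simp: scaleR_conv_scaleC mult.commute)
  have saS: "cinner (S x) y = cinner x (S y)" for x y
    by (rule LIMSEQ_unique[OF tendsto_cinner_left[OF S]]) (use tendsto_cinner_right[OF S] in \<open>simp add: Wsa\<close>)
  have "0 \<le> Re (cinner (S x) x)" for x
    by (rule LIMSEQ_le_const[OF tendsto_Re[OF tendsto_cinner_left[OF S]]]) (use Wpos in blast)
  then have pS: "positive_op S"
    using blS sC saS by (auto simp: positive_op_def clinear_op_def inner_ell2_def)
  have Se: "S (e n) = complex_of_real (w n) *\<^sub>C e n" for n
  proof (rule LIMSEQ_unique[OF S])
    have "W N (e n) = complex_of_real (w n) *\<^sub>C e n" if "N > n" for N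
    proof -
      have "W N (e n) = (\<Sum>k<N. if k = n then complex_of_real (w n) *\<^sub>C e n else 0)"
        unfolding W_def
        by (intro sum.cong refl) (use es_unit[OF A(1) es, of n] es_norm[OF A(1) es, of n] in \<open>auto simp: es_orth[OF A(1) es]\<close>)
      then show ?thesis using that by simp
    qed
    then have "\<forall>\<^sub>F N in sequentially. complex_of_real (w n) *\<^sub>C e n = W N (e n)"
      unfolding eventually_sequentially by (intro exI[of _ "Suc n"]) auto
    then show "(\<lambda>N. W N (e n)) \<longlonglongrightarrow> complex_of_real (w n) *\<^sub>C e n"
      by (rule Lim_transform_eventually[OF tendsto_const])
  qed
  define P where "P N x = (\<Sum>n<N. cinner x (e n) *\<^sub>C e n)" for N x
  have ww: "complex_of_real (w n) * (complex_of_real (w n) * z) = complex_of_real (\<mu> n) * z" for n z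
    by (simp add: w2[symmetric] power2_eq_square mult.assoc)
  \<comment> \<open>Moving \<open>S\<close> onto \<open>e n\<close> produces a second factor
    \<open>w n\<close>, so the coefficients become \<open>\<mu> n\<close> and the sum is
    \<open>A\<close> applied to the projection onto the first \<open>N\<close> eigenvectors.\<close>
  have AP: "W N (S x) = A (P N x)" for N x
    by (simp add: W_def P_def A.sum op_scaleC[OF A(1) es] es_eig[OF A(1) es] saS Se cinner_scaleC_right
        scaleR_conv_scaleC scaleC_scaleC ww mult.commute)
  obtain K where K: "K > 0" "\<And>y. (norm (A y))\<^sup>2 \<le> K * inner (A y) y"
    using positive_op_norm_bound[OF A(1)] by blast
  have "S (S x) = A x" for x
  proof (rule LIMSEQ_unique[OF S])
    have b: "(norm (A (P N x) - A x))\<^sup>2 \<le> K * \<mu> N * (norm x)\<^sup>2" for N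
    proof -
      define y where "y = x - P N x"
      have "cinner y (e n) = 0" if "n < N" for n
        unfolding y_def P_def by (rule orthonormal_remainder) (use that in \<open>auto simp: es_orth[OF A(1) es] es_unit[OF A(1) es]\<close>)
      then have q: "inner (A y) y \<le> \<mu> N * (norm y)\<^sup>2" by (rule es_quad[OF A(1) es])
      have "(norm x)\<^sup>2 = (\<Sum>n<N. (cmod (cinner x (e n)))\<^sup>2) + (norm y)\<^sup>2"
        unfolding y_def P_def by (rule orthonormal_Pythagoras) (auto simp: es_orth[OF A(1) es] es_unit[OF A(1) es])
      then have ny: "(norm y)\<^sup>2 \<le> (norm x)\<^sup>2" by (simp add: sum_nonneg)
      have "(norm (A (P N x) - A x))\<^sup>2 = (norm (A y))\<^sup>2"
        by (simp add: y_def A.diff norm_minus_commute)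
      also have "\<dots> \<le> K * (\<mu> N * (norm x)\<^sup>2)"
        using K(1) q ny by (intro order_trans[OF K(2)] mult_left_mono order_trans[OF q] mult_left_mono) auto
      finally show ?thesis by (simp add: mult_ac)
    qed
    have "(\<lambda>N. (norm (A (P N x) - A x))\<^sup>2) \<longlonglongrightarrow> 0"
    proof (rule tendsto_sandwich[where f="\<lambda>_. 0" and h="\<lambda>N. K * \<mu> N * (norm x)\<^sup>2"])
      have "(\<lambda>N. K * \<mu> N * (norm x)\<^sup>2) \<longlonglongrightarrow> K * 0 * (norm x)\<^sup>2" by (intro tendsto_intros es_lim[OF A(1) es])
      then show "(\<lambda>N. K * \<mu> N * (norm x)\<^sup>2) \<longlonglongrightarrow> 0" by simp
    qed (use b in auto)
    from tendsto_real_sqrt[OF this] have "(\<lambda>N. A (P N x) - A x) \<longlonglongrightarrow> 0" by (simp add: tendsto_norm_zero_iff)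
    then show "(\<lambda>N. W N (S x)) \<longlonglongrightarrow> A x" unfolding AP by (simp add: LIM_zero_iff)
  qed
  then show ?thesis using that pS by blast
qed

text \<open>From \<open>T^2 - c^2 = (T + c) (T - c)\<close>, where \<open>T + c\<close> is injective
  since \<open>T\<close> is positive and \<open>c > 0\<close>. Hence all positive roots of one
  operator share their eigenspaces for positive eigenvalues.\<close>

lemma positive_sqrt_eigen:
  assumes S: "positive_op S" and T: "positive_op T" and ST: "\<And>x. S (S x) = T (T x)" and c: "c > 0"
    and x: "S x = c *\<^sub>R x"
  shows "T x = c *\<^sub>R x"
proof -
  interpret T: bounded_linear T using T by (simp add: positive_op_def clinear_op_def)
  interpret S: bounded_linear S using S by (simp add: positive_op_def clinear_op_def)
  define y where "y = T x - c *\<^sub>R x"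
  have "T y + c *\<^sub>R y = T (T x) - c *\<^sub>R c *\<^sub>R x"
    by (simp add: y_def T.diff T.scaleR scaleR_diff_right)
  also have "T (T x) = c *\<^sub>R c *\<^sub>R x" by (simp add: ST[symmetric] x S.scaleR)
  finally have "inner (T y + c *\<^sub>R y) y = 0" by simp
  then have "inner (T y) y + c * (norm y)\<^sup>2 = 0" by (simp add: inner_add_left power2_norm_eq_inner)
  moreover have "0 \<le> inner (T y) y" using T by (simp add: positive_op_def)
  ultimately have "c * (norm y)\<^sup>2 \<le> 0" by linarith
  then have "y = 0" using c by (simp add: mult_le_0_iff)
  then show ?thesis by (simp add: y_def)
qed


section \<open>Transfer of operators between \<open>coeffs\<close> and \<open>ell2\<close>\<close>

definition on_ell2 :: "(coeffs \<Rightarrow> coeffs) \<Rightarrow> ell2 \<Rightarrow> ell2" where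
  "on_ell2 T x = Abs_ell2 (T (Rep_ell2 x))"

definition off_ell2 :: "(ell2 \<Rightarrow> ell2) \<Rightarrow> coeffs \<Rightarrow> coeffs" where
  "off_ell2 S x = Rep_ell2 (S (Abs_ell2 x))"

lemma on_off [simp]: "on_ell2 (off_ell2 S) = S"
  by (auto simp: on_ell2_def off_ell2_def Rep_ell2_inverse fun_eq_iff)

lemma Rep_on_ell2: "h0_bounded T \<Longrightarrow> Rep_ell2 (on_ell2 T x) = T (Rep_ell2 x)"
  unfolding on_ell2_def by (rule Abs_ell2_inverse) (use Rep_ell2 in \<open>auto simp: h0_bounded_def\<close>)

lemma on_ell2_Abs: "x \<in> l2 \<Longrightarrow> on_ell2 T (Abs_ell2 x) = Abs_ell2 (T x)"
  by (simp add: on_ell2_def Abs_ell2_inverse)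

lemma h0_bounded_linear: "h0_bounded T \<Longrightarrow> x \<in> l2 \<Longrightarrow> y \<in> l2 \<Longrightarrow> T (\<lambda>l. c * x l + y l) = (\<lambda>l. c * T x l + T y l)"
  by (simp add: h0_bounded_def)

lemma h0_bounded_clinear:
  assumes T: "h0_bounded T" shows "clinear_op (on_ell2 T)"
proof -
  have lin: "on_ell2 T (c *\<^sub>C x + y) = c *\<^sub>C on_ell2 T x + on_ell2 T y" for c x y
    using h0_bounded_linear[OF T Rep_ell2 Rep_ell2, of c x y]
    by (simp add: Rep_ell2_inject[symmetric] Rep_on_ell2[OF T] plus_ell2.rep_eq scaleC.rep_eq)
  have z: "on_ell2 T 0 = 0" using lin[of 1 0 0] by simp
  have sc: "on_ell2 T (c *\<^sub>C x) = c *\<^sub>C on_ell2 T x" for c x using lin[of c x 0] z by simp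
  obtain K where K: "\<forall>x\<in>l2. l2norm (T x) \<le> K * l2norm x" using T by (auto simp: h0_bounded_def)
  have "norm (on_ell2 T x) \<le> norm x * K" for x
    using K Rep_ell2[of x] by (simp add: norm_ell2.rep_eq Rep_on_ell2[OF T] mult.commute)
  then have "bounded_linear (on_ell2 T)"
    using lin[of 1] sc by (intro bounded_linear_intro) (auto simp: scaleR_conv_scaleC)
  then show ?thesis using sc by (simp add: clinear_op_def)
qed

lemma clinear_h0_bounded:
  assumes S: "clinear_op S" shows "h0_bounded (off_ell2 S)"
proof -
  interpret S: bounded_linear S by (rule clinear_op_bl[OF S])
  obtain K where K: "\<And>x. norm (S x) \<le> norm x * K" using S.bounded by blast
  have "Abs_ell2 (\<lambda>l. c * x l + y l) = c *\<^sub>C Abs_ell2 x + Abs_ell2 y" if "x \<in> l2" "y \<in> l2" for c x y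
    using that l2_add[OF l2_scale[OF that(1)] that(2)]
    by (simp add: Rep_ell2_inject[symmetric] plus_ell2.rep_eq scaleC.rep_eq Abs_ell2_inverse)
  moreover have "l2norm (off_ell2 S x) \<le> K * l2norm x" if "x \<in> l2" for x
    using K[of "Abs_ell2 x"] that by (simp add: norm_ell2.rep_eq off_ell2_def Abs_ell2_inverse mult.commute)
  then have "\<exists>K. \<forall>x\<in>l2. l2norm (off_ell2 S x) \<le> K * l2norm x" by blast
  ultimately show ?thesis
    unfolding h0_bounded_def
    by (simp add: off_ell2_def Rep_ell2 S.add clinear_op_scaleC[OF S] plus_ell2.rep_eq scaleC.rep_eq)
qed

lemma l2cauchy_iff: "l2cauchy (\<lambda>k. Rep_ell2 (X k)) \<longleftrightarrow> Cauchy X"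
  unfolding l2cauchy_def Cauchy_iff by (simp add: norm_ell2.rep_eq minus_ell2.rep_eq)

lemma h0_compact_iff: "h0_compact T \<longleftrightarrow> h0_bounded T \<and> compact_op (on_ell2 T)"
proof -
  have "(\<forall>x::nat \<Rightarrow> coeffs. (\<forall>k. x k \<in> l2 \<and> l2norm (x k) \<le> 1) \<longrightarrow>
        (\<exists>r::nat \<Rightarrow> nat. strict_mono r \<and> l2cauchy (\<lambda>k. T (x (r k))))) \<longleftrightarrow> compact_op (on_ell2 T)"
    if T: "h0_bounded T"
  proof
    assume L: "\<forall>x::nat \<Rightarrow> coeffs. (\<forall>k. x k \<in> l2 \<and> l2norm (x k) \<le> 1) \<longrightarrow>
        (\<exists>r::nat \<Rightarrow> nat. strict_mono r \<and> l2cauchy (\<lambda>k. T (x (r k))))"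
    show "compact_op (on_ell2 T)"
      unfolding compact_op_def
    proof (intro allI impI)
      fix x :: "nat \<Rightarrow> ell2" assume "\<forall>k. norm (x k) \<le> 1"
      then have "\<forall>k. Rep_ell2 (x k) \<in> l2 \<and> l2norm (Rep_ell2 (x k)) \<le> 1" using Rep_ell2 by (simp add: norm_ell2.rep_eq)
      with L[rule_format, of "\<lambda>k. Rep_ell2 (x k)"] obtain r :: "nat \<Rightarrow> nat" where "strict_mono r" "l2cauchy (\<lambda>k. T (Rep_ell2 (x (r k))))" by blast
      then show "\<exists>r::nat\<Rightarrow>nat. strict_mono r \<and> Cauchy (\<lambda>k. on_ell2 T (x (r k)))"
        by (auto simp: l2cauchy_iff[symmetric] Rep_on_ell2[OF T])
    qed
  next
    assume R: "compact_op (on_ell2 T)"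
    show "\<forall>x::nat \<Rightarrow> coeffs. (\<forall>k. x k \<in> l2 \<and> l2norm (x k) \<le> 1) \<longrightarrow>
        (\<exists>r::nat \<Rightarrow> nat. strict_mono r \<and> l2cauchy (\<lambda>k. T (x (r k))))"
    proof (intro allI impI)
      fix x :: "nat \<Rightarrow> coeffs" assume x: "\<forall>k. x k \<in> l2 \<and> l2norm (x k) \<le> 1"
      then have "\<forall>k. norm (Abs_ell2 (x k)) \<le> 1" by (simp add: norm_ell2.rep_eq Abs_ell2_inverse)
      with R[unfolded compact_op_def, rule_format, of "\<lambda>k. Abs_ell2 (x k)"]
      obtain r :: "nat \<Rightarrow> nat" where r: "strict_mono r" "Cauchy (\<lambda>k. on_ell2 T (Abs_ell2 (x (r k))))"
        by blast
      have "Rep_ell2 (on_ell2 T (Abs_ell2 (x (r k)))) = T (x (r k))" for k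
        using x by (simp add: Rep_on_ell2[OF T] Abs_ell2_inverse)
      with r show "\<exists>r::nat \<Rightarrow> nat. strict_mono r \<and> l2cauchy (\<lambda>k. T (x (r k)))"
        by (auto simp: l2cauchy_iff[symmetric] intro!: exI[of _ r])
    qed
  qed
  then show ?thesis by (auto simp: h0_compact_def)
qed

lemma cinner_Abs: "x \<in> l2 \<Longrightarrow> y \<in> l2 \<Longrightarrow> cinner (Abs_ell2 x) (Abs_ell2 y) = l2inner x y"
  by (simp add: cinner.rep_eq Abs_ell2_inverse)

text \<open>Self-adjointness comes from polarisation.\<close>
lemma h0_positive_iff: "h0_positive T \<longleftrightarrow> h0_bounded T \<and> positive_op (on_ell2 T)"
proof
  assume T: "h0_positive T"
  then have b: "h0_bounded T" by (simp add: h0_positive_def)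
  let ?S = "on_ell2 T"
  have cl: "clinear_op ?S" by (rule h0_bounded_clinear[OF b])
  interpret S: bounded_linear ?S by (rule clinear_op_bl[OF cl])
  have quad: "Im (cinner (?S x) x) = 0 \<and> 0 \<le> Re (cinner (?S x) x)" for x
    using T Rep_ell2[of x] by (simp add: h0_positive_def cinner.rep_eq Rep_on_ell2[OF b])
  have sa: "cinner (?S x) y = cinner x (?S y)" for x y
  proof -
    have 1: "Im (cinner (?S x) y) + Im (cinner (?S y) x) = 0"
      using quad[of "x + y"] quad[of x] quad[of y] by (simp add: S.add cinner_add_left cinner_add_right)
    have 2: "Re (cinner (?S x) y) - Re (cinner (?S y) x) = 0"
      using quad[of "\<i> *\<^sub>C x + y"] quad[of x] quad[of y]
      by (simp add: S.add clinear_op_scaleC[OF cl] cinner_add_left cinner_add_right cinner_scaleC_left cinner_scaleC_right)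
    have "cinner (?S x) y = cnj (cinner (?S y) x)" using 1 2 by (simp add: complex_eq_iff)
    then show ?thesis using cinner_commute[of x "?S y"] by simp
  qed
  show "h0_bounded T \<and> positive_op ?S"
    using b cl sa quad by (simp add: positive_op_def inner_ell2_def)
next
  assume "h0_bounded T \<and> positive_op (on_ell2 T)"
  then have b: "h0_bounded T" and p: "positive_op (on_ell2 T)" by auto
  have "Im (l2inner (T x) x) = 0 \<and> 0 \<le> Re (l2inner (T x) x)" if x: "x \<in> l2" for x
  proof -
    have Tx: "T x \<in> l2" using b x by (simp add: h0_bounded_def)
    have e: "l2inner (T x) x = cinner (on_ell2 T (Abs_ell2 x)) (Abs_ell2 x)"
      by (simp add: on_ell2_Abs x cinner_Abs Tx)
    have "cinner (on_ell2 T (Abs_ell2 x)) (Abs_ell2 x) = cnj (cinner (on_ell2 T (Abs_ell2 x)) (Abs_ell2 x))"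
      using p cinner_commute[of "on_ell2 T (Abs_ell2 x)" "Abs_ell2 x"] by (simp add: positive_op_def)
    then have "Im (l2inner (T x) x) = 0" unfolding e by (simp add: complex_eq_iff)
    moreover have "0 \<le> Re (l2inner (T x) x)"
      unfolding e inner_ell2_def[symmetric] using p unfolding positive_op_def by blast
    ultimately show ?thesis by blast
  qed
  then show "h0_positive T" using b by (simp add: h0_positive_def)
qed

lemma is_adjoint_iff:
  assumes "h0_bounded T"
  shows "is_adjoint T S \<longleftrightarrow> h0_bounded S \<and> (\<forall>x y. cinner (on_ell2 T x) y = cinner x (on_ell2 S y))"
proof -
  have "(\<forall>x\<in>l2. \<forall>y\<in>l2. l2inner (T x) y = l2inner x (S y)) \<longleftrightarrow> (\<forall>x y. cinner (on_ell2 T x) y = cinner x (on_ell2 S y))"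
    if S: "h0_bounded S"
  proof
    assume "\<forall>x\<in>l2. \<forall>y\<in>l2. l2inner (T x) y = l2inner x (S y)"
    then show "\<forall>x y. cinner (on_ell2 T x) y = cinner x (on_ell2 S y)"
      using Rep_ell2 by (simp add: cinner.rep_eq Rep_on_ell2[OF S] Rep_on_ell2[OF assms])
  next
    assume R: "\<forall>x y. cinner (on_ell2 T x) y = cinner x (on_ell2 S y)"
    show "\<forall>x\<in>l2. \<forall>y\<in>l2. l2inner (T x) y = l2inner x (S y)"
    proof (intro ballI)
      fix x y assume x: "x \<in> l2" and y: "y \<in> l2"
      then have "T x \<in> l2" "S y \<in> l2" using assms S by (auto simp: h0_bounded_def)
      then show "l2inner (T x) y = l2inner x (S y)"
        using R[rule_format, of "Abs_ell2 x" "Abs_ell2 y"] x y by (simp add: on_ell2_Abs cinner_Abs)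
    qed
  qed
  then show ?thesis by (auto simp: is_adjoint_def)
qed

text \<open>The supremum in \<open>hdim\<close> is attained by the eigenvectors \<open>e n\<close>
  with \<open>\<mu> n = c\<close>; \<open>eigenspace_card\<close> says that no orthonormal family is
  larger.\<close>

lemma hdim_eigenspace:
  assumes b: "h0_bounded S" and p: "positive_op (on_ell2 S)" and es: "eigensystem (on_ell2 S) \<mu> e" and c: "c > 0"
  shows "hdim (eigenspace_op S c) = ecard {n. \<mu> n = c}"
proof -
  have eig_iff: "x \<in> eigenspace_op S c \<longleftrightarrow> x \<in> l2 \<and> on_ell2 S (Abs_ell2 x) = c *\<^sub>R Abs_ell2 x" for x
  proof (cases "x \<in> l2")
    case True
    then have "S x \<in> l2" using b by (simp add: h0_bounded_def)
    with True show ?thesis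
      by (simp add: eigenspace_op_def on_ell2_Abs Rep_ell2_inject[symmetric] scaleR_ell2.rep_eq Abs_ell2_inverse)
  qed (simp add: eigenspace_op_def)
  have fin: "finite {n. \<mu> n = c}"
    by (rule finite_subset[OF _ finite_superlevel[OF es_lim[OF p es] c]]) auto
  have le: "card F \<le> card {n. \<mu> n = c}" if F: "finite F" "F \<subseteq> eigenspace_op S c" "orthonormal_set F" for F
  proof -
    have Fl2: "F \<subseteq> l2" using F(3) by (simp add: orthonormal_set_def)
    then have inj: "inj_on Abs_ell2 F" by (rule inj_on_subset[rotated]) (simp add: inj_on_def Abs_ell2_inject)
    have "card (Abs_ell2 ` F) \<le> card {n. \<mu> n = c}"
    proof (rule eigenspace_card[OF p es c])
      show "orthonormal (Abs_ell2 ` F)"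
        using F(3) Fl2 by (auto simp: orthonormal_def orthonormal_set_def cinner_Abs subset_iff Abs_ell2_inject)
      show "on_ell2 S f = c *\<^sub>R f" if "f \<in> Abs_ell2 ` F" for f
        using that F(2) eig_iff by auto
    qed (use F in simp)
    then show ?thesis by (simp add: card_image[OF inj])
  qed
  let ?E = "Rep_ell2 ` e ` {n. \<mu> n = c}"
  have sub: "{n. \<mu> n = c} \<subseteq> {n. \<mu> n > 0}" using c by auto
  have "inj_on (Rep_ell2 \<circ> e) {n. \<mu> n = c}"
    by (intro comp_inj_on inj_on_subset[OF es_inj[OF p es] sub]) (simp add: inj_on_def Rep_ell2_inject)
  then have card: "card ?E = card {n. \<mu> n = c}" by (simp add: image_image card_image[of "\<lambda>n. Rep_ell2 (e n)"] o_def)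
  have "Rep_ell2 (e n) \<in> eigenspace_op S c" if "\<mu> n = c" for n
    unfolding eig_iff using that by (simp add: Rep_ell2 Rep_ell2_inverse es_eig[OF p es])
  then have E: "finite ?E" "?E \<subseteq> eigenspace_op S c" using fin by auto
  have onE: "orthonormal_set ?E"
    using c es_inj[OF p es] Rep_ell2
    by (auto simp: orthonormal_set_def Rep_ell2_inject es_orth[OF p es] inj_on_def simp flip: cinner.rep_eq)
  show ?thesis
    unfolding hdim_def
  proof (rule antisym)
    show "(SUP F\<in>{F. finite F \<and> F \<subseteq> eigenspace_op S c \<and> orthonormal_set F}. enat (card F)) \<le> ecard {n. \<mu> n = c}"
      using le fin by (intro SUP_least) (auto simp: ecard_def)
    have "enat (card ?E) \<le> (SUP F\<in>{F. finite F \<and> F \<subseteq> eigenspace_op S c \<and> orthonormal_set F}. enat (card F))"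
      by (rule SUP_upper) (use E onE in auto)
    then show "ecard {n. \<mu> n = c} \<le> (SUP F\<in>{F. finite F \<and> F \<subseteq> eigenspace_op S c \<and> orthonormal_set F}. enat (card F))"
      by (simp add: card ecard_def fin)
  qed
qed

text \<open>The choice in \<open>singvals\<close> is resolved by exhibiting \<open>\<mu>\<close> and
  applying uniqueness. Its condition speaks of \<open>c > 0\<close> only, so it is enough to know
  the eigenspaces of \<open>absop T\<close> for positive eigenvalues.\<close>

lemma singvals_eqI:
  assumes b: "h0_bounded S" and p: "positive_op (on_ell2 S)" and es: "eigensystem (on_ell2 S) \<mu> e"
    and eq: "\<And>c. c > 0 \<Longrightarrow> eigenspace_op (absop T) c = eigenspace_op S c"
  shows "singvals T = \<mu>"
proof -
  let ?P = "\<lambda>\<nu>. antimono \<nu> \<and> (\<forall>n. 0 \<le> \<nu> n) \<and> (\<forall>c>0. ecard {n. \<nu> n = c} = hdim (eigenspace_op (absop T) c))"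
  have "?P \<mu>" using es_antimono[OF p es] es_nonneg[OF p es] hdim_eigenspace[OF b p es] eq by simp
  then have P: "?P (singvals T)" unfolding singvals_def by (rule someI[of ?P])
  show ?thesis
    by (rule antimono_multiplicity_unique[OF es_antimono[OF p es] es_nonneg[OF p es] es_lim[OF p es]])
       (use P hdim_eigenspace[OF b p es] eq in auto)
qed

text \<open>\<open>T\<close> is itself a candidate for \<open>absop T\<close>. Whatever candidate
  was chosen, it is a positive root of the square of \<open>T\<close>, and
  \<open>positive_sqrt_eigen\<close> in both directions identifies the relevant eigenspaces.\<close>

lemma singvals_positive:
  assumes T: "h0_positive T" and es: "eigensystem (on_ell2 T) \<mu> e"
  shows "singvals T = \<mu>"
proof -
  have b: "h0_bounded T" and p: "positive_op (on_ell2 T)" using T by (auto simp: h0_positive_iff)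
  let ?P = "\<lambda>S. h0_positive S \<and> (\<exists>T'. is_adjoint T T' \<and> (\<forall>x\<in>l2. S (S x) = T' (T x)))"
  have "is_adjoint T T" using b p by (simp add: is_adjoint_iff positive_op_def)
  then have "?P T" using T by blast
  then have "?P (absop T)" unfolding absop_def by (rule someI[of ?P])
  then obtain T' where S: "h0_positive (absop T)" and T': "is_adjoint T T'" and SS: "\<And>x. x \<in> l2 \<Longrightarrow> absop T (absop T x) = T' (T x)"
    by blast
  have bS: "h0_bounded (absop T)" and pS: "positive_op (on_ell2 (absop T))" using S by (auto simp: h0_positive_iff)
  have bT': "h0_bounded T'" using T' by (simp add: is_adjoint_def)
  have "on_ell2 T' y = on_ell2 T y" for y
  proof -
    have "cinner x (on_ell2 T' y - on_ell2 T y) = 0" for x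
      using T' p by (simp add: is_adjoint_iff[OF b] positive_op_def cinner_diff_right)
    from this[of "on_ell2 T' y - on_ell2 T y"] show ?thesis by (simp add: cinner_norm)
  qed
  moreover have "on_ell2 (absop T) (on_ell2 (absop T) x) = on_ell2 T' (on_ell2 T x)" for x
    using SS[OF Rep_ell2[of x]] by (simp add: Rep_ell2_inject[symmetric] Rep_on_ell2 bS bT' b)
  ultimately have SST: "on_ell2 (absop T) (on_ell2 (absop T) x) = on_ell2 T (on_ell2 T x)" for x by simp
  have eig_iff: "x \<in> eigenspace_op R c \<longleftrightarrow> x \<in> l2 \<and> on_ell2 R (Abs_ell2 x) = c *\<^sub>R Abs_ell2 x"
    if "h0_bounded R" for R x c
  proof (cases "x \<in> l2")
    case True
    then have "R x \<in> l2" using that by (simp add: h0_bounded_def)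
    with True show ?thesis
      by (simp add: eigenspace_op_def on_ell2_Abs Rep_ell2_inject[symmetric] scaleR_ell2.rep_eq Abs_ell2_inverse)
  qed (simp add: eigenspace_op_def)
  have "eigenspace_op (absop T) c = eigenspace_op T c" if c: "c > 0" for c
    using positive_sqrt_eigen[OF pS p SST c] positive_sqrt_eigen[OF p pS SST[symmetric] c]
    by (auto simp: eig_iff[OF b] eig_iff[OF bS])
  then show ?thesis by (rule singvals_eqI[OF b p es])
qed

text \<open>The choice in \<open>absop\<close> is inhabited by a square root of \<open>T' T\<close>.
  Equality of norms is what is exported about the chosen \<open>S\<close>: it carries compactness
  over to \<open>S\<close> here, and later the decay of \<open>T\<close> on basis vectors.\<close>

lemma singvals_compact:
  assumes T: "h0_compact T" and adj: "is_adjoint T T'"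
  obtains S e where "positive_op S" "eigensystem S (singvals T) e" "\<And>x. norm (S x) = norm (on_ell2 T x)"
proof -
  have b: "h0_bounded T" and cp: "compact_op (on_ell2 T)" using T by (auto simp: h0_compact_iff)
  have cl: "clinear_op (on_ell2 T)" by (rule h0_bounded_clinear[OF b])
  interpret T: bounded_linear "on_ell2 T" by (rule clinear_op_bl[OF cl])
  have adjD: "h0_bounded R" "cinner (on_ell2 T x) y = cinner x (on_ell2 R y)" if "is_adjoint T R" for R x y
    using that is_adjoint_iff[OF b] by auto
  have b': "h0_bounded T'" by (rule adjD[OF adj])
  have cl': "clinear_op (on_ell2 T')" by (rule h0_bounded_clinear[OF b'])
  interpret T': bounded_linear "on_ell2 T'" by (rule clinear_op_bl[OF cl'])
  let ?A = "\<lambda>x. on_ell2 T' (on_ell2 T x)"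
  have adj2: "cinner (on_ell2 T' x) y = cinner x (on_ell2 T y)" for x y
    using adjD(2)[OF adj, of y x] cinner_commute by metis
  have pA: "positive_op ?A"
    unfolding positive_op_def
  proof (intro conjI allI)
    show "clinear_op ?A" unfolding clinear_op_def
      using bounded_linear_compose[OF T'.bounded_linear_axioms T.bounded_linear_axioms] clinear_op_scaleC[OF cl] clinear_op_scaleC[OF cl'] by simp
    show "cinner (?A x) y = cinner x (?A y)" for x y by (simp add: adj2 adjD(2)[OF adj])
    show "0 \<le> inner (?A x) x" for x by (simp add: inner_ell2_def adj2 cinner_norm)
  qed
  have cA: "compact_op ?A"
    unfolding compact_op_def
  proof (intro allI impI)
    fix x :: "nat \<Rightarrow> ell2" assume "\<forall>k. norm (x k) \<le> 1"
    then obtain r :: "nat \<Rightarrow> nat" where r: "strict_mono r" "Cauchy (\<lambda>k. on_ell2 T (x (r k)))" using cp unfolding compact_op_def by blast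
    then show "\<exists>r::nat\<Rightarrow>nat. strict_mono r \<and> Cauchy (\<lambda>k. ?A (x (r k)))"
      using T'.Cauchy[OF r(2)] by blast
  qed
  obtain S0 where S0: "positive_op S0" "\<And>x. S0 (S0 x) = ?A x" using positive_sqrt_exists[OF pA cA] by blast
  let ?P = "\<lambda>S. h0_positive S \<and> (\<exists>T'. is_adjoint T T' \<and> (\<forall>x\<in>l2. S (S x) = T' (T x)))"
  have "h0_positive (off_ell2 S0)"
    using S0(1) clinear_h0_bounded[of S0] by (simp add: h0_positive_iff positive_op_def)
  moreover have "off_ell2 S0 (off_ell2 S0 x) = T' (T x)" if "x \<in> l2" for x
    using that b by (simp add: off_ell2_def Rep_ell2_inverse S0(2) Rep_on_ell2[OF b'] Rep_on_ell2[OF b] Abs_ell2_inverse)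
  ultimately have "?P (off_ell2 S0)" using adj by blast
  then have "?P (absop T)" unfolding absop_def by (rule someI[of ?P])
  then obtain T'' where S: "h0_positive (absop T)" and T'': "is_adjoint T T''" and SS: "\<And>x. x \<in> l2 \<Longrightarrow> absop T (absop T x) = T'' (T x)"
    by blast
  define S where "S = on_ell2 (absop T)"
  have bS: "h0_bounded (absop T)" and pS: "positive_op S" using S by (auto simp: h0_positive_iff S_def)
  have eqT: "on_ell2 T'' y = on_ell2 T' y" for y
  proof -
    have "cinner x (on_ell2 T'' y - on_ell2 T' y) = 0" for x
      using adjD(2)[OF adj] adjD(2)[OF T''] by (simp add: cinner_diff_right)
    from this[of "on_ell2 T'' y - on_ell2 T' y"] show ?thesis by (simp add: cinner_norm)
  qed
  have "S (S x) = on_ell2 T'' (on_ell2 T x)" for x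
    using SS[OF Rep_ell2[of x]] by (simp add: S_def Rep_ell2_inject[symmetric] Rep_on_ell2 bS adjD(1)[OF T''] b)
  then have SSA: "S (S x) = ?A x" for x by (simp add: eqT)
  have nS: "norm (S x) = norm (on_ell2 T x)" for x
  proof -
    have "cinner (S x) (S x) = cinner (S (S x)) x" using pS by (simp add: positive_op_def)
    also have "\<dots> = cinner (on_ell2 T x) (on_ell2 T x)" by (simp add: SSA adj2)
    finally have "(norm (S x))\<^sup>2 = (norm (on_ell2 T x))\<^sup>2" unfolding cinner_norm using of_real_eq_iff by blast
    then show ?thesis by (simp add: power2_eq_iff_nonneg)
  qed
  interpret S: bounded_linear S using pS by (simp add: positive_op_def clinear_op_def)
  have "Cauchy (\<lambda>k. S (x k)) \<longleftrightarrow> Cauchy (\<lambda>k. on_ell2 T (x k))" for x :: "nat \<Rightarrow> ell2"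
    unfolding Cauchy_iff by (simp add: nS flip: S.diff T.diff)
  then have "compact_op S" using cp by (simp add: compact_op_def)
  then obtain \<mu> e where es: "eigensystem S \<mu> e" using eigensystem_exists[OF pS] by blast
  have "singvals T = \<mu>" by (rule singvals_eqI[OF bS pS[unfolded S_def] es[unfolded S_def]]) simp
  then show ?thesis using that[of S e] pS es nS by simp
qed

section \<open>Logarithmic averages\<close>

text \<open>\<open>trace_r\<close>, and below it \<open>dix_avg\<close>, detached from the operator,
  so that sums and differences of trace sequences can be averaged as well.\<close>

definition interp :: "(nat \<Rightarrow> real) \<Rightarrow> real \<Rightarrow> real" where
  "interp p r = (let N = nat \<lfloor>r\<rfloor> in p N + (r - real N) * (p (Suc N) - p N))"

definition log_avg :: "(nat \<Rightarrow> real) \<Rightarrow> real \<Rightarrow> real" where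
  "log_avg p \<Lambda> = (1 / ln \<Lambda>) * integral {exp 1..\<Lambda>} (\<lambda>r. interp p r / ln r / r)"

lemma dix_avg_eq: "dix_avg T = log_avg (partial_trace T)"
  by (simp add: fun_eq_iff dix_avg_def log_avg_def trace_r_def[abs_def] interp_def[abs_def])

lemma interp_add: "interp (\<lambda>n. p n + q n) r = interp p r + interp q r"
  by (simp add: interp_def Let_def algebra_simps)

lemma interp_diff: "interp (\<lambda>n. p n - q n) r = interp p r - interp q r"
  by (simp add: interp_def Let_def algebra_simps)

lemma interp_convex: "interp p r = (1 - (r - real (nat \<lfloor>r\<rfloor>))) * p (nat \<lfloor>r\<rfloor>) + (r - real (nat \<lfloor>r\<rfloor>)) * p (Suc (nat \<lfloor>r\<rfloor>))"
  by (simp add: interp_def Let_def algebra_simps)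

lemma frac_bounds: "0 \<le> r \<Longrightarrow> 0 \<le> r - real (nat \<lfloor>r\<rfloor>) \<and> r - real (nat \<lfloor>r\<rfloor>) \<le> 1"
  by linarith

lemma interp_mono_seq:
  assumes "0 \<le> r" "\<And>n. p n \<le> q n" shows "interp p r \<le> interp q r"
  unfolding interp_convex using frac_bounds[OF assms(1)] assms(2)
  by (intro add_mono mult_left_mono) auto

lemma interp_ge:
  assumes "mono p" "0 \<le> r" shows "p (nat \<lfloor>r\<rfloor>) \<le> interp p r"
  using frac_bounds[OF assms(2)] monoD[OF assms(1), of "nat \<lfloor>r\<rfloor>" "Suc (nat \<lfloor>r\<rfloor>)"]
  by (simp add: interp_def Let_def)

lemma interp_le:
  assumes "mono p" "0 \<le> r" shows "interp p r \<le> p (Suc (nat \<lfloor>r\<rfloor>))"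
proof -
  have "(r - real (nat \<lfloor>r\<rfloor>)) * (p (Suc (nat \<lfloor>r\<rfloor>)) - p (nat \<lfloor>r\<rfloor>)) \<le> 1 * (p (Suc (nat \<lfloor>r\<rfloor>)) - p (nat \<lfloor>r\<rfloor>))"
    using frac_bounds[OF assms(2)] monoD[OF assms(1), of "nat \<lfloor>r\<rfloor>" "Suc (nat \<lfloor>r\<rfloor>)"] by (intro mult_right_mono) auto
  then show ?thesis by (simp add: interp_def Let_def)
qed

text \<open>One ramp per unit interval. The floor in \<open>interp\<close> hides its continuity; a
  finite sum of ramps shows it.\<close>

lemma interp_eq_sum:
  assumes r: "0 \<le> r" "r < real M"
  shows "interp p r = p 0 + (\<Sum>k<M. (p (Suc k) - p k) * max 0 (min 1 (r - real k)))"
proof -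
  define N where "N = nat \<lfloor>r\<rfloor>"
  have N: "real N \<le> r" "r < real N + 1" using r(1) unfolding N_def by linarith+
  then have "N < M" using r(2) by linarith
  then have "(\<Sum>k<M. (p (Suc k) - p k) * max 0 (min 1 (r - real k))) = (\<Sum>k\<in>{..<N} \<union> {N} \<union> {Suc N..<M}. (p (Suc k) - p k) * max 0 (min 1 (r - real k)))"
    by (intro sum.cong refl) auto
  also have "\<dots> = (\<Sum>k<N. (p (Suc k) - p k) * max 0 (min 1 (r - real k))) + (p (Suc N) - p N) * max 0 (min 1 (r - real N))
     + (\<Sum>k\<in>{Suc N..<M}. (p (Suc k) - p k) * max 0 (min 1 (r - real k)))"
    by (subst sum.union_disjoint, simp, simp, force)+ simp
  also have "(\<Sum>k<N. (p (Suc k) - p k) * max 0 (min 1 (r - real k))) = (\<Sum>k<N. p (Suc k) - p k)"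
  proof (intro sum.cong refl)
    fix k assume "k \<in> {..<N}"
    then have "real k + 1 \<le> real N" by simp
    then have "max 0 (min 1 (r - real k)) = 1" using N(1) by (simp add: max_def min_def)
    then show "(p (Suc k) - p k) * max 0 (min 1 (r - real k)) = p (Suc k) - p k" by simp
  qed
  also have "\<dots> = p N - p 0" by (rule sum_lessThan_telescope)
  also have "max 0 (min 1 (r - real N)) = r - real N" using N by (simp add: max_def min_def)
  also have "(\<Sum>k\<in>{Suc N..<M}. (p (Suc k) - p k) * max 0 (min 1 (r - real k))) = 0"
  proof (intro sum.neutral ballI)
    fix k assume "k \<in> {Suc N..<M}"
    then have "r - real k \<le> 0" using N(2) by auto
    then have "max 0 (min 1 (r - real k)) = 0" by (simp add: max_def min_def)
    then show "(p (Suc k) - p k) * max 0 (min 1 (r - real k)) = 0" by simp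
  qed
  finally show ?thesis by (simp add: interp_def Let_def N_def algebra_simps)
qed

lemma continuous_on_halfline:
  fixes f :: "real \<Rightarrow> 'a::topological_space"
  assumes "\<And>b. continuous_on {a..b} f" shows "continuous_on {a..} f"
  unfolding continuous_on_eq_continuous_within
proof
  fix x assume x: "x \<in> {a..}"
  have "continuous (at x within {a..x+1}) f"
    using assms[of "x+1"] x unfolding continuous_on_eq_continuous_within by simp
  moreover have "at x within {a..x+1} = at x within {a..}"
    by (rule at_within_nhd[of x "{..<x+1}"]) auto
  ultimately show "continuous (at x within {a..}) f" by simp
qed

lemma continuous_on_interp: "continuous_on {0..} (interp p)"
proof (rule continuous_on_halfline)
  fix b :: real
  obtain M :: nat where M: "b < real M" using reals_Archimedean2 by blast
  have "continuous_on {0..b} (\<lambda>r. p 0 + (\<Sum>k<M. (p (Suc k) - p k) * max 0 (min 1 (r - real k))))"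
    by (intro continuous_intros)
  then show "continuous_on {0..b} (interp p)"
    by (rule continuous_on_cong[THEN iffD1, rotated -1]) (use M in \<open>auto simp: interp_eq_sum[of _ M]\<close>)
qed

lemma exp1_ge: "(1::real) \<le> exp 1" "(0::real) < exp 1"
  by auto

lemma ln_ge_1: "exp 1 \<le> r \<Longrightarrow> 1 \<le> ln (r::real)"
  using ln_ge_iff[of r 1] less_le_trans[OF exp1_ge(2)] by simp

lemma continuous_on_integrand: "continuous_on {exp 1..} (\<lambda>r. interp p r / ln r / r)"
proof -
  have "continuous_on {exp 1..} (interp p)"
    by (rule continuous_on_subset[OF continuous_on_interp]) (auto intro: order_trans[OF exp_ge_zero])
  moreover have "ln r \<noteq> 0 \<and> r \<noteq> 0" if "r \<in> {exp 1..}" for r :: real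
    using ln_ge_1[of r] that less_le_trans[OF exp1_ge(2), of r] by auto
  ultimately show ?thesis by (intro continuous_intros) auto
qed

lemma integrable_integrand: "(\<lambda>r. interp p r / ln r / r) integrable_on {exp 1..b}"
  by (intro integrable_continuous_real continuous_on_subset[OF continuous_on_integrand]) auto

lemma log_avg_add: "log_avg (\<lambda>n. p n + q n) \<Lambda> = log_avg p \<Lambda> + log_avg q \<Lambda>"
  using integral_add[OF integrable_integrand[of p \<Lambda>] integrable_integrand[of q \<Lambda>]]
  by (simp only: log_avg_def interp_add add_divide_distrib distrib_left)

lemma log_avg_diff: "log_avg (\<lambda>n. p n - q n) \<Lambda> = log_avg p \<Lambda> - log_avg q \<Lambda>"
  using integral_diff[OF integrable_integrand[of p \<Lambda>] integrable_integrand[of q \<Lambda>]]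
  by (simp only: log_avg_def interp_diff diff_divide_distrib right_diff_distrib)

lemma continuous_on_log_avg: "continuous_on {exp 1..} (log_avg p)"
proof -
  have "continuous_on {exp 1..} (\<lambda>\<Lambda>. integral {exp 1..\<Lambda>} (\<lambda>r. interp p r / ln r / r))"
    by (rule continuous_on_halfline) (rule indefinite_integral_continuous_1[OF integrable_integrand])
  moreover have "ln r \<noteq> 0 \<and> r \<noteq> 0" if "r \<in> {exp 1..}" for r :: real
    using ln_ge_1[of r] that less_le_trans[OF exp1_ge(2), of r] by auto
  ultimately show ?thesis unfolding log_avg_def by (intro continuous_intros) auto
qed

lemma integral_deriv:
  fixes g :: "real \<Rightarrow> real"
  assumes "continuous_on {a..} g" "a < x"
  shows "((\<lambda>x. integral {a..x} g) has_real_derivative g x) (at x)"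
proof -
  have "((\<lambda>x. integral {a..x} g) has_real_derivative g x) (at x within {a..x+1})"
    by (rule integral_has_real_derivative) (use assms in \<open>auto intro: continuous_on_subset\<close>)
  moreover have "at x within {a..x+1} = at x" using assms(2) by (intro at_within_interior) auto
  ultimately show ?thesis by simp
qed

text \<open>L'Hospital: the derivatives of numerator and denominator are \<open>g r / r\<close> and
  \<open>1 / r\<close>, with quotient \<open>g r\<close>.\<close>

lemma log_average_tendsto:
  fixes g :: "real \<Rightarrow> real"
  assumes g: "continuous_on {a..} g" and a: "a > 0" and lim: "(g \<longlongrightarrow> L) at_top"
  shows "((\<lambda>\<Lambda>. (1 / ln \<Lambda>) * integral {a..\<Lambda>} (\<lambda>r. g r / r)) \<longlongrightarrow> L) at_top"
proof -
  have c: "continuous_on {a..} (\<lambda>r. g r / r)" using a g by (intro continuous_intros) auto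
  have "((\<lambda>\<Lambda>. integral {a..\<Lambda>} (\<lambda>r. g r / r) / ln \<Lambda>) \<longlongrightarrow> L) at_top"
  proof (rule lhospital_at_top_at_top[where f'="\<lambda>r. g r / r" and g'="inverse"])
    show "filterlim ln at_top (at_top :: real filter)" by (rule ln_at_top)
    show "\<forall>\<^sub>F x in at_top. inverse x \<noteq> (0::real)"
      using eventually_gt_at_top[of 0] by eventually_elim simp
    show "\<forall>\<^sub>F x in at_top. ((\<lambda>\<Lambda>. integral {a..\<Lambda>} (\<lambda>r. g r / r)) has_real_derivative g x / x) (at x)"
      using eventually_gt_at_top[of a] by eventually_elim (rule integral_deriv[OF c])
    show "\<forall>\<^sub>F x in at_top. (ln has_real_derivative inverse x) (at x)"
      using eventually_gt_at_top[of 0] by eventually_elim (auto intro!: derivative_eq_intros simp: field_simps)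
    show "((\<lambda>x. g x / x / inverse x) \<longlongrightarrow> L) at_top"
      using lim by (rule Lim_transform_eventually) (use eventually_gt_at_top[of 0] in \<open>eventually_elim, simp add: field_simps\<close>)
  qed
  then show ?thesis by simp
qed

text \<open>The order bound holds only eventually and at integers. From \<open>exp 1\<close> on,
  \<open>ln r\<close> is at least 1 and absorbs the constant \<open>s N0\<close> that covers the
  early terms, while rounding up costs a factor 2, since \<open>r + 1 \<le> r * r\<close>.\<close>

lemma log_bound:
  fixes s :: "nat \<Rightarrow> real"
  assumes s: "mono s" "\<And>n. 0 \<le> s n" "s \<in> O(\<lambda>N. ln (real N))"
  obtains C where "C > 0" "\<And>r. exp 1 \<le> r \<Longrightarrow> interp s r \<le> C * ln r"
proof -
  obtain c where c: "c > 0" "\<forall>\<^sub>F N in sequentially. norm (s N) \<le> c * norm (ln (real N))"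
    using s(3) by (elim landau_o.bigE)
  then obtain N0 where N0: "\<And>N. N \<ge> N0 \<Longrightarrow> norm (s N) \<le> c * norm (ln (real N))"
    unfolding eventually_sequentially by blast
  have "interp s r \<le> (2 * c + s N0) * ln r" if r: "exp 1 \<le> r" for r
  proof -
    have r1: "1 \<le> ln r" "0 < r" "2 \<le> r"
      using ln_ge_1[OF r] exp_ge_add_one_self[of 1] r less_le_trans[OF exp1_ge(2) r] by auto
    define N where "N = Suc (nat \<lfloor>r\<rfloor>)"
    have NR: "real N \<le> r + 1" "1 \<le> real N" using r1 unfolding N_def by linarith+
    have "real N \<le> r * r" using NR(1) r1(2,3) mult_right_mono[of 2 r r] by linarith
    then have lnN: "ln (real N) \<le> 2 * ln r"
      using ln_mono[of "real N" "r * r"] NR r1 by (simp add: ln_mult)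
    have "s N \<le> c * (2 * ln r) + s N0"
    proof (cases "N \<ge> N0")
      case True
      have "s N \<le> c * norm (ln (real N))" using N0[OF True] by simp
      also have "norm (ln (real N)) \<le> 2 * ln r" using lnN NR(2) by simp
      finally show ?thesis using s(2)[of N0] c(1) by (simp add: add_increasing2)
    next
      case False
      then show ?thesis using monoD[OF s(1), of N N0] c(1) r1 by (simp add: add_increasing)
    qed
    also have "s N0 \<le> s N0 * ln r" using s(2)[of N0] r1 mult_left_mono[of 1 "ln r" "s N0"] by simp
    finally have "s N \<le> c * (2 * ln r) + s N0 * ln r" by simp
    with interp_le[OF s(1), of r] r1 show ?thesis unfolding N_def[symmetric] by (simp add: algebra_simps)
  qed
  moreover have "2 * c + s N0 > 0" using c(1) s(2)[of N0] by linarith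
  ultimately show ?thesis using that by blast
qed

lemma interp_nonneg: "0 \<le> r \<Longrightarrow> (\<And>n. 0 \<le> p n) \<Longrightarrow> 0 \<le> interp p r"
  unfolding interp_convex using frac_bounds[of r] by (intro add_nonneg_nonneg mult_nonneg_nonneg) auto

lemma log_avg_bounds:
  assumes s: "mono s" "\<And>n. 0 \<le> s n" "s \<in> O(\<lambda>N. ln (real N))"
  obtains C where "\<And>\<Lambda>. exp 1 \<le> \<Lambda> \<Longrightarrow> 0 \<le> log_avg s \<Lambda> \<and> log_avg s \<Lambda> \<le> C"
proof -
  obtain C where C: "C > 0" "\<And>r. exp 1 \<le> r \<Longrightarrow> interp s r \<le> C * ln r" using log_bound[OF s] by blast
  have "0 \<le> log_avg s \<Lambda> \<and> log_avg s \<Lambda> \<le> C" if L: "exp 1 \<le> \<Lambda>" for \<Lambda>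
  proof
    have pos: "0 \<le> interp s r / ln r / r" if "r \<in> {exp 1..\<Lambda>}" for r
    proof -
      have "1 \<le> ln r" "0 < r" using that ln_ge_1[of r] less_le_trans[OF exp1_ge(2), of r] by auto
      moreover from this have "0 \<le> interp s r" using s(2) by (intro interp_nonneg) auto
      ultimately show ?thesis by (intro divide_nonneg_nonneg; linarith)
    qed
    then have i0: "0 \<le> integral {exp 1..\<Lambda>} (\<lambda>r. interp s r / ln r / r)"
      by (rule integral_nonneg[OF integrable_integrand])
    have ln1: "1 \<le> ln \<Lambda>" by (rule ln_ge_1[OF L])
    then show "0 \<le> log_avg s \<Lambda>" using i0 by (simp add: log_avg_def)
    have "((\<lambda>r. C / r) has_integral (C * ln \<Lambda> - C * ln (exp 1))) {exp 1..\<Lambda>}"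
      by (rule fundamental_theorem_of_calculus[OF L])
         (auto intro!: derivative_eq_intros simp flip: has_real_derivative_iff_has_vector_derivative simp: less_le_trans[OF exp1_ge(2)])
    then have "integral {exp 1..\<Lambda>} (\<lambda>r. interp s r / ln r / r) \<le> C * ln \<Lambda> - C * ln (exp 1)"
    proof (rule has_integral_le[OF integrable_integral[OF integrable_integrand]])
      fix r assume r: "r \<in> {exp 1..\<Lambda>}"
      then have "1 \<le> ln r" "0 < r" using ln_ge_1[of r] less_le_trans[OF exp1_ge(2), of r] by auto
      moreover from this have p: "0 < ln r" by linarith
      have "interp s r / ln r \<le> C" unfolding pos_divide_le_eq[OF p] using C(2)[of r] r by simp
      ultimately show "interp s r / ln r / r \<le> C / r" by (intro divide_right_mono) auto
    qed
    also have "\<dots> \<le> C * ln \<Lambda>" using C(1) by simp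
    finally show "log_avg s \<Lambda> \<le> C" using ln1 by (simp add: log_avg_def field_simps)
  qed
  then show ?thesis using that by blast
qed

text \<open>The Cesaro mean over the multiplicative group makes the dilation by 4 invisible;
  4 rather than 2 absorbs the rounding in the interpolation.\<close>
lemma log_avg_additive:
  fixes p q s :: "nat \<Rightarrow> real"
  assumes p: "mono p" and q: "mono q" and s: "mono s" "\<And>n. 0 \<le> s n" "s \<in> O(\<lambda>N. ln (real N))"
    and le: "\<And>n. s n \<le> p n + q n" and ge: "\<And>n. p n + q n \<le> s (2 * n)"
  shows "((\<lambda>\<Lambda>. log_avg p \<Lambda> + log_avg q \<Lambda> - log_avg s \<Lambda>) \<longlongrightarrow> 0) at_top"
proof -
  obtain C where C: "C > 0" "\<And>r. exp 1 \<le> r \<Longrightarrow> interp s r \<le> C * ln r" using log_bound[OF s] by blast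
  define d where "d = (\<lambda>\<Lambda>. log_avg p \<Lambda> + log_avg q \<Lambda> - log_avg s \<Lambda>)"
  define h where "h = (\<lambda>u. interp s u / ln u / u)"
  define H where "H = (\<lambda>x. integral {exp 1..x} h)"
  have cont: "continuous_on {exp 1..} h" unfolding h_def by (rule continuous_on_integrand)
  have hint: "h integrable_on {a..b}" if "exp 1 \<le> a" for a b
    by (rule integrable_continuous_real[OF continuous_on_subset[OF cont]]) (use that in auto)
  have facts: "1 \<le> ln r" "0 < r" "0 \<le> interp s r" "2 \<le> r" "0 \<le> h r" if "exp 1 \<le> r" for r
  proof -
    show r: "1 \<le> ln r" "0 < r" using ln_ge_1[OF that] less_le_trans[OF exp1_ge(2) that] by auto
    show i: "0 \<le> interp s r" using r s(2) by (intro interp_nonneg) auto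
    show "2 \<le> r" using exp_ge_add_one_self[of 1] that by simp
    show "0 \<le> h r" unfolding h_def using r i by (intro divide_nonneg_nonneg; linarith)
  qed
  have h_le: "h r \<le> C / r" if "exp 1 \<le> r" for r
    using C(2)[OF that] facts[OF that] by (simp add: h_def field_simps)
  have deq: "d \<Lambda> = (1 / ln \<Lambda>) * (integral {exp 1..\<Lambda>} (\<lambda>r. interp (\<lambda>n. p n + q n) r / ln r / r) - H \<Lambda>)" for \<Lambda>
    unfolding d_def log_avg_add[symmetric] by (simp add: log_avg_def H_def h_def algebra_simps)
  have low: "0 \<le> d \<Lambda>" if L: "exp 1 \<le> \<Lambda>" for \<Lambda>
  proof -
    have "H \<Lambda> \<le> integral {exp 1..\<Lambda>} (\<lambda>r. interp (\<lambda>n. p n + q n) r / ln r / r)"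
      unfolding H_def h_def
    proof (rule integral_le[OF integrable_integrand integrable_integrand])
      fix r assume "r \<in> {exp 1..\<Lambda>}"
      then have "exp 1 \<le> r" by simp
      from facts[OF this] interp_mono_seq[of r s "\<lambda>n. p n + q n"] le
      show "interp s r / ln r / r \<le> interp (\<lambda>n. p n + q n) r / ln r / r"
        by (intro divide_right_mono) auto
    qed
    then show ?thesis using facts[OF L] by (simp add: deq)
  qed
  \<comment> \<open>Substituting \<open>4 * r\<close> turns the average of \<open>p + q\<close> into
    one of \<open>s\<close>. Two errors arise: the integral of \<open>h\<close> between
    \<open>\<Lambda>\<close> and \<open>4 * \<Lambda>\<close>, at most \<open>C * ln 4\<close>, and
    the replacement of \<open>ln (4 * r)\<close> by \<open>ln r\<close> in the denominator, which
    integrates to a multiple of \<open>ln (ln \<Lambda>)\<close>. Both are negligible against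
    \<open>ln \<Lambda>\<close>.\<close>
  have up: "d \<Lambda> \<le> (C * ln 4 + C * ln 4 * ln (ln \<Lambda>)) / ln \<Lambda>" if L: "exp 1 \<le> \<Lambda>" for \<Lambda>
  proof -
    have L4: "exp 1 \<le> 4 * \<Lambda>" using L facts(2)[OF L] by linarith
    have pt: "interp (\<lambda>n. p n + q n) r / ln r / r \<le> h (4 * r) * 4 + C * ln 4 / (r * ln r)" if r: "exp 1 \<le> r" for r
    proof -
      note f = facts[OF r]
      have r4: "exp 1 \<le> 4 * r" using r f(2) by linarith
      note f4 = facts[OF r4]
      have "interp (\<lambda>n. p n + q n) r \<le> p (Suc (nat \<lfloor>r\<rfloor>)) + q (Suc (nat \<lfloor>r\<rfloor>))"
        using interp_le[of p r] interp_le[of q r] p q f by (simp add: interp_add)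
      also have "\<dots> \<le> s (2 * Suc (nat \<lfloor>r\<rfloor>))" by (rule ge)
      also have "\<dots> \<le> s (nat \<lfloor>4 * r\<rfloor>)"
      proof (intro monoD[OF s(1)] le_nat_floor)
        have aux: "x \<le> r \<Longrightarrow> 2 * (1 + x) \<le> 4 * r" for x :: real using f(4) by argo
        have "real (nat \<lfloor>r\<rfloor>) \<le> r" using f(2) by linarith
        then show "real (2 * Suc (nat \<lfloor>r\<rfloor>)) \<le> 4 * r"
          unfolding of_nat_mult of_nat_Suc of_nat_numeral by (rule aux)
      qed
      also have "\<dots> \<le> interp s (4 * r)" using f by (intro interp_ge s) auto
      finally have 1: "interp (\<lambda>n. p n + q n) r \<le> interp s (4 * r)" .
      have ln4: "ln (4 * r) = ln 4 + ln r" using f by (simp add: ln_mult)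
      have l4: "(0::real) < ln 4" by simp
      have "interp s (4 * r) / ln r / r = h (4 * r) * 4 + interp s (4 * r) / ln (4 * r) * ln 4 / (r * ln r)"
      proof -
        have alg: "a / x / r = a / (y + x) / (4 * r) * 4 + a / (y + x) * y / (r * x)"
          if "0 < x" "0 < y" "0 < r" for a x y r :: real
        proof -
          have "y + x \<noteq> 0" using that by linarith
          then show ?thesis using that by (simp add: divide_simps) (simp add: algebra_simps)
        qed
        have "0 < ln r" using f(1) by linarith
        from alg[OF this l4 f(2)] show ?thesis unfolding h_def ln4 .
      qed
      also have "interp s (4 * r) / ln (4 * r) * ln 4 / (r * ln r) \<le> C * ln 4 / (r * ln r)"
        using C(2)[OF r4] f f4 l4 by (intro divide_right_mono mult_right_mono) (auto simp: field_simps)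
      finally have "interp s (4 * r) / ln r / r \<le> h (4 * r) * 4 + C * ln 4 / (r * ln r)" by simp
      moreover have "interp (\<lambda>n. p n + q n) r / ln r / r \<le> interp s (4 * r) / ln r / r"
        using 1 f by (intro divide_right_mono) auto
      ultimately show ?thesis by linarith
    qed
    have "((\<lambda>r. h (4 * r) * 4 + C * ln 4 / (r * ln r)) has_integral
       ((H (4 * \<Lambda>) + C * ln 4 * ln (ln \<Lambda>)) - (H (4 * exp 1) + C * ln 4 * ln (ln (exp 1))))) {exp 1..\<Lambda>}"
    proof (rule fundamental_theorem_of_calculus[OF L])
      fix r assume r: "r \<in> {exp 1..\<Lambda>}"
      then have f: "1 \<le> ln r" "0 < r" "1 < r" using facts[of r] by auto
      have "exp 1 < 4 * r" using r f by auto
      from integral_deriv[OF cont this] have "(H has_real_derivative h (4 * r)) (at (4 * r))" unfolding H_def .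
      moreover have "((\<lambda>r. 4 * r) has_real_derivative 4) (at r)" by (auto intro!: derivative_eq_intros)
      ultimately have 1: "((\<lambda>r. H (4 * r)) has_real_derivative h (4 * r) * 4) (at r)"
        by (rule DERIV_chain2[where f=H and g="\<lambda>r. 4 * r"])
      have 2: "((\<lambda>r. C * ln 4 * ln (ln r)) has_real_derivative C * ln 4 / (r * ln r)) (at r)"
        using f by (auto intro!: derivative_eq_intros simp: field_simps)
      show "((\<lambda>r. H (4 * r) + C * ln 4 * ln (ln r)) has_vector_derivative h (4 * r) * 4 + C * ln 4 / (r * ln r)) (at r within {exp 1..\<Lambda>})"
        using DERIV_add[OF 1 2] unfolding has_real_derivative_iff_has_vector_derivative by (rule has_vector_derivative_at_within)
    qed
    then have "integral {exp 1..\<Lambda>} (\<lambda>r. interp (\<lambda>n. p n + q n) r / ln r / r) \<le> (H (4 * \<Lambda>) + C * ln 4 * ln (ln \<Lambda>)) - (H (4 * exp 1) + C * ln 4 * ln (ln (exp 1)))"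
      by (rule has_integral_le[OF integrable_integral[OF integrable_integrand]]) (use pt in auto)
    moreover have "0 \<le> H (4 * exp 1)" unfolding H_def
      by (rule integral_nonneg[OF hint]) (use facts in auto)
    moreover have "H (4 * \<Lambda>) - H \<Lambda> \<le> C * ln 4"
    proof -
      have "H \<Lambda> + integral {\<Lambda>..4 * \<Lambda>} h = H (4 * \<Lambda>)"
        unfolding H_def by (rule Henstock_Kurzweil_Integration.integral_combine[OF L _ hint]) (use facts(2)[OF L] in auto)
      moreover have "((\<lambda>r. C / r) has_integral (C * ln (4 * \<Lambda>) - C * ln \<Lambda>)) {\<Lambda>..4 * \<Lambda>}"
        by (rule fundamental_theorem_of_calculus)
           (use facts(2)[OF L] in \<open>auto intro!: derivative_eq_intros simp flip: has_real_derivative_iff_has_vector_derivative\<close>)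
      then have "integral {\<Lambda>..4 * \<Lambda>} h \<le> C * ln (4 * \<Lambda>) - C * ln \<Lambda>"
        by (rule has_integral_le[OF integrable_integral[OF hint[OF L]]]) (use h_le L in auto)
      ultimately show ?thesis using facts(2)[OF L] by (simp add: ln_mult algebra_simps)
    qed
    ultimately have "integral {exp 1..\<Lambda>} (\<lambda>r. interp (\<lambda>n. p n + q n) r / ln r / r) - H \<Lambda> \<le> C * ln 4 + C * ln 4 * ln (ln \<Lambda>)"
      by simp
    then show ?thesis unfolding deq using facts(1)[OF L] by (simp add: divide_right_mono)
  qed
  have lim1: "((\<lambda>\<Lambda>. 1 / ln \<Lambda>) \<longlongrightarrow> 0) (at_top :: real filter)"
    using tendsto_inverse_0_at_top[OF ln_at_top] by (simp add: inverse_eq_divide)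
  have lim2: "((\<lambda>\<Lambda>. ln (ln \<Lambda>) / ln \<Lambda>) \<longlongrightarrow> 0) (at_top :: real filter)"
    by (rule filterlim_compose[OF ln_x_over_x_tendsto_0 ln_at_top])
  have "((\<lambda>\<Lambda>. C * ln 4 * (1 / ln \<Lambda>) + C * ln 4 * (ln (ln \<Lambda>) / ln \<Lambda>)) \<longlongrightarrow> C * ln 4 * 0 + C * ln 4 * 0) at_top"
    by (intro tendsto_intros lim1 lim2)
  then have lim: "((\<lambda>\<Lambda>. (C * ln 4 + C * ln 4 * ln (ln \<Lambda>)) / ln \<Lambda>) \<longlongrightarrow> 0) at_top"
    by (simp add: add_divide_distrib)
  have "(d \<longlongrightarrow> 0) at_top"
    by (rule tendsto_sandwich[OF eventually_mono[OF eventually_ge_at_top[of "exp 1"] low]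
          eventually_mono[OF eventually_ge_at_top[of "exp 1"] up] tendsto_const lim])
  then show ?thesis by (simp add: d_def)
qed

lemma ln_ratio_tendsto:
  fixes f :: "real \<Rightarrow> real"
  assumes "\<forall>\<^sub>F r in at_top. r / 2 \<le> f r \<and> f r \<le> 2 * r"
  shows "((\<lambda>r. ln (f r) / ln r) \<longlongrightarrow> 1) at_top"
proof (rule tendsto_sandwich)
  have lim: "((\<lambda>\<Lambda>. 1 / ln \<Lambda>) \<longlongrightarrow> 0) (at_top :: real filter)"
    using tendsto_inverse_0_at_top[OF ln_at_top] by (simp add: inverse_eq_divide)
  have "((\<lambda>r. 1 - ln 2 * (1 / ln r)) \<longlongrightarrow> 1 - ln 2 * 0) (at_top :: real filter)" by (intro tendsto_intros lim)
  then show "((\<lambda>r. 1 - ln 2 * (1 / ln r)) \<longlongrightarrow> 1) (at_top :: real filter)" by simp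
  have "((\<lambda>r. 1 + ln 2 * (1 / ln r)) \<longlongrightarrow> 1 + ln 2 * 0) (at_top :: real filter)" by (intro tendsto_intros lim)
  then show "((\<lambda>r. 1 + ln 2 * (1 / ln r)) \<longlongrightarrow> 1) (at_top :: real filter)" by simp
  have b: "\<forall>\<^sub>F r in at_top. ln r > 0 \<and> ln r - ln 2 \<le> ln (f r) \<and> ln (f r) \<le> ln r + ln 2"
    using assms eventually_gt_at_top[of "1::real"]
  proof eventually_elim
    case (elim r)
    then have "0 < f r" by linarith
    with elim show ?case using ln_mono[of "r/2" "f r"] ln_mono[of "f r" "2 * r"] by (simp add: ln_div ln_mult)
  qed
  show "\<forall>\<^sub>F r in at_top. 1 - ln 2 * (1 / ln r) \<le> ln (f r) / ln r"
    using b
  proof eventually_elim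
    case (elim r)
    then show ?case using divide_right_mono[of "ln r - ln 2" "ln (f r)" "ln r"] by (simp add: diff_divide_distrib)
  qed
  show "\<forall>\<^sub>F r in at_top. ln (f r) / ln r \<le> 1 + ln 2 * (1 / ln r)"
    using b
  proof eventually_elim
    case (elim r)
    then show ?case using divide_right_mono[of "ln (f r)" "ln r + ln 2" "ln r"] by (simp add: add_divide_distrib)
  qed
qed

text \<open>\<open>p\<close> is not assumed monotone, since it will be a difference of two trace
  sequences. So \<open>interp p r\<close> is compared with its lower node through the jump to the
  next node, and both nodes have the same limit after division by \<open>ln r\<close>.\<close>

lemma log_avg_tendsto:
  assumes "((\<lambda>N. p N / ln (real N)) \<longlongrightarrow> L) sequentially"
  shows "(log_avg p \<longlongrightarrow> L) at_top"
proof -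
  have "continuous_on {exp 1..} (interp p)"
    by (rule continuous_on_subset[OF continuous_on_interp]) (auto intro: order_trans[OF exp_ge_zero])
  moreover have ln0: "ln r \<noteq> 0 \<and> r \<noteq> 0" if "r \<in> {exp 1..}" for r :: real
    using ln_ge_1[of r] that less_le_trans[OF exp1_ge(2), of r] by auto
  ultimately have cont: "continuous_on {exp 1..} (\<lambda>r. interp p r / ln r)" by (intro continuous_intros) auto
  define fl where "fl = (\<lambda>r::real. nat \<lfloor>r\<rfloor>)"
  have fl: "filterlim fl sequentially at_top"
    unfolding fl_def by (rule filterlim_compose[OF filterlim_nat_sequentially filterlim_floor_sequentially])
  have fl': "filterlim (\<lambda>r. Suc (fl r)) sequentially at_top"
    by (rule filterlim_compose[OF filterlim_Suc fl])
  have key: "((\<lambda>r. p (f r) / ln r) \<longlongrightarrow> L) at_top"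
    if f: "filterlim f sequentially at_top" and b: "\<forall>\<^sub>F r::real in at_top. r / 2 \<le> real (f r) \<and> real (f r) \<le> 2 * r" for f
  proof -
    have "((\<lambda>r. p (f r) / ln (real (f r)) * (ln (real (f r)) / ln r)) \<longlongrightarrow> L * 1) at_top"
      by (intro tendsto_mult filterlim_compose[OF assms f] ln_ratio_tendsto b)
    then have "((\<lambda>r. p (f r) / ln (real (f r)) * (ln (real (f r)) / ln r)) \<longlongrightarrow> L) at_top" by simp
    then show ?thesis
    proof (rule Lim_transform_eventually)
      show "\<forall>\<^sub>F r in at_top. p (f r) / ln (real (f r)) * (ln (real (f r)) / ln r) = p (f r) / ln r"
        using b eventually_gt_at_top[of "4::real"]
      proof eventually_elim
        case (elim r)
        then have "1 < real (f r)" by linarith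
        then have "ln (real (f r)) \<noteq> 0" by (simp add: ln_gt_zero less_imp_neq[symmetric])
        then show ?case by simp
      qed
    qed
  qed
  have a: "((\<lambda>r. p (fl r) / ln r) \<longlongrightarrow> L) at_top"
    by (rule key[OF fl]) (use eventually_ge_at_top[of "2::real"] in \<open>eventually_elim, unfold fl_def, linarith\<close>)
  have b: "((\<lambda>r. p (Suc (fl r)) / ln r) \<longlongrightarrow> L) at_top"
    by (rule key[OF fl']) (use eventually_ge_at_top[of "2::real"] in \<open>eventually_elim, unfold fl_def, linarith\<close>)
  have "((\<lambda>r. interp p r / ln r) \<longlongrightarrow> L) at_top"
  proof (rule Lim_transform[OF a])
    have "((\<lambda>r. p (Suc (fl r)) / ln r - p (fl r) / ln r) \<longlongrightarrow> L - L) at_top" by (intro tendsto_diff a b)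
    then have lim0: "((\<lambda>r. norm (p (Suc (fl r)) / ln r - p (fl r) / ln r)) \<longlongrightarrow> 0) at_top"
      by (intro tendsto_norm_zero) simp
    show "((\<lambda>r. interp p r / ln r - p (fl r) / ln r) \<longlongrightarrow> 0) at_top"
    proof (rule Lim_null_comparison[OF _ lim0])
      show "\<forall>\<^sub>F r in at_top. norm (interp p r / ln r - p (fl r) / ln r) \<le> norm (p (Suc (fl r)) / ln r - p (fl r) / ln r)"
        using eventually_ge_at_top[of "0::real"]
      proof eventually_elim
        case (elim r)
        have "interp p r / ln r - p (fl r) / ln r = (r - real (fl r)) * (p (Suc (fl r)) / ln r - p (fl r) / ln r)"
          by (simp add: interp_def Let_def fl_def diff_divide_distrib add_divide_distrib algebra_simps)
        moreover have "\<bar>r - real (fl r)\<bar> \<le> 1" using frac_bounds[OF elim] unfolding fl_def by linarith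
        ultimately show ?case unfolding real_norm_def abs_mult by (simp add: abs_mult mult_left_le_one_le)
      qed
    qed
  qed
  from log_average_tendsto[OF cont _ this] show ?thesis by (simp add: log_avg_def[abs_def])
qed

section \<open>The Dixmier trace\<close>

lemma const_in_Cb: "(\<lambda>t. c) \<in> Cb"
  by (auto simp: Cb_def image_constant_conv)

lemma Cb_lincomb: "f \<in> Cb \<Longrightarrow> g \<in> Cb \<Longrightarrow> (\<lambda>t. c * f t + g t) \<in> Cb"
proof -
  assume f: "f \<in> Cb" and g: "g \<in> Cb"
  then have cont: "continuous_on {exp 1..} (\<lambda>t. c * f t + g t)" by (auto simp: Cb_def intro!: continuous_intros)
  obtain A B where "\<forall>t\<in>{exp 1..}. norm (f t) \<le> A" "\<forall>t\<in>{exp 1..}. norm (g t) \<le> B"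
    using f g by (auto simp: Cb_def bounded_iff)
  then have "norm (c * f t + g t) \<le> norm c * A + B" if "t \<in> {exp 1..}" for t
    using that by (intro norm_triangle_le add_mono) (auto simp: norm_mult mult_left_mono)
  then show ?thesis using cont by (auto simp: Cb_def bounded_iff)
qed

text \<open>A cluster point of the evaluations at \<open>\<Lambda> \<rightarrow> \<infinity>\<close> in the compact product of discs.\<close>
lemma dixmier_state_exists: "\<exists>\<omega>. dixmier_state \<omega>"
proof -
  have "\<forall>f. \<exists>B. f \<in> Cb \<longrightarrow> (\<forall>t\<ge>exp 1. cmod (f t) \<le> B)" by (auto simp: Cb_def bounded_iff)
  then obtain B where B: "\<And>f t. f \<in> Cb \<Longrightarrow> t \<ge> exp 1 \<Longrightarrow> cmod (f t) \<le> B f" by metis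
  \<comment> \<open>Functions outside \<open>Cb\<close> are sent to 0, so that every coordinate of
    \<open>ev \<Lambda>\<close> stays in a fixed disc and the product is compact.\<close>
  define ev where "ev = (\<lambda>\<Lambda> (f::real \<Rightarrow> complex). if f \<in> Cb then f \<Lambda> else 0)"
  define K where "K = (\<Pi>\<^sub>E f\<in>(UNIV::(real \<Rightarrow> complex) set). cball (0::complex) (\<bar>B f\<bar>))"
  have "compactin (product_topology (\<lambda>f. euclidean) UNIV) K"
    unfolding K_def by (subst compactin_PiE) auto
  then have K: "compact K" by (simp add: euclidean_product_topology)
  define F where "F = filtermap ev at_top"
  have ge: "\<forall>\<^sub>F \<Lambda>::real in at_top. exp 1 \<le> \<Lambda>" by (rule eventually_ge_at_top)
  have "\<forall>\<^sub>F \<omega> in F. \<omega> \<in> K"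
    unfolding F_def eventually_filtermap using ge
  proof eventually_elim
    case (elim \<Lambda>)
    then have "cmod (ev \<Lambda> f) \<le> \<bar>B f\<bar>" for f
      using B[of f \<Lambda>] by (auto simp: ev_def)
    then show ?case by (auto simp: K_def)
  qed
  moreover have "F \<noteq> bot" by (simp add: F_def filtermap_bot_iff)
  ultimately obtain \<omega> where \<omega>: "inf (nhds \<omega>) F \<noteq> bot" using K unfolding compact_filter by blast
  \<comment> \<open>Every clause of \<open>dixmier_state\<close> is a closed condition on
    coordinates that \<open>ev \<Lambda>\<close> satisfies for large \<open>\<Lambda>\<close>, and
    such conditions pass to cluster points.\<close>
  have cl: "\<omega> \<in> C" if C: "closed C" "\<And>\<Lambda>. \<Lambda> \<ge> M \<Longrightarrow> \<Lambda> \<ge> exp 1 \<Longrightarrow> ev \<Lambda> \<in> C" for C M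
  proof (rule ccontr)
    assume "\<omega> \<notin> C"
    then have "\<forall>\<^sub>F x in nhds \<omega>. x \<in> - C" using C(1) by (intro eventually_nhds_in_open) auto
    moreover have "\<forall>\<^sub>F x in F. x \<in> C"
      unfolding F_def eventually_filtermap using ge eventually_ge_at_top[of M] by eventually_elim (rule C(2))
    ultimately have "\<forall>\<^sub>F x in inf (nhds \<omega>) F. False" unfolding eventually_inf by blast
    with \<omega> show False by (simp add: trivial_limit_def)
  qed
  have coord: "continuous_on UNIV (\<lambda>\<omega>::(real \<Rightarrow> complex) \<Rightarrow> complex. \<omega> f)" for f
    by (rule continuous_on_product_coordinates)
  have "dixmier_state \<omega>"
    unfolding dixmier_state_def
  proof (intro conjI ballI allI impI)
    fix f g c assume f: "f \<in> Cb" and g: "g \<in> Cb"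
    have "closed {\<omega>. \<omega> (\<lambda>t. c * f t + g t) = c * \<omega> f + \<omega> g}"
      by (intro closed_Collect_eq continuous_intros coord)
    from cl[OF this] have "\<omega> \<in> {\<omega>. \<omega> (\<lambda>t. c * f t + g t) = c * \<omega> f + \<omega> g}"
      using f g Cb_lincomb[OF f g, of c] by (simp add: ev_def)
    then show "\<omega> (\<lambda>t. c * f t + g t) = c * \<omega> f + \<omega> g" by simp
  next
    fix f assume f: "f \<in> Cb" and pos: "\<forall>t\<ge>exp 1. Im (f t) = 0 \<and> 0 \<le> Re (f t)"
    have "closed ({\<omega>. Im (\<omega> f) = 0} \<inter> {\<omega>. 0 \<le> Re (\<omega> f)})"
      by (intro closed_Int closed_Collect_eq closed_Collect_le continuous_intros coord)
    from cl[OF this] have "\<omega> \<in> {\<omega>. Im (\<omega> f) = 0} \<inter> {\<omega>. 0 \<le> Re (\<omega> f)}"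
      using f pos by (simp add: ev_def)
    then show "Im (\<omega> f) = 0" "0 \<le> Re (\<omega> f)" by auto
  next
    have "closed {\<omega>::(real \<Rightarrow> complex) \<Rightarrow> complex. \<omega> (\<lambda>t. 1) = 1}"
      by (intro closed_Collect_eq continuous_intros coord)
    from cl[OF this] have "\<omega> \<in> {\<omega>. \<omega> (\<lambda>t. 1) = 1}" using const_in_Cb by (simp add: ev_def)
    then show "\<omega> (\<lambda>t. 1) = 1" by simp
  next
    fix f :: "real \<Rightarrow> complex" assume f: "f \<in> Cb" and lim: "(f \<longlongrightarrow> 0) at_top"
    have "cmod (\<omega> f) \<le> 0 + e" if e: "e > 0" for e
    proof -
      have "\<forall>\<^sub>F t in at_top. dist (f t) 0 < e" by (rule tendstoD[OF lim e])
      then obtain M where M: "\<And>t. t \<ge> M \<Longrightarrow> cmod (f t) < e" unfolding eventually_at_top_linorder by auto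
      have "closed {\<omega>. cmod (\<omega> f) \<le> e}"
        by (intro closed_Collect_le continuous_intros coord)
      from cl[OF this, of M] have "\<omega> \<in> {\<omega>. cmod (\<omega> f) \<le> e}" using f M less_imp_le by (simp add: ev_def) blast
      then show ?thesis by simp
    qed
    from field_le_epsilon[OF this] show "\<omega> f = 0" by simp
  qed
  then show ?thesis by blast
qed

lemma dixmier_state_add:
  assumes \<omega>: "dixmier_state \<omega>" "f \<in> Cb" "g \<in> Cb" shows "\<omega> (\<lambda>t. f t + g t) = \<omega> f + \<omega> g"
proof -
  have "\<omega> (\<lambda>t. 1 * f t + g t) = 1 * \<omega> f + \<omega> g" using \<omega> unfolding dixmier_state_def by blast
  then show ?thesis by simp
qed

lemma dixmier_state_diff:
  assumes \<omega>: "dixmier_state \<omega>" "f \<in> Cb" "g \<in> Cb" shows "\<omega> (\<lambda>t. f t - g t) = \<omega> f - \<omega> g"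
proof -
  have "\<omega> (\<lambda>t. (-1) * g t + f t) = (-1) * \<omega> g + \<omega> f" using \<omega> unfolding dixmier_state_def by blast
  then show ?thesis by (simp add: algebra_simps)
qed

lemma dixmier_state_limit:
  assumes \<omega>: "dixmier_state \<omega>" "f \<in> Cb" and lim: "(f \<longlongrightarrow> c) at_top" shows "\<omega> f = c"
proof -
  have mem: "(\<lambda>t. f t - c) \<in> Cb"
    using Cb_lincomb[OF const_in_Cb[of "-c"] assms(2), of 1] by (simp add: algebra_simps)
  have lin: "\<forall>f\<in>Cb. \<forall>g\<in>Cb. \<forall>c. \<omega> (\<lambda>t. c * f t + g t) = c * \<omega> f + \<omega> g"
    and one: "\<omega> (\<lambda>t. 1) = 1" and van: "\<forall>f\<in>Cb. (f \<longlongrightarrow> 0) at_top \<longrightarrow> \<omega> f = 0"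
    using \<omega>(1) by (auto simp: dixmier_state_def)
  have "\<omega> (\<lambda>t. c * 1 + (f t - c)) = c * \<omega> (\<lambda>t. 1) + \<omega> (\<lambda>t. f t - c)"
    by (rule lin[rule_format, OF const_in_Cb[of 1] mem])
  moreover have "\<omega> (\<lambda>t. f t - c) = 0" using van mem LIM_zero[OF lim] by blast
  ultimately show ?thesis by (simp add: one)
qed

text \<open>\<open>absop\<close> inspects its argument on \<open>l2\<close> only, so operators that
  differ elsewhere have literally the same singular values.\<close>

lemma partial_trace_cong:
  assumes "\<And>x. x \<in> l2 \<Longrightarrow> T x = T' x" shows "partial_trace T = partial_trace T'"
proof -
  have "is_adjoint T R = is_adjoint T' R" for R by (auto simp: is_adjoint_def assms)
  then have "absop T = absop T'" unfolding absop_def using assms by simp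
  then have "singvals T = singvals T'" unfolding singvals_def by (simp only:)
  then show ?thesis by (simp add: partial_trace_def fun_eq_iff)
qed

lemma positive_compact_eigensystem:
  assumes "h0_positive T" "h0_compact T"
  obtains e where "eigensystem (on_ell2 T) (singvals T) e" "positive_op (on_ell2 T)"
proof -
  have p: "positive_op (on_ell2 T)" "compact_op (on_ell2 T)"
    using assms by (auto simp: h0_positive_iff h0_compact_iff)
  then obtain \<mu> e where es: "eigensystem (on_ell2 T) \<mu> e" using eigensystem_exists by blast
  from singvals_positive[OF assms(1) es] es p that show ?thesis by auto
qed

lemma partial_trace_mono_nonneg:
  assumes "h0_positive T" "h0_compact T"
  shows "mono (partial_trace T)" "0 \<le> partial_trace T n"
proof -
  obtain e where e: "eigensystem (on_ell2 T) (singvals T) e" "positive_op (on_ell2 T)"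
    using positive_compact_eigensystem[OF assms] .
  note nn = es_nonneg[OF e(2,1)]
  show "mono (partial_trace T)" unfolding partial_trace_def
    by (intro monoI sum_mono2) (use nn in auto)
  show "0 \<le> partial_trace T n" unfolding partial_trace_def using nn by (simp add: sum_nonneg)
qed

section \<open>Additivity of the Dixmier trace\<close>

definition opadd :: "(coeffs \<Rightarrow> coeffs) \<Rightarrow> (coeffs \<Rightarrow> coeffs) \<Rightarrow> coeffs \<Rightarrow> coeffs" where
  "opadd A B = (\<lambda>x l. A x l + B x l)"

lemma h0_bounded_opadd:
  assumes A: "h0_bounded A" and B: "h0_bounded B"
  shows "h0_bounded (opadd A B)" "on_ell2 (opadd A B) = (\<lambda>x. on_ell2 A x + on_ell2 B x)"
proof -
  have on: "on_ell2 (opadd A B) x = on_ell2 A x + on_ell2 B x" for x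
  proof -
    have "opadd A B (Rep_ell2 x) = Rep_ell2 (on_ell2 A x + on_ell2 B x)"
      by (simp add: opadd_def plus_ell2.rep_eq Rep_on_ell2 A B)
    then show ?thesis unfolding on_ell2_def[of "opadd A B"] by (simp add: Rep_ell2_inverse)
  qed
  then show "on_ell2 (opadd A B) = (\<lambda>x. on_ell2 A x + on_ell2 B x)" by blast
  interpret A: bounded_linear "on_ell2 A" by (rule clinear_op_bl[OF h0_bounded_clinear[OF A]])
  interpret B: bounded_linear "on_ell2 B" by (rule clinear_op_bl[OF h0_bounded_clinear[OF B]])
  have in_l2: "opadd A B x \<in> l2" if "x \<in> l2" for x
    using A B that by (auto simp: opadd_def h0_bounded_def intro!: l2_add)
  obtain K L where KL: "\<And>x. norm (on_ell2 A x) \<le> norm x * K" "\<And>x. norm (on_ell2 B x) \<le> norm x * L"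
    using A.bounded B.bounded by blast
  have "l2norm (opadd A B x) \<le> (K + L) * l2norm x" if x: "x \<in> l2" for x
  proof -
    have "l2norm (opadd A B x) = norm (on_ell2 (opadd A B) (Abs_ell2 x))"
      by (simp add: on_ell2_Abs[OF x] norm_ell2.rep_eq Abs_ell2_inverse in_l2[OF x])
    also have "\<dots> \<le> norm (Abs_ell2 x) * K + norm (Abs_ell2 x) * L"
      unfolding on by (intro norm_triangle_le add_mono KL)
    finally show ?thesis by (simp add: norm_ell2.rep_eq Abs_ell2_inverse x algebra_simps)
  qed
  moreover have "opadd A B (\<lambda>l. c * x l + y l) = (\<lambda>l. c * opadd A B x l + opadd A B y l)" if "x \<in> l2" "y \<in> l2" for c x y
    unfolding opadd_def h0_bounded_linear[OF A that] h0_bounded_linear[OF B that] by (simp add: algebra_simps)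
  ultimately show "h0_bounded (opadd A B)" using in_l2 unfolding h0_bounded_def by blast
qed

lemma compact_op_add:
  assumes "compact_op A" "compact_op B" shows "compact_op (\<lambda>x. A x + B x)"
  unfolding compact_op_def
proof (intro allI impI)
  fix x :: "nat \<Rightarrow> ell2" assume x: "\<forall>k. norm (x k) \<le> 1"
  obtain r :: "nat \<Rightarrow> nat" where r: "strict_mono r" "Cauchy (\<lambda>k. A (x (r k)))"
    using assms(1)[unfolded compact_op_def, rule_format, of x] x by blast
  obtain s :: "nat \<Rightarrow> nat" where s: "strict_mono s" "Cauchy (\<lambda>k. B (x (r (s k))))"
    using assms(2)[unfolded compact_op_def, rule_format, of "\<lambda>k. x (r k)"] x by blast
  have "Cauchy (\<lambda>k. A (x (r (s k))))" using Cauchy_subseq_Cauchy[OF r(2) s(1)] by (simp add: o_def)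
  then have "Cauchy (\<lambda>k. A (x (r (s k))) + B (x (r (s k))))"
    using s(2) unfolding Cauchy_convergent_iff by (rule convergent_add)
  then show "\<exists>r::nat\<Rightarrow>nat. strict_mono r \<and> Cauchy (\<lambda>k. A (x (r k)) + B (x (r k)))"
    using strict_mono_o[OF r(1) s(1)] by (intro exI[of _ "r \<circ> s"]) (simp add: o_def)
qed

lemma L1inf_opadd:
  assumes A: "h0_positive A" "L1inf A" and B: "h0_positive B" "L1inf B"
  shows opadd_positive: "h0_positive (opadd A B)" and opadd_L1inf: "L1inf (opadd A B)"
    and partial_trace_subadd: "partial_trace (opadd A B) n \<le> partial_trace A n + partial_trace B n"
    and partial_trace_superadd: "partial_trace A n + partial_trace B n \<le> partial_trace (opadd A B) (2 * n)"
proof -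
  have b: "h0_bounded A" "h0_bounded B" using A B by (auto simp: h0_positive_def)
  have cp: "h0_compact A" "h0_compact B" using A B by (auto simp: L1inf_def)
  obtain e where e: "eigensystem (on_ell2 A) (singvals A) e" "positive_op (on_ell2 A)"
    using positive_compact_eigensystem[OF A(1) cp(1)] .
  obtain f where f: "eigensystem (on_ell2 B) (singvals B) f" "positive_op (on_ell2 B)"
    using positive_compact_eigensystem[OF B(1) cp(2)] .
  show pos: "h0_positive (opadd A B)"
    using h0_bounded_opadd[OF b] positive_op_add[OF e(2) f(2)] by (simp add: h0_positive_iff)
  have com: "h0_compact (opadd A B)"
    using h0_bounded_opadd[OF b] compact_op_add cp by (simp add: h0_compact_iff)
  obtain g where g: "eigensystem (on_ell2 (opadd A B)) (singvals (opadd A B)) g"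
    using positive_compact_eigensystem[OF pos com] .
  note g' = g[unfolded h0_bounded_opadd(2)[OF b]]
  show sub: "partial_trace (opadd A B) n \<le> partial_trace A n + partial_trace B n" for n
    unfolding partial_trace_def by (rule eigensum_subadd[OF e(2,1) f(2,1) g'])
  show "partial_trace A n + partial_trace B n \<le> partial_trace (opadd A B) (2 * n)"
    unfolding partial_trace_def by (rule eigensum_superadd[OF e(2,1) f(2,1) g'])
  have "(\<lambda>n. partial_trace A n + partial_trace B n) \<in> O(\<lambda>N. ln (real N))"
    using A(2) B(2) by (auto simp: L1inf_def intro: sum_in_bigo)
  then have "partial_trace (opadd A B) \<in> O(\<lambda>N. ln (real N))"
    by (rule landau_o.big_trans[rotated])
       (intro landau_o.bigI[of 1] always_eventually, simp, use sub partial_trace_mono_nonneg[OF pos com] partial_trace_mono_nonneg[OF A(1) cp(1)] partial_trace_mono_nonneg[OF B(1) cp(2)] in force)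
  then show "L1inf (opadd A B)" using com by (simp add: L1inf_def)
qed

lemma dix_avg_Cb:
  assumes A: "h0_positive A" "L1inf A" shows "(\<lambda>t. complex_of_real (dix_avg A t)) \<in> Cb"
proof -
  have cp: "h0_compact A" and O: "partial_trace A \<in> O(\<lambda>N. ln (real N))" using A(2) by (auto simp: L1inf_def)
  obtain C where C: "\<And>\<Lambda>. exp 1 \<le> \<Lambda> \<Longrightarrow> 0 \<le> log_avg (partial_trace A) \<Lambda> \<and> log_avg (partial_trace A) \<Lambda> \<le> C"
    using log_avg_bounds[OF partial_trace_mono_nonneg[OF A(1) cp] O] by blast
  have "bounded ((\<lambda>t. complex_of_real (log_avg (partial_trace A) t)) ` {exp 1..})"
    unfolding bounded_iff using C by (intro exI[of _ C]) auto
  then show ?thesis unfolding Cb_def dix_avg_eq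
    by (auto intro!: continuous_intros continuous_on_log_avg)
qed

text \<open>For the averages, additivity is only asymptotic, by \<open>log_avg_additive\<close>; it
  becomes exact because a state vanishes on functions that tend to 0.\<close>

lemma trpos_opadd:
  assumes \<omega>: "dixmier_state \<omega>" and A: "h0_positive A" "L1inf A" and B: "h0_positive B" "L1inf B"
  shows "trpos \<omega> (opadd A B) = trpos \<omega> A + trpos \<omega> B"
proof -
  let ?C = "opadd A B"
  have C: "h0_positive ?C" "L1inf ?C" using opadd_positive[OF A B] opadd_L1inf[OF A B] by auto
  have cp: "h0_compact A" "h0_compact B" "h0_compact ?C" "partial_trace ?C \<in> O(\<lambda>N. ln (real N))"
    using A B C by (auto simp: L1inf_def)
  have "((\<lambda>t. dix_avg A t + dix_avg B t - dix_avg ?C t) \<longlongrightarrow> 0) at_top"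
    unfolding dix_avg_eq
    by (rule log_avg_additive)
       (use partial_trace_mono_nonneg[OF A(1) cp(1)] partial_trace_mono_nonneg[OF B(1) cp(2)] partial_trace_mono_nonneg[OF C(1) cp(3)] cp(4)
         partial_trace_subadd[OF A B] partial_trace_superadd[OF A B] in auto)
  then have lim: "((\<lambda>t. complex_of_real (dix_avg A t) + complex_of_real (dix_avg B t) - complex_of_real (dix_avg ?C t)) \<longlongrightarrow> 0) at_top"
    using tendsto_of_real[of _ 0 at_top, where 'a=complex] by fastforce
  have AB: "(\<lambda>t. complex_of_real (dix_avg A t) + complex_of_real (dix_avg B t)) \<in> Cb"
    using Cb_lincomb[OF dix_avg_Cb[OF A] dix_avg_Cb[OF B], of 1] by simp
  have ABC: "(\<lambda>t. complex_of_real (dix_avg A t) + complex_of_real (dix_avg B t) - complex_of_real (dix_avg ?C t)) \<in> Cb"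
    using Cb_lincomb[OF dix_avg_Cb[OF C] AB, of "-1"] by (simp add: algebra_simps)
  have "0 = \<omega> (\<lambda>t. complex_of_real (dix_avg A t) + complex_of_real (dix_avg B t) - complex_of_real (dix_avg ?C t))"
    using dixmier_state_limit[OF \<omega> ABC lim] by simp
  also have "\<dots> = trpos \<omega> A + trpos \<omega> B - trpos \<omega> ?C"
    using dixmier_state_diff[OF \<omega> AB dix_avg_Cb[OF C]] dixmier_state_add[OF \<omega> dix_avg_Cb[OF A] dix_avg_Cb[OF B]]
    by (simp add: trpos_def)
  finally show ?thesis by simp
qed

text \<open>Polarisation at \<open>x + U x\<close>: the cross terms equal twice the squared norm of
  \<open>U x\<close>.\<close>

lemma self_adjoint_quad_zero:
  fixes U :: "ell2 \<Rightarrow> ell2"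
  assumes add: "\<And>x y. U (x + y) = U x + U y" and sa: "\<And>x y. cinner (U x) y = cinner x (U y)"
    and q: "\<And>x. inner (U x) x = 0"
  shows "U x = 0"
proof -
  have sa': "inner (U x) y = inner (U y) x" for x y
    by (metis sa inner_ell2_def inner_commute)
  have "inner (U x) (U x) = 0"
    using q[of "x + U x"] q[of x] q[of "U x"] sa'[of "U x" x] by (simp add: add inner_add_left inner_add_right)
  then show ?thesis by simp
qed

text \<open>Independence of the decomposition. The differences \<open>U\<close> and \<open>V\<close>
  of the real and imaginary parts are self-adjoint with \<open>U + i V = 0\<close>; their quadratic
  forms are real, so both vanish, and so do \<open>U\<close> and \<open>V\<close>. Moving the
  negative parts to the other side gives equal sums of positive operators, to which
  \<open>trpos_opadd\<close> applies.\<close>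

lemma dixmier_trace_eqI:
  assumes \<omega>: "dixmier_state \<omega>"
    and pos: "\<And>S. S \<in> {A1, A2, A3, A4} \<Longrightarrow> h0_positive S \<and> L1inf S"
    and T: "\<And>x. x \<in> l2 \<Longrightarrow> T x = (\<lambda>l. A1 x l - A2 x l + \<i> * (A3 x l - A4 x l))"
  shows "dixmier_trace \<omega> T = trpos \<omega> A1 - trpos \<omega> A2 + \<i> * (trpos \<omega> A3 - trpos \<omega> A4)"
proof -
  let ?P = "\<lambda>c. \<exists>T1 T2 T3 T4. (\<forall>S\<in>{T1, T2, T3, T4}. h0_positive S \<and> L1inf S) \<and>
      (\<forall>x\<in>l2. T x = (\<lambda>l. T1 x l - T2 x l + \<i> * (T3 x l - T4 x l))) \<and>
      c = trpos \<omega> T1 - trpos \<omega> T2 + \<i> * (trpos \<omega> T3 - trpos \<omega> T4)"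
  have "?P (trpos \<omega> A1 - trpos \<omega> A2 + \<i> * (trpos \<omega> A3 - trpos \<omega> A4))"
    by (rule exI[of _ A1], rule exI[of _ A2], rule exI[of _ A3], rule exI[of _ A4]) (use pos T in blast)
  then have "?P (dixmier_trace \<omega> T)" unfolding dixmier_trace_def by (rule someI[of ?P])
  then obtain T1 T2 T3 T4 where posT: "\<forall>S\<in>{T1, T2, T3, T4}. h0_positive S \<and> L1inf S"
    and TT: "\<forall>x\<in>l2. T x = (\<lambda>l. T1 x l - T2 x l + \<i> * (T3 x l - T4 x l))"
    and c: "dixmier_trace \<omega> T = trpos \<omega> T1 - trpos \<omega> T2 + \<i> * (trpos \<omega> T3 - trpos \<omega> T4)" by blast
  have b: "h0_bounded S" "positive_op (on_ell2 S)" if "S \<in> {A1, A2, A3, A4, T1, T2, T3, T4}" for S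
    using that pos posT by (auto simp: h0_positive_iff)
  note lins = clinear_op_bl[OF h0_bounded_clinear[OF b(1)]]
  define U where "U = (\<lambda>x. (on_ell2 A1 x + on_ell2 T2 x) - (on_ell2 T1 x + on_ell2 A2 x))"
  define V where "V = (\<lambda>x. (on_ell2 A3 x + on_ell2 T4 x) - (on_ell2 T3 x + on_ell2 A4 x))"
  have ladd: "on_ell2 S (x + y) = on_ell2 S x + on_ell2 S y" if "S \<in> {A1, A2, A3, A4, T1, T2, T3, T4}" for S x y
    using lins[OF that] by (simp add: linear_simps)
  have lsa: "cinner (on_ell2 S x) y = cinner x (on_ell2 S y)" if "S \<in> {A1, A2, A3, A4, T1, T2, T3, T4}" for S x y
    using b(2)[OF that] by (simp add: positive_op_def)
  have Uadd: "U (x + y) = U x + U y" and Vadd: "V (x + y) = V x + V y" for x y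
    by (simp_all add: U_def V_def ladd)
  have Usa: "cinner (U x) y = cinner x (U y)" and Vsa: "cinner (V x) y = cinner x (V y)" for x y
    by (simp_all add: U_def V_def cinner_diff_left cinner_diff_right cinner_add_left cinner_add_right lsa)
  have UV: "U x + \<i> *\<^sub>C V x = 0" for x
  proof -
    have R: "Rep_ell2 (on_ell2 S x) = S (Rep_ell2 x)" if "S \<in> {A1, A2, A3, A4, T1, T2, T3, T4}" for S
      by (rule Rep_on_ell2[OF b(1)[OF that]])
    have "A1 (Rep_ell2 x) l - A2 (Rep_ell2 x) l + \<i> * (A3 (Rep_ell2 x) l - A4 (Rep_ell2 x) l)
        = T1 (Rep_ell2 x) l - T2 (Rep_ell2 x) l + \<i> * (T3 (Rep_ell2 x) l - T4 (Rep_ell2 x) l)" for l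
      using T[OF Rep_ell2[of x]] TT[rule_format, OF Rep_ell2[of x]] by (simp add: fun_eq_iff)
    note this[unfolded right_diff_distrib]
    then show ?thesis
      unfolding Rep_ell2_inject[symmetric] U_def V_def
      by (simp add: plus_ell2.rep_eq minus_ell2.rep_eq scaleC.rep_eq zero_ell2.rep_eq R fun_eq_iff)
         (simp add: algebra_simps)
  qed
  have real: "Im (cinner (U x) x) = 0 \<and> Im (cinner (V x) x) = 0" for x
    using cinner_commute[of "U x" x] cinner_commute[of "V x" x] Usa[of x x] Vsa[of x x] by (simp add: complex_eq_iff)
  have UVq: "cinner (U x) x + \<i> * cinner (V x) x = 0" for x
    using UV[of x] by (metis cinner_add_left cinner_scaleC_left cinner_zero_left)
  have q: "inner (U x) x = 0 \<and> inner (V x) x = 0" for x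
    using real[of x] UVq[of x] by (simp add: inner_ell2_def complex_eq_iff)
  have "U x = 0" "V x = 0" for x
    using self_adjoint_quad_zero[OF Uadd Usa] self_adjoint_quad_zero[OF Vadd Vsa] q by auto
  then have e: "on_ell2 (opadd A1 T2) = on_ell2 (opadd T1 A2)" "on_ell2 (opadd A3 T4) = on_ell2 (opadd T3 A4)"
    by (simp_all add: h0_bounded_opadd b U_def V_def fun_eq_iff)
  have eq: "trpos \<omega> X = trpos \<omega> Y" if "on_ell2 X = on_ell2 Y" "h0_bounded X" "h0_bounded Y" for X Y
  proof -
    have "X x = Y x" if "x \<in> l2" for x
      using \<open>on_ell2 X = on_ell2 Y\<close> Rep_on_ell2[OF \<open>h0_bounded X\<close>, of "Abs_ell2 x"] Rep_on_ell2[OF \<open>h0_bounded Y\<close>, of "Abs_ell2 x"] that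
      by (simp add: Abs_ell2_inverse)
    from partial_trace_cong[OF this] show ?thesis by (simp add: trpos_def dix_avg_eq)
  qed
  have "trpos \<omega> (opadd A1 T2) = trpos \<omega> (opadd T1 A2)" "trpos \<omega> (opadd A3 T4) = trpos \<omega> (opadd T3 A4)"
    by (intro eq e h0_bounded_opadd b; simp)+
  then have "trpos \<omega> A1 + trpos \<omega> T2 = trpos \<omega> T1 + trpos \<omega> A2" "trpos \<omega> A3 + trpos \<omega> T4 = trpos \<omega> T3 + trpos \<omega> A4"
    using pos posT by (simp_all add: trpos_opadd[OF \<omega>])
  then have d: "trpos \<omega> T1 - trpos \<omega> T2 = trpos \<omega> A1 - trpos \<omega> A2" "trpos \<omega> T3 - trpos \<omega> T4 = trpos \<omega> A3 - trpos \<omega> A4"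
    by (simp_all add: algebra_simps)
  show ?thesis unfolding c d ..
qed

section \<open>Sums over the lattice\<close>

lemma ivec_simps: "ivec (a + b) = ivec a + ivec b" "ivec (a - b) = ivec a - ivec b" "ivec (- a) = - ivec a" "ivec 0 = 0"
  by (simp_all add: ivec_def vec_eq_iff)

lemma ivec_eq_0_iff [simp]: "ivec l = 0 \<longleftrightarrow> l = 0"
  by (simp add: ivec_def vec_eq_iff)

lemma lnorm_nonneg [simp]: "0 \<le> lnorm l" and lnorm_0 [simp]: "lnorm 0 = 0"
  by (simp_all add: lnorm_def ivec_simps)

lemma lnorm_triangle: "lnorm (a + b) \<le> lnorm a + lnorm b"
  by (simp add: lnorm_def ivec_simps norm_triangle_ineq)

lemma lnorm_minus_commute: "lnorm (a - b) = lnorm (b - a)"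
  by (simp add: lnorm_def ivec_simps norm_minus_commute)

lemma component_le_lnorm: "\<bar>real_of_int (l $ k)\<bar> \<le> lnorm l"
  using component_le_norm_cart[of "ivec l" k] by (simp add: ivec_def lnorm_def)

lemma lnorm_ge_1: assumes "l \<noteq> 0" shows "1 \<le> lnorm l"
proof -
  obtain k where "l $ k \<noteq> 0" using assms by (auto simp: vec_eq_iff)
  then have "1 \<le> \<bar>real_of_int (l $ k)\<bar>" by linarith
  then show ?thesis using component_le_lnorm[of l k] by linarith
qed

text \<open>Each coordinate takes at most \<open>2 * floor R + 1 \<le> 3 * R\<close> values, and
  \<open>81 = 3 ^ 4\<close>.\<close>

lemma lattice_ball:
  assumes "1 \<le> R"
  shows finite_lattice_ball: "finite {l. lnorm l \<le> R}" and card_lattice_ball: "real (card {l. lnorm l \<le> R}) \<le> 81 * R ^ 4"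
proof -
  define A where "A = {- \<lfloor>R\<rfloor>..\<lfloor>R\<rfloor>}"
  let ?P = "PiE (UNIV :: 4 set) (\<lambda>_. A)"
  have sub: "{l. lnorm l \<le> R} \<subseteq> vec_lambda ` ?P"
  proof
    fix l assume "l \<in> {l. lnorm l \<le> R}"
    then have "\<bar>real_of_int (l $ k)\<bar> \<le> R" for k using component_le_lnorm[of l k] by simp
    then have "l $ k \<in> A" for k unfolding A_def by (metis abs_le_iff atLeastAtMost_iff le_floor_iff minus_le_iff of_int_minus)
    then have "vec_nth l \<in> ?P" by auto
    then show "l \<in> vec_lambda ` ?P" by (intro image_eqI[of _ _ "vec_nth l"]) auto
  qed
  have fin: "finite ?P" by (intro finite_PiE) (auto simp: A_def)
  then show "finite {l. lnorm l \<le> R}" using sub finite_subset by blast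
  have "card {l. lnorm l \<le> R} \<le> card ?P"
    using card_mono[OF finite_imageI[OF fin] sub] card_image_le[OF fin, of vec_lambda] by linarith
  also have "card ?P = card A ^ 4" by (simp add: card_PiE)
  finally have "real (card {l. lnorm l \<le> R}) \<le> real (card A) ^ 4" by (metis of_nat_le_iff of_nat_power)
  also have "\<dots> \<le> (3 * R) ^ 4" using assms unfolding A_def by (intro power_mono) (auto, linarith)
  finally show "real (card {l. lnorm l \<le> R}) \<le> 81 * R ^ 4" by (simp add: power_mult_distrib)
qed

text \<open>A shell between \<open>Q\<close> and \<open>2 * Q\<close> has at most
  \<open>81 * (2 * Q) ^ 4\<close> points, each contributing at most \<open>1 / Q ^ (q + 4)\<close>;
  this gives \<open>1296 = 81 * 16\<close>.\<close>

lemma lattice_dyadic_shells: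
  assumes R: "1 \<le> R"
  shows "(\<Sum>l\<in>{l. R \<le> lnorm l \<and> lnorm l < 2 ^ J * R}. 1 / lnorm l ^ (q + 4)) \<le> 1296 / R ^ q * (\<Sum>j<J. (1 / 2 ^ q) ^ j)"
proof (induction J)
  case 0
  have "{l. R \<le> lnorm l \<and> lnorm l < 2 ^ 0 * R} = {}" by auto
  then show ?case by (simp only: sum.empty lessThan_0 mult_zero_right)
next
  case (Suc J)
  let ?Q = "2 ^ J * R"
  have Q: "1 \<le> ?Q" "R \<le> ?Q"
    using R mult_mono[of 1 "2 ^ J" 1 R] mult_right_mono[of 1 "2 ^ J" R] by auto
  have Q2: "1 \<le> 2 * ?Q" using Q by linarith
  have fin: "finite {l. R \<le> lnorm l \<and> lnorm l < 2 ^ Suc J * R}"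
    by (rule finite_subset[OF _ finite_lattice_ball[OF Q2]]) auto
  have split: "{l. R \<le> lnorm l \<and> lnorm l < 2 ^ Suc J * R} = {l. R \<le> lnorm l \<and> lnorm l < ?Q} \<union> {l. ?Q \<le> lnorm l \<and> lnorm l < 2 ^ Suc J * R}"
    using Q R by (auto intro: order_trans[OF Q(2)])
  have "(\<Sum>l\<in>{l. ?Q \<le> lnorm l \<and> lnorm l < 2 ^ Suc J * R}. 1 / lnorm l ^ (q + 4)) \<le> (\<Sum>l\<in>{l. lnorm l \<le> 2 * ?Q}. 1 / ?Q ^ (q + 4))"
    by (rule sum_le_included[where i="\<lambda>l. l"])
       (use Q finite_lattice_ball[OF Q2] in \<open>auto intro!: finite_subset[OF _ fin] frac_le power_mono\<close>)
  also have "\<dots> = real (card {l. lnorm l \<le> 2 * ?Q}) / ?Q ^ (q + 4)" by simp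
  also have "\<dots> \<le> 81 * (2 * ?Q) ^ 4 / ?Q ^ (q + 4)" by (intro divide_right_mono card_lattice_ball[OF Q2]) (use R in simp)
  also have "\<dots> = 1296 / ?Q ^ q" using R by (simp add: power_add power_mult_distrib)
  also have "\<dots> = 1296 / R ^ q * (1 / 2 ^ q) ^ J"
    by (simp add: power_mult_distrib power_one_over flip: power_mult)
  finally have shell: "(\<Sum>l\<in>{l. ?Q \<le> lnorm l \<and> lnorm l < 2 ^ Suc J * R}. 1 / lnorm l ^ (q + 4)) \<le> 1296 / R ^ q * (1 / 2 ^ q) ^ J" .
  have "(\<Sum>l\<in>{l. R \<le> lnorm l \<and> lnorm l < 2 ^ Suc J * R}. 1 / lnorm l ^ (q + 4))
     = (\<Sum>l\<in>{l. R \<le> lnorm l \<and> lnorm l < ?Q}. 1 / lnorm l ^ (q + 4)) + (\<Sum>l\<in>{l. ?Q \<le> lnorm l \<and> lnorm l < 2 ^ Suc J * R}. 1 / lnorm l ^ (q + 4))"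
    unfolding split by (rule sum.union_disjoint) (use fin split in \<open>auto intro: finite_subset[OF _ fin]\<close>)
  with Suc.IH shell show ?case by (simp add: distrib_left)
qed

text \<open>The shell bounds form a geometric series whose ratio is at most \<open>1 / 2\<close>
  because \<open>q \<ge> 1\<close>, hence \<open>2592 = 2 * 1296\<close>.\<close>

lemma lattice_tail:
  assumes q: "1 \<le> q" and R: "1 \<le> R" and F: "finite F" "\<And>l. l \<in> F \<Longrightarrow> R \<le> lnorm l"
  shows "(\<Sum>l\<in>F. 1 / lnorm l ^ (q + 4)) \<le> 2592 / R ^ q"
proof -
  define B where "B = (\<Sum>l\<in>F. lnorm l)"
  have B: "\<forall>l\<in>F. lnorm l \<le> B" unfolding B_def using F(1) by (auto intro: member_le_sum)
  obtain J where J: "B < 2 ^ J" using real_arch_pow[of 2 B] by auto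
  let ?S = "{l. R \<le> lnorm l \<and> lnorm l < 2 ^ J * R}"
  have "1 \<le> 2 ^ J * R" using R mult_mono[of 1 "2 ^ J" 1 R] by simp
  then have "finite ?S" by (intro finite_subset[OF _ finite_lattice_ball[of "2 ^ J * R"]]) auto
  moreover have "F \<subseteq> ?S"
  proof
    fix l assume l: "l \<in> F"
    have "2 ^ J * 1 \<le> 2 ^ J * R" using R by (intro mult_left_mono) auto
    moreover have "lnorm l \<le> B" using B l by blast
    ultimately have "lnorm l < 2 ^ J * R" using J by linarith
    then show "l \<in> ?S" using F(2)[OF l] by simp
  qed
  ultimately have "(\<Sum>l\<in>F. 1 / lnorm l ^ (q + 4)) \<le> (\<Sum>l\<in>?S. 1 / lnorm l ^ (q + 4))" by (intro sum_mono2) auto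
  also have "\<dots> \<le> 1296 / R ^ q * (\<Sum>j<J. (1 / 2 ^ q) ^ j)" by (rule lattice_dyadic_shells[OF R])
  also have "\<dots> \<le> 1296 / R ^ q * 2"
  proof (rule mult_left_mono)
    have "(1 / 2 ^ q :: real) \<le> 1 / 2" using q power_increasing[of 1 q "2::real"] by (simp add: field_simps)
    then have "(\<Sum>j<J. (1 / 2 ^ q :: real) ^ j) \<le> (\<Sum>j<J. (1/2) ^ j)" by (intro sum_mono power_mono) auto
    also have "\<dots> \<le> (\<Sum>j. (1/2) ^ j)" by (rule sum_le_suminf) (auto simp: summable_geometric)
    also have "(\<Sum>j. (1/2::real) ^ j) = 2" by (subst suminf_geometric) auto
    finally show "(\<Sum>j<J. (1 / 2 ^ q :: real) ^ j) \<le> 2" .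
  qed (use R in simp)
  finally show ?thesis by simp
qed

section \<open>Riemann sums and logarithmic sums over the lattice\<close>

definition cell :: "real \<Rightarrow> lat \<Rightarrow> freq set" where
  "cell R l = {x. \<forall>k. of_int (l $ k) \<le> R * x $ k \<and> R * x $ k < of_int (l $ k) + 1}"

lemma cell_borel [measurable]: "cell R l \<in> sets borel"
proof -
  have [measurable]: "(\<lambda>x::freq. x $ k) \<in> borel_measurable borel" for k
    by (intro borel_measurable_continuous_onI continuous_intros)
  show ?thesis unfolding cell_def by measurable
qed

lemma cell_measure:
  assumes R: "R > 0" shows "emeasure lborel (cell R l) = ennreal (1 / R ^ 4)"
proof -
  define a b :: freq where "a = (1/R) *\<^sub>R ivec l" and "b = (\<chi> k. (of_int (l $ k) + 1) / R)"
  have ab: "b $ k - a $ k = 1 / R" for k by (simp add: a_def b_def ivec_def add_divide_distrib)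
  have sub: "box a b \<subseteq> cell R l" "cell R l \<subseteq> cbox a b"
    using R by (auto simp: cell_def mem_box_cart a_def b_def ivec_def field_simps less_imp_le)
  have le: "a \<bullet> i \<le> b \<bullet> i" if "i \<in> Basis" for i
    using that R ab by (auto simp: Basis_vec_def inner_axis) (metis diff_ge_0_iff_ge divide_nonneg_pos zero_le_one)
  have "(\<Prod>i\<in>Basis. (b - a) \<bullet> i) = (\<Prod>i\<in>(Basis :: freq set). 1 / R)"
    by (intro prod.cong refl) (auto simp: Basis_vec_def inner_axis ab)
  also have "\<dots> = 1 / R ^ 4" by (simp add: power_one_over)
  finally have p: "(\<Prod>i\<in>Basis. (b - a) \<bullet> i) = 1 / R ^ 4" .
  have "emeasure lborel (box a b) = ennreal (1 / R ^ 4)" "emeasure lborel (cbox a b) = ennreal (1 / R ^ 4)"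
    using le p by (simp_all add: emeasure_lborel_box_eq emeasure_lborel_cbox_eq)
  then show ?thesis
    using emeasure_mono[OF sub(1), of lborel] emeasure_mono[OF sub(2), of lborel] by (simp add: antisym)
qed

definition lfloor :: "real \<Rightarrow> freq \<Rightarrow> lat" where
  "lfloor R x = (\<chi> k. \<lfloor>R * x $ k\<rfloor>)"

lemma mem_cell_iff: "x \<in> cell R l \<longleftrightarrow> lfloor R x = l"
  by (simp add: cell_def lfloor_def vec_eq_iff floor_eq_iff)

text \<open>Each of the four coordinates moves by at most 1, hence \<open>sqrt 4\<close>.\<close>

lemma lfloor_close: "norm (ivec (lfloor R x) - R *\<^sub>R x) \<le> 2"
proof -
  have "(norm (ivec (lfloor R x) - R *\<^sub>R x))\<^sup>2 = (\<Sum>k\<in>UNIV. (of_int \<lfloor>R * x $ k\<rfloor> - R * x $ k)\<^sup>2)"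
    by (simp add: norm_vec_def L2_set_def sum_nonneg ivec_def lfloor_def power2_commute)
  also have "\<dots> \<le> (\<Sum>k\<in>(UNIV::4 set). 1)"
  proof (rule sum_mono)
    fix k :: 4
    have "\<bar>of_int \<lfloor>R * x $ k\<rfloor> - R * x $ k\<bar> \<le> 1" by linarith
    then show "(of_int \<lfloor>R * x $ k\<rfloor> - R * x $ k)\<^sup>2 \<le> 1" by (simp add: abs_square_le_1)
  qed
  finally have "(norm (ivec (lfloor R x) - R *\<^sub>R x))\<^sup>2 \<le> 2\<^sup>2" by simp
  then show ?thesis by (rule power2_le_imp_le) simp
qed

text \<open>The scaled sum is the integral of a step function that is constant on the cells, which
  have volume \<open>1 / R ^ 4\<close>; in this form dominated convergence can be applied to
  it.\<close>

lemma lattice_sum_eq_integral: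
  fixes F :: "lat \<Rightarrow> real"
  assumes R: "R > 0" and A: "finite A"
  shows "(\<Sum>l\<in>A. F l) / R ^ 4 = (\<integral>x. (if lfloor R x \<in> A then F (lfloor R x) else 0) \<partial>lborel)"
    and "(\<lambda>x. if lfloor R x \<in> A then F (lfloor R x) else 0) \<in> borel_measurable lborel"
proof -
  have eq: "(\<lambda>x. if lfloor R x \<in> A then F (lfloor R x) else 0) = (\<lambda>x. \<Sum>l\<in>A. F l * indicator (cell R l) x)"
  proof
    fix x
    have "(\<Sum>l\<in>A. F l * indicator (cell R l) x) = (\<Sum>l\<in>A. if l = lfloor R x then F (lfloor R x) else 0)"
      by (intro sum.cong refl) (auto simp: indicator_def mem_cell_iff)
    then show "(if lfloor R x \<in> A then F (lfloor R x) else 0) = (\<Sum>l\<in>A. F l * indicator (cell R l) x)"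
      using A by simp
  qed
  have fin: "emeasure lborel (cell R l) < \<infinity>" for l by (simp add: cell_measure[OF R])
  have m: "measure lborel (cell R l) = 1 / R ^ 4" for l using R by (simp add: measure_def cell_measure)
  show "(\<Sum>l\<in>A. F l) / R ^ 4 = (\<integral>x. (if lfloor R x \<in> A then F (lfloor R x) else 0) \<partial>lborel)"
    unfolding eq using fin by (subst Bochner_Integration.integral_sum) (auto simp: m sum_divide_distrib)
  show "(\<lambda>x. if lfloor R x \<in> A then F (lfloor R x) else 0) \<in> borel_measurable lborel"
    unfolding eq by measurable
qed

text \<open>A punctured ball: the origin is left out because functions homogeneous of degree 0 and
  negative powers of \<open>lnorm\<close> carry no information there.\<close>

abbreviation lshell :: "real \<Rightarrow> lat set" where
  "lshell R \<equiv> {l. l \<noteq> 0 \<and> lnorm l \<le> R}"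

lemma finite_lshell: "finite (lshell R)"
  by (rule finite_subset[OF _ finite_lattice_ball[of "max 1 R"]]) auto

text \<open>By homogeneity \<open>h\<close> at a lattice point equals \<open>h\<close> at that point
  divided by \<open>R\<close>, so the step functions converge to \<open>h\<close> inside the unit
  ball and to 0 outside it. The exceptions are the origin and the unit sphere, which form a null
  set.\<close>

lemma lattice_Riemann_sum:
  fixes h :: "freq \<Rightarrow> real"
  assumes cont: "continuous_on (UNIV - {0}) h" and hom: "\<And>t x. t > 0 \<Longrightarrow> x \<noteq> 0 \<Longrightarrow> h (t *\<^sub>R x) = h x"
    and bd: "\<And>x. x \<noteq> 0 \<Longrightarrow> \<bar>h x\<bar> \<le> M"
  shows "((\<lambda>R. (\<Sum>l\<in>lshell R. h (ivec l)) / R ^ 4) \<longlongrightarrow> integral (ball 0 1) h) at_top"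
    and "h integrable_on ball 0 1"
proof -
  have M0: "0 \<le> M" using bd[of "axis 1 1"] by (simp add: axis_eq_0_iff)
  define f where "f = (\<lambda>x. indicator (ball 0 1 - {0}) x *\<^sub>R h x)"
  have fm: "f \<in> borel_measurable lborel"
    unfolding f_def measurable_lborel2
    by (rule borel_measurable_continuous_on_indicator) (auto intro: continuous_on_subset[OF cont])
  define s where "s = (\<lambda>R x. if lfloor R x \<in> lshell R then h (ivec (lfloor R x)) else 0)"
  \<comment> \<open>The convergence theorem asks for measurability at every real \<open>R\<close>;
    the cells are available only for positive \<open>R\<close>.\<close>
  define s' where "s' = (\<lambda>R. if R > 0 then s R else (\<lambda>_. 0))"
  \<comment> \<open>Radius 3: if the cell corner of \<open>x\<close> lies in \<open>lshell R\<close>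
    and \<open>R \<ge> 1\<close>, then \<open>R * norm x \<le> R + 2 \<le> 3 * R\<close>.\<close>
  have ball3: "integrable lborel (\<lambda>x::freq. M * indicator (cball 0 3) x)"
    by (intro integrable_mult_right integrable_real_indicator emeasure_bounded_finite) auto
  have lim: "((\<lambda>R. integral\<^sup>L lborel (s' R)) \<longlongrightarrow> integral\<^sup>L lborel f) at_top"
  proof (rule integral_dominated_convergence_at_top[where w="\<lambda>x. M * indicator (cball 0 3) x"])
    show "s' R \<in> borel_measurable lborel" for R
      using lattice_sum_eq_integral(2)[where A="lshell R" and R=R and F="\<lambda>l. h (ivec l)", OF _ finite_lshell] by (auto simp: s'_def s_def)
    have "sphere (0::freq) 1 \<in> null_sets lborel"
      using negligible_sphere[of "0::freq" 1] by (simp add: negligible_iff_null_sets null_sets_completion_iff)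
    moreover have "{0::freq} \<in> null_sets lborel" by (auto simp: null_sets_def)
    ultimately have "AE x in lborel. x \<notin> sphere (0::freq) 1 \<and> x \<notin> {0}" by (intro AE_conjI AE_not_in)
    then show "AE x in lborel. ((\<lambda>R. s' R x) \<longlongrightarrow> f x) at_top"
    proof eventually_elim
      case (elim x)
      then have x: "x \<noteq> 0" "norm x \<noteq> 1" by auto
      define y where "y = (\<lambda>R. (1/R) *\<^sub>R ivec (lfloor R x))"
      have ylim: "(y \<longlongrightarrow> x) at_top"
      proof (rule LIM_zero_cancel, rule Lim_null_comparison)
        show "\<forall>\<^sub>F R in at_top. norm (y R - x) \<le> 2 * inverse R"
          using eventually_gt_at_top[of 0]
        proof eventually_elim
          case (elim R)
          then have "y R - x = (1/R) *\<^sub>R (ivec (lfloor R x) - R *\<^sub>R x)"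
            by (simp add: y_def scaleR_diff_right)
          then have "norm (y R - x) = norm (ivec (lfloor R x) - R *\<^sub>R x) / R" using elim by simp
          also have "\<dots> \<le> 2 / R" using lfloor_close[of R x] elim by (intro divide_right_mono) auto
          finally show ?case by (simp add: inverse_eq_divide)
        qed
        have "((\<lambda>R. 2 * inverse R) \<longlongrightarrow> 2 * 0) (at_top :: real filter)"
          by (intro tendsto_intros tendsto_inverse_0_at_top filterlim_ident)
        then show "((\<lambda>R. 2 * inverse R) \<longlongrightarrow> 0) (at_top :: real filter)" by simp
      qed
      have ln: "lnorm (lfloor R x) = R * norm (y R)" if "R > 0" for R
        using that by (simp add: lnorm_def y_def)
      show ?case
      proof (cases "norm x < 1")
        case True
        have "\<forall>\<^sub>F R in at_top. norm (y R) < 1" by (rule order_tendstoD(2)[OF tendsto_norm[OF ylim] True])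
        moreover have yne: "\<forall>\<^sub>F R in at_top. y R \<noteq> 0" by (rule tendsto_imp_eventually_ne[OF ylim x(1)])
        ultimately have ev: "\<forall>\<^sub>F R in at_top. h (y R) = s' R x"
          using eventually_gt_at_top[of 0]
        proof eventually_elim
          case (elim R)
          then have "lnorm (lfloor R x) \<le> R" using ln[of R] mult_left_mono[of "norm (y R)" 1 R] by simp
          moreover have "lfloor R x \<noteq> 0" using elim by (auto simp: y_def ivec_simps)
          ultimately have "s' R x = h (ivec (lfloor R x))" using elim by (simp add: s'_def s_def)
          also have "\<dots> = h (y R)" unfolding y_def
            using elim \<open>lfloor R x \<noteq> 0\<close> by (intro hom[symmetric]) auto
          finally show ?case ..
        qed
        have "isCont h x" using cont x(1) by (simp add: continuous_on_eq_continuous_at open_delete)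
        from isCont_tendsto_compose[OF this ylim] have "((\<lambda>R. h (y R)) \<longlongrightarrow> h x) at_top" .
        then have "((\<lambda>R. s' R x) \<longlongrightarrow> h x) at_top" by (rule Lim_transform_eventually[OF _ ev])
        moreover have "f x = h x" using True x by (simp add: f_def)
        ultimately show ?thesis by simp
      next
        case False
        then have "1 < norm x" using x by simp
        then have "\<forall>\<^sub>F R in at_top. 1 < norm (y R)" by (rule order_tendstoD(1)[OF tendsto_norm[OF ylim]])
        then have "\<forall>\<^sub>F R in at_top. 0 = s' R x"
          using eventually_gt_at_top[of 0]
        proof eventually_elim
          case (elim R)
          then have "lnorm (lfloor R x) > R" using ln[of R] mult_strict_left_mono[of 1 "norm (y R)" R] by simp
          then show ?case by (simp add: s'_def s_def)
        qed
        then have "((\<lambda>R. s' R x) \<longlongrightarrow> 0) at_top" by (rule Lim_transform_eventually[OF tendsto_const])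
        moreover have "f x = 0" using False by (simp add: f_def)
        ultimately show ?thesis by simp
      qed
    qed
    show "\<forall>\<^sub>F R in at_top. AE x in lborel. norm (s' R x) \<le> M * indicator (cball 0 3) x"
      using eventually_ge_at_top[of 1]
    proof eventually_elim
      case (elim R)
      have "norm (s' R x) \<le> M * indicator (cball 0 3) x" for x
      proof (cases "lfloor R x \<in> lshell R")
        case True
        have "R * norm x \<le> norm (ivec (lfloor R x)) + 2"
          using lfloor_close[of R x] norm_triangle_ineq3[of "R *\<^sub>R x" "ivec (lfloor R x)"] elim
          by (simp add: norm_minus_commute)
        also have "\<dots> \<le> R * 3" using True elim by (simp add: lnorm_def)
        finally have "norm x \<le> 3" using elim by simp
        then show ?thesis using True elim bd[of "ivec (lfloor R x)"] by (simp add: s'_def s_def)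
      next
        case False
        then have "s' R x = 0" by (auto simp: s'_def s_def)
        then show ?thesis using M0 by simp
      qed
      then show ?case by simp
    qed
  qed (use fm ball3 in auto)
  have fint: "integrable lborel f"
    by (rule Bochner_Integration.integrable_bound[OF ball3 fm])
       (use bd M0 in \<open>auto simp: f_def indicator_def\<close>)
  have "(f has_integral integral\<^sup>L lborel f) UNIV" by (rule has_integral_integral_lborel[OF fint])
  then have "((\<lambda>x. if x \<in> ball 0 1 then h x else 0) has_integral integral\<^sup>L lborel f) UNIV"
    by (rule has_integral_spike[of "{0}", rotated 2]) (auto simp: f_def)
  then have hi: "(h has_integral integral\<^sup>L lborel f) (ball 0 1)"
    unfolding has_integral_restrict_UNIV .
  then show "h integrable_on ball 0 1" by blast
  have "\<forall>\<^sub>F R in at_top. integral\<^sup>L lborel (s' R) = (\<Sum>l\<in>lshell R. h (ivec l)) / R ^ 4"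
    using eventually_gt_at_top[of 0]
  proof eventually_elim
    case (elim R)
    then show ?case
      using lattice_sum_eq_integral(1)[where A="lshell R" and F="\<lambda>l. h (ivec l)", OF elim finite_lshell] by (simp add: s'_def s_def)
  qed
  from Lim_transform_eventually[OF lim this]
  show "((\<lambda>R. (\<Sum>l\<in>lshell R. h (ivec l)) / R ^ 4) \<longlongrightarrow> integral (ball 0 1) h) at_top"
    using integral_unique[OF hi] by simp
qed


text \<open>A version of \<open>log_average_tendsto\<close> for functions with jumps, such as
  lattice sums in their radius. The integral is split at a point after which \<open>g\<close> is
  close to \<open>L\<close>; the first part is constant and vanishes after division by
  \<open>ln R\<close>.\<close>

lemma log_average_tendsto_integrable:
  fixes g :: "real \<Rightarrow> real"
  assumes int: "\<And>b. (\<lambda>t. g t / t) integrable_on {1..b}" and bd: "\<And>t. t \<ge> 1 \<Longrightarrow> \<bar>g t\<bar> \<le> B"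
    and lim: "(g \<longlongrightarrow> L) at_top"
  shows "((\<lambda>R. integral {1..R} (\<lambda>t. g t / t) / ln R) \<longlongrightarrow> L) at_top"
proof (rule tendstoI)
  fix e :: real assume e: "e > 0"
  obtain t0 where t0: "\<And>t. t \<ge> t0 \<Longrightarrow> \<bar>g t - L\<bar> < e / 2" "t0 \<ge> 1"
  proof -
    have "\<forall>\<^sub>F t in at_top. dist (g t) L < e / 2" using tendstoD[OF lim, of "e/2"] e by simp
    then obtain t1 where "\<And>t. t \<ge> t1 \<Longrightarrow> \<bar>g t - L\<bar> < e / 2" by (auto simp: eventually_at_top_linorder dist_real_def)
    then show ?thesis by (intro that[of "max t1 1"]) auto
  qed
  have inv: "((\<lambda>t. c / t) has_integral c * ln b - c * ln a) {a..b}" if "1 \<le> a" "a \<le> b" for a b c :: real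
    by (rule fundamental_theorem_of_calculus[OF that(2)])
       (use that in \<open>auto intro!: derivative_eq_intros simp flip: has_real_derivative_iff_has_vector_derivative\<close>)
  define C where "C = (B + \<bar>L\<bar>) * ln t0"
  have est: "\<bar>integral {1..R} (\<lambda>t. g t / t) - L * ln R\<bar> \<le> C + e / 2 * ln R" if R: "R \<ge> t0" for R
  proof -
    let ?d = "\<lambda>t. g t / t - L / t"
    have Li: "(\<lambda>t. L / t) integrable_on {1..R}" using inv[of 1 R L] R t0(2) by auto
    have dint: "?d integrable_on {1..R}" by (intro integrable_diff int Li)
    have d1: "?d integrable_on {1..t0}" "?d integrable_on {t0..R}"
      by (rule integrable_on_subinterval[OF dint]; use R t0(2) in auto)+
    have "integral {1..R} (\<lambda>t. g t / t) - L * ln R = integral {1..R} ?d"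
      using integral_unique[OF inv[of 1 R L]] R t0(2) by (simp add: integral_diff[OF int Li])
    also have "\<dots> = integral {1..t0} ?d + integral {t0..R} ?d"
      using Henstock_Kurzweil_Integration.integral_combine[OF t0(2) R dint] by simp
    finally have eq: "integral {1..R} (\<lambda>t. g t / t) - L * ln R = integral {1..t0} ?d + integral {t0..R} ?d" .
    have "norm (integral {1..t0} ?d) \<le> integral {1..t0} (\<lambda>t. (B + \<bar>L\<bar>) / t)"
    proof (rule integral_norm_bound_integral[OF d1(1)])
      show "(\<lambda>t. (B + \<bar>L\<bar>) / t) integrable_on {1..t0}" using inv[of 1 t0] t0(2) by blast
      fix t assume t: "t \<in> {1..t0}"
      then have "\<bar>g t - L\<bar> \<le> B + \<bar>L\<bar>" using bd[of t] by auto
      moreover have "norm (?d t) = \<bar>g t - L\<bar> / t" using t by (simp add: diff_divide_distrib[symmetric] abs_divide)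
      ultimately show "norm (?d t) \<le> (B + \<bar>L\<bar>) / t" using t by (simp add: divide_right_mono)
    qed
    also have "\<dots> = C" using integral_unique[OF inv[of 1 t0 "B + \<bar>L\<bar>"]] t0(2) by (simp add: C_def)
    finally have 1: "\<bar>integral {1..t0} ?d\<bar> \<le> C" by simp
    have "norm (integral {t0..R} ?d) \<le> integral {t0..R} (\<lambda>t. (e/2) / t)"
    proof (rule integral_norm_bound_integral[OF d1(2)])
      show "(\<lambda>t. (e/2) / t) integrable_on {t0..R}" using inv[OF t0(2) R] by blast
      fix t assume t: "t \<in> {t0..R}"
      then have "norm (?d t) = \<bar>g t - L\<bar> / t" using t0(2) by (simp add: diff_divide_distrib[symmetric] abs_divide)
      moreover have "\<bar>g t - L\<bar> \<le> e / 2" using t0(1)[of t] t by simp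
      ultimately show "norm (?d t) \<le> (e/2) / t" using t t0(2) by (simp only:) (intro divide_right_mono; simp)
    qed
    also have "\<dots> = (e/2) * ln R - (e/2) * ln t0" by (rule integral_unique[OF inv[OF t0(2) R]])
    also have "\<dots> \<le> e / 2 * ln R" using e t0(2) by simp
    finally have 2: "\<bar>integral {t0..R} ?d\<bar> \<le> e / 2 * ln R" by simp
    show ?thesis unfolding eq using 1 2 by linarith
  qed
  have "\<forall>\<^sub>F R in at_top. ln R > 2 * C / e"
    using filterlim_at_top_dense[THEN iffD1, OF ln_at_top] by blast
  then show "\<forall>\<^sub>F R in at_top. dist (integral {1..R} (\<lambda>t. g t / t) / ln R) L < e"
    using eventually_ge_at_top[of t0] eventually_gt_at_top[of 1]
  proof eventually_elim
    case (elim R)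
    have lnR: "ln R > 0" using elim by simp
    have "C + e / 2 * ln R < e * ln R" using elim(1) e by (simp add: field_simps)
    with est[OF elim(2)] have *: "\<bar>integral {1..R} (\<lambda>t. g t / t) - L * ln R\<bar> < e * ln R" by linarith
    have "integral {1..R} (\<lambda>t. g t / t) / ln R - L = (integral {1..R} (\<lambda>t. g t / t) - L * ln R) / ln R"
      using lnR by (simp add: field_simps)
    then have "dist (integral {1..R} (\<lambda>t. g t / t) / ln R) L = \<bar>integral {1..R} (\<lambda>t. g t / t) - L * ln R\<bar> / ln R"
      using lnR by (simp add: dist_real_def abs_divide)
    also have "\<dots> < e" using * lnR by (simp add: divide_less_eq)
    finally show ?case .
  qed
qed

text \<open>A lattice point \<open>l\<close> contributes to the integrand from
  \<open>t = lnorm l\<close> on, and the integral of \<open>1 / t ^ 5\<close> from there to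
  \<open>R\<close> is \<open>(1 / lnorm l ^ 4 - 1 / R ^ 4) / 4\<close>.\<close>

lemma lattice_Abel_summation:
  fixes f :: "lat \<Rightarrow> real"
  assumes R: "R \<ge> 1"
  shows "((\<lambda>t. (\<Sum>l\<in>lshell t. f l) / t ^ 4 / t) has_integral
     ((\<Sum>l\<in>lshell R. f l / lnorm l ^ 4) - (\<Sum>l\<in>lshell R. f l) / R ^ 4) / 4) {1..R}"
proof -
  have one: "((\<lambda>t. if t \<in> {lnorm l..R} then f l / t ^ 5 else 0) has_integral (f l / lnorm l ^ 4 - f l / R ^ 4) / 4) {1..R}"
    if l: "l \<in> lshell R" for l
  proof -
    have l1: "1 \<le> lnorm l" "lnorm l \<le> R" using l lnorm_ge_1[of l] by auto
    have "((\<lambda>t. f l / t ^ 5) has_integral (- f l / (4 * R ^ 4)) - (- f l / (4 * lnorm l ^ 4))) {lnorm l..R}"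
    proof (rule fundamental_theorem_of_calculus[OF l1(2)])
      fix t assume "t \<in> {lnorm l..R}"
      then have "t > 0" using l1 by auto
      then show "((\<lambda>t. - f l / (4 * t ^ 4)) has_vector_derivative f l / t ^ 5) (at t within {lnorm l..R})"
        unfolding has_real_derivative_iff_has_vector_derivative[symmetric]
        by (auto intro!: derivative_eq_intros simp: divide_simps)
    qed
    moreover have "(- f l / (4 * R ^ 4)) - (- f l / (4 * lnorm l ^ 4)) = (f l / lnorm l ^ 4 - f l / R ^ 4) / 4"
      by (simp add: diff_divide_distrib mult.commute)
    ultimately have "((\<lambda>t. f l / t ^ 5) has_integral (f l / lnorm l ^ 4 - f l / R ^ 4) / 4) {lnorm l..R}"
      by (simp only:)
    then show ?thesis by (rule has_integral_restrict[THEN iffD2, rotated]) (use l1 in auto)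
  qed
  have A: "((\<lambda>t. \<Sum>l\<in>lshell R. if t \<in> {lnorm l..R} then f l / t ^ 5 else 0) has_integral
      (\<Sum>l\<in>lshell R. (f l / lnorm l ^ 4 - f l / R ^ 4) / 4)) {1..R}"
    by (rule has_integral_sum[OF finite_lshell]) (use one in auto)
  have B: "(\<Sum>l\<in>lshell R. if t \<in> {lnorm l..R} then f l / t ^ 5 else 0) = (\<Sum>l\<in>lshell t. f l) / t ^ 4 / t"
    if t: "t \<in> {1..R}" for t
  proof -
    have "(\<Sum>l\<in>lshell R. if t \<in> {lnorm l..R} then f l / t ^ 5 else 0) = (\<Sum>l\<in>lshell t. f l / t ^ 5)"
      by (rule sum.mono_neutral_cong_right[OF finite_lshell]) (use t in auto)
    then show ?thesis by (simp add: sum_divide_distrib eval_nat_numeral mult_ac)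
  qed
  have C: "(\<Sum>l\<in>lshell R. (f l / lnorm l ^ 4 - f l / R ^ 4) / 4) = ((\<Sum>l\<in>lshell R. f l / lnorm l ^ 4) - (\<Sum>l\<in>lshell R. f l) / R ^ 4) / 4"
    by (simp add: sum_subtractf sum_divide_distrib diff_divide_distrib)
  show ?thesis by (rule has_integral_eq[OF B A[unfolded C]])
qed

text \<open>Abel summation writes the weighted sum as \<open>g R\<close> plus 4 times the integral
  of \<open>g t / t\<close>, where \<open>g\<close> is the scaled Riemann sum. As \<open>g\<close>
  tends to the ball integral, so does its logarithmic average. The factor 4 is the dimension and
  turns the ball integral into the sphere integral.\<close>

lemma lattice_log_asymptotics:
  fixes h :: "freq \<Rightarrow> real"
  assumes cont: "continuous_on (UNIV - {0}) h" and hom: "\<And>t x. t > 0 \<Longrightarrow> x \<noteq> 0 \<Longrightarrow> h (t *\<^sub>R x) = h x"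
    and bd: "\<And>x. x \<noteq> 0 \<Longrightarrow> \<bar>h x\<bar> \<le> M"
  shows "((\<lambda>R. (\<Sum>l\<in>lshell R. h (ivec l) / lnorm l ^ 4) / ln R) \<longlongrightarrow> 4 * integral (ball 0 1) h) at_top"
proof -
  let ?I = "integral (ball 0 1) h"
  define g where "g = (\<lambda>R. (\<Sum>l\<in>lshell R. h (ivec l)) / R ^ 4)"
  have glim: "(g \<longlongrightarrow> ?I) at_top" unfolding g_def by (rule lattice_Riemann_sum[OF cont hom bd])
  have M0: "0 \<le> M" using bd[of "axis 1 1"] by (simp add: axis_eq_0_iff)
  have gb: "\<bar>g t\<bar> \<le> 81 * M" if t: "t \<ge> 1" for t
  proof -
    have "\<bar>\<Sum>l\<in>lshell t. h (ivec l)\<bar> \<le> (\<Sum>l\<in>lshell t. M)"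
      by (intro order_trans[OF sum_abs] sum_mono bd) auto
    also have "\<dots> = real (card (lshell t)) * M" by simp
    also have "\<dots> \<le> (81 * t ^ 4) * M"
    proof (intro mult_right_mono M0)
      have "card (lshell t) \<le> card {l. lnorm l \<le> t}" by (rule card_mono[OF finite_lattice_ball[OF t]]) auto
      then show "real (card (lshell t)) \<le> 81 * t ^ 4" using card_lattice_ball[OF t] by linarith
    qed
    finally have "\<bar>\<Sum>l\<in>lshell t. h (ivec l)\<bar> \<le> 81 * M * t ^ 4" by (simp add: mult_ac)
    then show ?thesis using t by (simp add: g_def abs_divide divide_le_eq)
  qed
  have int: "(\<lambda>t. g t / t) integrable_on {1..b}" for b
  proof (cases "b \<ge> 1")
    case True
    then show ?thesis using lattice_Abel_summation[OF True, of "\<lambda>l. h (ivec l)"] unfolding g_def by blast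
  qed (simp add: integrable_on_empty)
  have eq: "(\<Sum>l\<in>lshell R. h (ivec l) / lnorm l ^ 4) / ln R = 4 * (integral {1..R} (\<lambda>t. g t / t) / ln R) + g R / ln R" if "R \<ge> 1" for R
  proof -
    have "(\<Sum>l\<in>lshell R. h (ivec l) / lnorm l ^ 4) = 4 * integral {1..R} (\<lambda>t. g t / t) + g R"
      using integral_unique[OF lattice_Abel_summation[OF that, of "\<lambda>l. h (ivec l)"]] unfolding g_def by simp
    then show ?thesis by (simp only: add_divide_distrib times_divide_eq_right)
  qed
  have lim1: "((\<lambda>R. 1 / ln R) \<longlongrightarrow> 0) (at_top :: real filter)"
    using tendsto_inverse_0_at_top[OF ln_at_top] by (simp add: inverse_eq_divide)
  have "((\<lambda>R. 4 * (integral {1..R} (\<lambda>t. g t / t) / ln R) + g R * (1 / ln R)) \<longlongrightarrow> 4 * ?I + ?I * 0) at_top"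
    by (intro tendsto_intros log_average_tendsto_integrable[OF int gb glim] glim lim1)
  then have "((\<lambda>R. 4 * (integral {1..R} (\<lambda>t. g t / t) / ln R) + g R / ln R) \<longlongrightarrow> 4 * ?I) at_top" by simp
  then show ?thesis
    by (rule Lim_transform_eventually[OF _ eventually_mono[OF eventually_ge_at_top[of 1] eq[symmetric]]])
qed

section \<open>Operators given by rapidly decaying kernels\<close>

definition kop :: "(lat \<Rightarrow> lat \<Rightarrow> complex) \<Rightarrow> coeffs \<Rightarrow> coeffs" where
  "kop k x = (\<lambda>n. \<Sum>\<^sub>\<infinity>l. k n l * x l)"

definition kadj :: "(lat \<Rightarrow> lat \<Rightarrow> complex) \<Rightarrow> lat \<Rightarrow> lat \<Rightarrow> complex" where
  "kadj k n l = cnj (k l n)"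

text \<open>The bound is symmetric in \<open>n\<close> and \<open>l\<close>, so that the class is closed under adjoints; the exponent 10 leaves
  a summable weight after two powers are spent on trading \<open>1 + lnorm n\<close> for \<open>1 + lnorm l\<close>.\<close>
definition kdecay :: "real \<Rightarrow> (lat \<Rightarrow> lat \<Rightarrow> complex) \<Rightarrow> bool" where
  "kdecay C k \<longleftrightarrow> 0 \<le> C \<and>
    (\<forall>n l. cmod (k n l) \<le> C / ((1 + lnorm (n - l)) ^ 10 * (1 + lnorm l) ^ 2 * (1 + lnorm n) ^ 2))"

lemma kdecay_nonneg: "kdecay C k \<Longrightarrow> 0 \<le> C"
  by (simp add: kdecay_def)

lemma kdecay_kadj: "kdecay C k \<Longrightarrow> kdecay C (kadj k)"
  unfolding kdecay_def kadj_def complex_mod_cnj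
proof (elim conjE, intro conjI allI)
  fix n l
  assume "\<forall>n l. cmod (k n l) \<le> C / ((1 + lnorm (n - l)) ^ 10 * (1 + lnorm l) ^ 2 * (1 + lnorm n) ^ 2)"
  then have "cmod (k l n) \<le> C / ((1 + lnorm (l - n)) ^ 10 * (1 + lnorm n) ^ 2 * (1 + lnorm l) ^ 2)" by blast
  then show "cmod (k l n) \<le> C / ((1 + lnorm (n - l)) ^ 10 * (1 + lnorm l) ^ 2 * (1 + lnorm n) ^ 2)"
    by (simp only: lnorm_minus_commute[of l n] mult_ac)
qed

lemma kadj_kadj [simp]: "kadj (kadj k) = k"
  by (simp add: kadj_def fun_eq_iff)

lemma Peetre: "1 + lnorm l \<le> (1 + lnorm n) * (1 + lnorm (n - l))"
proof -
  have "lnorm l \<le> lnorm n + lnorm (n - l)"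
    using lnorm_triangle[of n "l - n"] lnorm_minus_commute[of n l] by simp
  also have "\<dots> \<le> lnorm n + lnorm (n - l) + lnorm n * lnorm (n - l)" by simp
  finally show ?thesis by (simp add: algebra_simps)
qed

lemma kdecay_column:
  assumes "kdecay C k" shows "cmod (k n l) \<le> C / ((1 + lnorm (n - l)) ^ 8 * (1 + lnorm l) ^ 4)"
proof -
  have p: "0 < 1 + lnorm m" for m using lnorm_nonneg[of m] by linarith
  have "(1 + lnorm l) ^ 2 \<le> ((1 + lnorm n) * (1 + lnorm (n - l))) ^ 2"
    using Peetre p[of l] by (intro power_mono) auto
  then have "(1 + lnorm (n - l)) ^ 8 * (1 + lnorm l) ^ 2 * (1 + lnorm l) ^ 2
      \<le> (1 + lnorm (n - l)) ^ 8 * (1 + lnorm l) ^ 2 * ((1 + lnorm n) * (1 + lnorm (n - l))) ^ 2"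
    using p by (intro mult_left_mono) auto
  also have "\<dots> = (1 + lnorm (n - l)) ^ 10 * (1 + lnorm l) ^ 2 * (1 + lnorm n) ^ 2"
    by (simp add: power_mult_distrib eval_nat_numeral mult_ac)
  finally have "(1 + lnorm (n - l)) ^ 8 * (1 + lnorm l) ^ 4 \<le> (1 + lnorm (n - l)) ^ 10 * (1 + lnorm l) ^ 2 * (1 + lnorm n) ^ 2"
    by (simp add: mult.assoc flip: power_add)
  moreover have "0 < (1 + lnorm (n - l)) ^ 8 * (1 + lnorm l) ^ 4" by (intro mult_pos_pos zero_less_power p)
  ultimately have "C / ((1 + lnorm (n - l)) ^ 10 * (1 + lnorm l) ^ 2 * (1 + lnorm n) ^ 2) \<le> C / ((1 + lnorm (n - l)) ^ 8 * (1 + lnorm l) ^ 4)"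
    using kdecay_nonneg[OF assms] by (intro divide_left_mono) (auto intro!: mult_pos_pos simp: p)
  then show ?thesis using assms unfolding kdecay_def by (meson order_trans)
qed

lemma lattice_weight_tail:
  assumes "1 \<le> R" "finite F" "\<And>l. l \<in> F \<Longrightarrow> R \<le> lnorm l"
  shows "(\<Sum>l\<in>F. 1 / (1 + lnorm l) ^ 8) \<le> 2592 / R ^ 4"
proof -
  have "(\<Sum>l\<in>F. 1 / (1 + lnorm l) ^ 8) \<le> (\<Sum>l\<in>F. 1 / lnorm l ^ 8)"
  proof (intro sum_mono frac_le power_mono)
    fix l assume "l \<in> F"
    then have "1 \<le> lnorm l" using assms(1) assms(3)[of l] by linarith
    then show "0 < lnorm l ^ 8" by simp
  qed auto
  with lattice_tail[of 4, OF _ assms] show ?thesis by simp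
qed

text \<open>\<open>2593\<close> is the tail bound \<open>2592\<close> from radius 1 on plus the term
  at the origin.\<close>

lemma lattice_weight_bound: "finite F \<Longrightarrow> (\<Sum>l\<in>F. 1 / (1 + lnorm l) ^ 8) \<le> 2593"
proof -
  assume F: "finite F"
  have "(\<Sum>l\<in>F. 1 / (1 + lnorm l) ^ 8) \<le> (\<Sum>l\<in>insert 0 (F - {0}). 1 / (1 + lnorm l) ^ 8)"
    using F by (intro sum_mono2) auto
  also have "\<dots> = 1 + (\<Sum>l\<in>F - {0}. 1 / (1 + lnorm l) ^ 8)" using F by (subst sum.insert) auto
  also have "(\<Sum>l\<in>F - {0}. 1 / (1 + lnorm l) ^ 8) \<le> 2592 / 1 ^ 4"
    by (rule lattice_weight_tail) (use F lnorm_ge_1 in auto)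
  finally show ?thesis by simp
qed

lemma lattice_weight_bound_shift:
  assumes "finite F" shows "(\<Sum>n\<in>F. 1 / (1 + lnorm (n - l)) ^ 8) \<le> 2593"
proof -
  have "(\<Sum>n\<in>F. 1 / (1 + lnorm (n - l)) ^ 8) = (\<Sum>m\<in>(\<lambda>n. n - l) ` F. 1 / (1 + lnorm m) ^ 8)"
    by (subst sum.reindex) (auto simp: inj_on_def)
  then show ?thesis using lattice_weight_bound[of "(\<lambda>n. n - l) ` F"] assms by simp
qed

lemma weighted_l2:
  assumes "\<And>n. cmod (x n) \<le> B / (1 + lnorm (n - l)) ^ 8" "0 \<le> B"
  shows "x \<in> l2" "norm (Abs_ell2 x) \<le> 51 * B"
proof -
  have *: "(\<Sum>n\<in>F. (cmod (x n))\<^sup>2) \<le> (51 * B)\<^sup>2" if F: "finite F" for F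
  proof -
    have "(cmod (x n))\<^sup>2 \<le> B\<^sup>2 * (1 / (1 + lnorm (n - l)) ^ 8)" for n
    proof -
      have p: "1 \<le> (1 + lnorm (n - l)) ^ 8" by (intro one_le_power) simp
      have "(cmod (x n))\<^sup>2 \<le> (B / (1 + lnorm (n - l)) ^ 8)\<^sup>2" using assms(1)[of n] by (intro power_mono) auto
      also have "\<dots> = B\<^sup>2 * (1 / ((1 + lnorm (n - l)) ^ 8 * (1 + lnorm (n - l)) ^ 8))" by (simp add: power2_eq_square)
      also have "\<dots> \<le> B\<^sup>2 * (1 / ((1 + lnorm (n - l)) ^ 8 * 1))"
      proof (intro mult_left_mono divide_left_mono)
        show "0 < (1 + lnorm (n - l)) ^ 8 * (1 + lnorm (n - l)) ^ 8 * ((1 + lnorm (n - l)) ^ 8 * 1)"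
          using p by (intro mult_pos_pos; linarith)
      qed (use p in auto)
      finally show ?thesis by simp
    qed
    then have "(\<Sum>n\<in>F. (cmod (x n))\<^sup>2) \<le> B\<^sup>2 * (\<Sum>n\<in>F. 1 / (1 + lnorm (n - l)) ^ 8)"
      unfolding sum_distrib_left by (intro sum_mono)
    also have "\<dots> \<le> B\<^sup>2 * 2593" by (intro mult_left_mono lattice_weight_bound_shift F) simp
    \<comment> \<open>\<open>51 ^ 2 = 2601\<close> is the first square above
      \<open>2593\<close>.\<close>
    also have "\<dots> \<le> (51 * B)\<^sup>2" by (simp add: power_mult_distrib)
    finally show ?thesis .
  qed
  then show x: "x \<in> l2" unfolding l2_iff_bdd by blast
  have "(norm (Abs_ell2 x))\<^sup>2 \<le> (51 * B)\<^sup>2"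
    by (rule norm_sq_le_bounded_sums) (use * x in \<open>simp add: Abs_ell2_inverse\<close>)
  then show "norm (Abs_ell2 x) \<le> 51 * B" by (rule power2_le_imp_le) (use assms(2) in simp)
qed

definition kcol :: "(lat \<Rightarrow> lat \<Rightarrow> complex) \<Rightarrow> lat \<Rightarrow> ell2" where
  "kcol k l = Abs_ell2 (\<lambda>n. k n l)"

lemma kdecay_kcol:
  assumes k: "kdecay C k"
  shows Rep_kcol: "Rep_ell2 (kcol k l) = (\<lambda>n. k n l)" and norm_kcol: "norm (kcol k l) \<le> 51 * C / (1 + lnorm l) ^ 4"
proof -
  have b: "cmod (k n l) \<le> (C / (1 + lnorm l) ^ 4) / (1 + lnorm (n - l)) ^ 8" for n
    using kdecay_column[OF k, of n l] by (simp add: mult.commute)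
  have c: "0 \<le> C / (1 + lnorm l) ^ 4" using kdecay_nonneg[OF k] by simp
  show "Rep_ell2 (kcol k l) = (\<lambda>n. k n l)" unfolding kcol_def using weighted_l2(1)[OF b c] by (simp add: Abs_ell2_inverse)
  show "norm (kcol k l) \<le> 51 * C / (1 + lnorm l) ^ 4" unfolding kcol_def using weighted_l2(2)[OF b c] by simp
qed

text \<open>Each coefficient of the image is an inner product with a column of the adjoint kernel.
  This gives linearity in \<open>x\<close> and, by Cauchy-Schwarz, the bound of
  \<open>kop_pointwise\<close>.\<close>

lemma kop_cinner:
  assumes k: "kdecay C k" shows "kop k (Rep_ell2 x) n = cinner x (kcol (kadj k) n)"
  by (simp add: kop_def cinner.rep_eq l2inner_def Rep_kcol[OF kdecay_kadj[OF k]] kadj_def mult.commute)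

text \<open>The image of the unit ball is dominated by one fixed sequence in \<open>l2\<close>;
  boundedness and compactness both rest on this.\<close>

lemma kop_pointwise:
  assumes k: "kdecay C k" shows "cmod (kop k (Rep_ell2 x) n) \<le> 51 * C * norm x / (1 + lnorm n) ^ 4"
proof -
  have "cmod (kop k (Rep_ell2 x) n) \<le> norm x * norm (kcol (kadj k) n)"
    unfolding kop_cinner[OF k] by (rule cmod_cinner_le)
  also have "\<dots> \<le> norm x * (51 * C / (1 + lnorm n) ^ 4)"
    by (intro mult_left_mono norm_kcol[OF kdecay_kadj[OF k]]) simp
  finally show ?thesis by (simp add: mult_ac)
qed

lemma pointwise_weight_sum:
  assumes "\<And>n. n \<in> F \<Longrightarrow> cmod (x n) \<le> B / (1 + lnorm n) ^ 4"
  shows "(\<Sum>n\<in>F. (cmod (x n))\<^sup>2) \<le> B\<^sup>2 * (\<Sum>n\<in>F. 1 / (1 + lnorm n) ^ 8)"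
  unfolding sum_distrib_left
proof (rule sum_mono)
  fix n assume "n \<in> F"
  then have "(cmod (x n))\<^sup>2 \<le> (B / (1 + lnorm n) ^ 4)\<^sup>2" by (intro power_mono assms) auto
  then show "(cmod (x n))\<^sup>2 \<le> B\<^sup>2 * (1 / (1 + lnorm n) ^ 8)" by (simp add: power_divide flip: power_mult)
qed

lemma kop_h0_bounded:
  assumes k: "kdecay C k" shows "h0_bounded (kop k)"
proof -
  have b: "(\<Sum>n\<in>F. (cmod (kop k (Rep_ell2 x) n))\<^sup>2) \<le> (51 * C * norm x)\<^sup>2 * 2593" if F: "finite F" for F x
    by (rule order_trans[OF pointwise_weight_sum[OF kop_pointwise[OF k]] mult_left_mono[OF lattice_weight_bound[OF F]]]) simp
  have mem: "kop k (Rep_ell2 x) \<in> l2" for x unfolding l2_iff_bdd using b by blast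
  have nb: "l2norm (kop k (Rep_ell2 x)) \<le> (51 * C * 51) * norm x" for x
  proof -
    have "(norm (Abs_ell2 (kop k (Rep_ell2 x))))\<^sup>2 \<le> (51 * C * norm x)\<^sup>2 * 2593"
      by (rule norm_sq_le_bounded_sums) (use b mem in \<open>simp add: Abs_ell2_inverse\<close>)
    also have "\<dots> \<le> (51 * C * 51 * norm x)\<^sup>2" by (simp add: power_mult_distrib)
    finally have "norm (Abs_ell2 (kop k (Rep_ell2 x))) \<le> 51 * C * 51 * norm x"
      by (rule power2_le_imp_le) (use kdecay_nonneg[OF k] in simp)
    then show ?thesis by (simp add: norm_ell2.rep_eq Abs_ell2_inverse mem)
  qed
  have R: "Rep_ell2 (Abs_ell2 x) = x" if "x \<in> l2" for x using that by (rule Abs_ell2_inverse)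
  show ?thesis unfolding h0_bounded_def
  proof (intro conjI ballI allI)
    fix x :: coeffs assume x: "x \<in> l2"
    show "kop k x \<in> l2" using mem[of "Abs_ell2 x"] by (simp add: R x)
    fix y :: coeffs and c assume y: "y \<in> l2"
    have e: "(\<lambda>l. c * x l + y l) = Rep_ell2 (c *\<^sub>C Abs_ell2 x + Abs_ell2 y)"
      by (simp add: plus_ell2.rep_eq scaleC.rep_eq R x y)
    have "kop k (\<lambda>l. c * x l + y l) n = c * kop k x n + kop k y n" for n
    proof -
      have "kop k x n = cinner (Abs_ell2 x) (kcol (kadj k) n)" "kop k y n = cinner (Abs_ell2 y) (kcol (kadj k) n)"
        using kop_cinner[OF k, of "Abs_ell2 x" n] kop_cinner[OF k, of "Abs_ell2 y" n] by (simp_all add: R x y)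
      then show ?thesis unfolding e kop_cinner[OF k] by (simp add: cinner_add_left cinner_scaleC_left)
    qed
    then show "kop k (\<lambda>l. c * x l + y l) = (\<lambda>l. c * kop k x l + kop k y l)" by blast
  next
    show "\<exists>K. \<forall>x\<in>l2. l2norm (kop k x) \<le> K * l2norm x"
    proof (intro exI ballI)
      fix x assume "x \<in> l2"
      then show "l2norm (kop k x) \<le> (51 * C * 51) * l2norm x"
        using nb[of "Abs_ell2 x"] by (simp add: R norm_ell2.rep_eq)
    qed
  qed
qed

text \<open>Images of the unit ball lie in a compact product of discs, so some subsequence converges
  at every lattice point. The squares of the radii are summable, so the part outside a large ball is
  uniformly small and pointwise convergence becomes convergence in norm.\<close>

lemma kop_h0_compact:
  assumes k: "kdecay C k" shows "h0_compact (kop k)"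
  unfolding h0_compact_iff
proof (intro conjI)
  note b = kop_h0_bounded[OF k]
  show "h0_bounded (kop k)" by (rule b)
  show "compact_op (on_ell2 (kop k))"
    unfolding compact_op_def
  proof (intro allI impI)
    fix x :: "nat \<Rightarrow> ell2" assume x: "\<forall>k. norm (x k) \<le> 1"
    define y where "y = (\<lambda>i. kop k (Rep_ell2 (x i)))"
    define B where "B = 51 * C"
    have yb: "cmod (y i n) \<le> B / (1 + lnorm n) ^ 4" for i n
    proof -
      have "cmod (y i n) \<le> B * norm (x i) / (1 + lnorm n) ^ 4" unfolding y_def B_def by (rule kop_pointwise[OF k])
      also have "\<dots> \<le> B * 1 / (1 + lnorm n) ^ 4"
        using x kdecay_nonneg[OF k] by (intro divide_right_mono mult_left_mono) (auto simp: B_def)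
      finally show ?thesis by simp
    qed
    define K where "K = (\<Pi>\<^sub>E n\<in>(UNIV::lat set). cball (0::complex) (B / (1 + lnorm n) ^ 4))"
    have "compactin (product_topology (\<lambda>f. euclidean) UNIV) K"
      unfolding K_def by (subst compactin_PiE) auto
    then have "compact K" by (simp add: euclidean_product_topology)
    then have "seq_compact K" by (rule compact_imp_seq_compact)
    moreover have "y i \<in> K" for i using yb by (auto simp: K_def)
    ultimately obtain z r where r: "strict_mono r" "(y \<circ> r) \<longlonglongrightarrow> z" using seq_compactE[of K y] by metis
    have "(\<lambda>i. y (r i)) \<longlonglongrightarrow> z" using r(2) by (simp add: o_def)
    then have pw: "(\<lambda>i. y (r i) n) \<longlonglongrightarrow> z n" for n
      by (rule continuous_on_tendsto_compose[OF continuous_on_product_coordinates[of n]]) auto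
    have "Cauchy (\<lambda>i. on_ell2 (kop k) (x (r i)))"
    proof (rule CauchyI)
      fix e :: real assume e: "e > 0"
      obtain R where R: "R \<ge> 1" "4 * B\<^sup>2 * (2592 / R ^ 4) < e\<^sup>2 / 2"
      proof -
        have "((\<lambda>R. 4 * B\<^sup>2 * (2592 * (inverse R) ^ 4)) \<longlongrightarrow> 4 * B\<^sup>2 * (2592 * 0 ^ 4)) (at_top :: real filter)"
          by (intro tendsto_intros tendsto_inverse_0_at_top filterlim_ident)
        then have "\<forall>\<^sub>F R in at_top. 4 * B\<^sup>2 * (2592 * (inverse R) ^ 4) < e\<^sup>2 / 2"
          by (rule order_tendstoD) (use e in simp)
        then have "\<forall>\<^sub>F R in at_top. 1 \<le> R \<and> 4 * B\<^sup>2 * (2592 * (inverse R) ^ 4) < e\<^sup>2 / 2"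
          using eventually_ge_at_top[of "1::real"] by eventually_elim simp
        then obtain R where "1 \<le> R" "4 * B\<^sup>2 * (2592 * (inverse R) ^ 4) < e\<^sup>2 / 2" by (auto dest: eventually_happens)
        then show ?thesis using that by (simp add: field_simps)
      qed
      define F where "F = {l. lnorm l \<le> R}"
      have finF: "finite F" unfolding F_def by (rule finite_lattice_ball[OF R(1)])
      define d where "d = (\<lambda>i. \<Sum>n\<in>F. (cmod (y (r i) n - z n))\<^sup>2)"
      have "d \<longlonglongrightarrow> (\<Sum>n\<in>F. (cmod (z n - z n))\<^sup>2)" unfolding d_def by (intro tendsto_intros pw)
      \<comment> \<open>Then \<open>2 * d m + 2 * d n\<close> is below \<open>e ^ 2 / 2\<close>; the
        other half is reserved for the tail outside \<open>F\<close>.\<close>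
      then have "\<forall>\<^sub>F i in sequentially. d i < e\<^sup>2 / 8" by (rule order_tendstoD) (use e in simp)
      then obtain M where M: "\<And>i. i \<ge> M \<Longrightarrow> d i < e\<^sup>2 / 8" unfolding eventually_sequentially by blast
      have "norm (on_ell2 (kop k) (x (r m)) - on_ell2 (kop k) (x (r n))) < e" if mn: "m \<ge> M" "n \<ge> M" for m n
      proof -
        let ?v = "on_ell2 (kop k) (x (r m)) - on_ell2 (kop k) (x (r n))"
        have v: "Rep_ell2 ?v l = y (r m) l - y (r n) l" for l by (simp add: minus_ell2.rep_eq Rep_on_ell2[OF b] y_def)
        have sq: "(cmod (a - b'))\<^sup>2 \<le> 2 * (cmod a)\<^sup>2 + 2 * (cmod b')\<^sup>2" for a b' :: complex
        proof -
          have "(cmod (a - b'))\<^sup>2 \<le> (cmod a + cmod b')\<^sup>2" by (intro power_mono norm_triangle_ineq4) auto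
          also have "\<dots> \<le> 2 * (cmod a)\<^sup>2 + 2 * (cmod b')\<^sup>2"
            using sum_squares_bound[of "cmod a" "cmod b'"] by (simp add: power2_sum)
          finally show ?thesis .
        qed
        have F1: "(\<Sum>l\<in>F. (cmod (Rep_ell2 ?v l))\<^sup>2) \<le> 2 * d m + 2 * d n"
        proof -
          have "(\<Sum>l\<in>F. (cmod (Rep_ell2 ?v l))\<^sup>2) \<le> (\<Sum>l\<in>F. 2 * (cmod (y (r m) l - z l))\<^sup>2 + 2 * (cmod (y (r n) l - z l))\<^sup>2)"
          proof (rule sum_mono)
            fix l
            show "(cmod (Rep_ell2 ?v l))\<^sup>2 \<le> 2 * (cmod (y (r m) l - z l))\<^sup>2 + 2 * (cmod (y (r n) l - z l))\<^sup>2"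
              unfolding v using sq[of "y (r m) l - z l" "y (r n) l - z l"] by simp
          qed
          then show ?thesis by (simp add: d_def sum.distrib sum_distrib_left)
        qed
        have "(\<Sum>l\<in>G. (cmod (Rep_ell2 ?v l))\<^sup>2) \<le> (2 * d m + 2 * d n) + 4 * B\<^sup>2 * (2592 / R ^ 4)" if G: "finite G" for G
        proof -
          have "(\<Sum>l\<in>G. (cmod (Rep_ell2 ?v l))\<^sup>2) \<le> (\<Sum>l\<in>F \<union> (G - F). (cmod (Rep_ell2 ?v l))\<^sup>2)"
            using finF G by (intro sum_mono2) auto
          also have "\<dots> = (\<Sum>l\<in>F. (cmod (Rep_ell2 ?v l))\<^sup>2) + (\<Sum>l\<in>G - F. (cmod (Rep_ell2 ?v l))\<^sup>2)"
            using finF G by (intro sum.union_disjoint) auto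
          also have "(\<Sum>l\<in>G - F. (cmod (Rep_ell2 ?v l))\<^sup>2) \<le> (2 * B)\<^sup>2 * (\<Sum>l\<in>G - F. 1 / (1 + lnorm l) ^ 8)"
          proof (rule pointwise_weight_sum)
            fix l
            have "cmod (y (r m) l - y (r n) l) \<le> B / (1 + lnorm l) ^ 4 + B / (1 + lnorm l) ^ 4"
              by (intro order_trans[OF norm_triangle_ineq4] add_mono yb)
            then show "cmod (Rep_ell2 ?v l) \<le> 2 * B / (1 + lnorm l) ^ 4" by (simp add: v)
          qed
          also have "(2 * B)\<^sup>2 * (\<Sum>l\<in>G - F. 1 / (1 + lnorm l) ^ 8) \<le> (2 * B)\<^sup>2 * (2592 / R ^ 4)"
            by (intro mult_left_mono lattice_weight_tail R(1)) (use G in \<open>auto simp: F_def\<close>)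
          finally show ?thesis using F1 by (simp add: power_mult_distrib)
        qed
        then have "(norm ?v)\<^sup>2 \<le> (2 * d m + 2 * d n) + 4 * B\<^sup>2 * (2592 / R ^ 4)" by (rule norm_sq_le_bounded_sums)
        also have "\<dots> < e\<^sup>2" using M[OF mn(1)] M[OF mn(2)] R(2) by linarith
        finally show ?thesis by (rule power2_less_imp_less) (use e in simp)
      qed
      then show "\<exists>M. \<forall>m\<ge>M. \<forall>n\<ge>M. norm (on_ell2 (kop k) (x (r m)) - on_ell2 (kop k) (x (r n))) < e" by blast
    qed
    then show "\<exists>r::nat\<Rightarrow>nat. strict_mono r \<and> Cauchy (\<lambda>i. on_ell2 (kop k) (x (r i)))" using r(1) by blast
  qed
qed


section \<open>Basis vectors and eigenvalue sums of kernel operators\<close>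

lift_definition ebas :: "lat \<Rightarrow> ell2" is "\<lambda>l n. if n = l then 1 else 0"
  unfolding l2_def by (auto intro!: finite_nonzero_values_imp_summable_on)

lemma cinner_ebas [simp]: "cinner x (ebas l) = Rep_ell2 x l"
proof -
  have "((\<lambda>n. Rep_ell2 x n * cnj (Rep_ell2 (ebas l) n)) has_sum (\<Sum>n\<in>{l}. Rep_ell2 x n * cnj (Rep_ell2 (ebas l) n))) UNIV"
    by (rule has_sum_finite_neutralI[of "{l}"]) (auto simp: ebas.rep_eq)
  then show ?thesis by (simp add: cinner.rep_eq l2inner_def infsumI ebas.rep_eq)
qed

lemma inj_ebas: "inj ebas"
proof (rule injI)
  fix a b assume "ebas a = ebas b"
  then have "Rep_ell2 (ebas a) a = Rep_ell2 (ebas b) a" by simp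
  then show "a = b" by (simp add: ebas.rep_eq split: if_splits)
qed

lemma ebas_orthonormal: "orthonormal (ebas ` F)"
  using inj_ebas by (auto simp: orthonormal_def ebas.rep_eq inj_on_def)

lemma on_kop_ebas:
  assumes k: "kdecay C k" shows "on_ell2 (kop k) (ebas l) = kcol k l"
proof -
  have "kop k (Rep_ell2 (ebas l)) n = k n l" for n
    unfolding kop_cinner[OF k]
    using cinner_ebas[of "kcol (kadj k) n" l] cinner_commute[of "ebas l" "kcol (kadj k) n"]
    by (simp add: Rep_kcol[OF kdecay_kadj[OF k]] kadj_def)
  then have "kop k (Rep_ell2 (ebas l)) = (\<lambda>n. k n l)" by blast
  then show ?thesis by (simp only: on_ell2_def kcol_def)
qed

lemma ebas_approximation:
  assumes e: "e > 0"
  obtains F where "finite F" "norm (x - (\<Sum>l\<in>F. cinner x (ebas l) *\<^sub>C ebas l)) \<le> e"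
proof -
  have "e\<^sup>2 > 0" using e by simp
  from has_sum_finite_approximation[OF has_sum_norm_sq[of x] this]
  obtain F where F: "finite F" "dist (\<Sum>l\<in>F. (cmod (Rep_ell2 x l))\<^sup>2) ((norm x)\<^sup>2) \<le> e\<^sup>2" by blast
  define y where "y = x - (\<Sum>l\<in>F. cinner x (ebas l) *\<^sub>C ebas l)"
  have "norm (ebas l) = 1" for l by (rule orthonormal_norm[OF ebas_orthonormal[of "{l}"]]) simp
  then have "(norm x)\<^sup>2 = (\<Sum>l\<in>F. (cmod (cinner x (ebas l)))\<^sup>2) + (norm y)\<^sup>2"
    unfolding y_def by (intro orthonormal_Pythagoras F(1)) (auto simp: ebas.rep_eq)
  then have "(norm y)\<^sup>2 \<le> e\<^sup>2" using F(2) by (simp add: dist_real_def)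
  then have "norm y \<le> e" by (rule power2_le_imp_le) (use e in simp)
  with F(1) that show ?thesis by (simp add: y_def)
qed

text \<open>\<open>\<phi>\<close> is linear over the reals only, so it has to vanish on all complex
  multiples of the basis vectors.\<close>

lemma functional_zero_on_basis:
  fixes \<phi> :: "ell2 \<Rightarrow> complex"
  assumes \<phi>: "bounded_linear \<phi>" and z: "\<And>c l. \<phi> (c *\<^sub>C ebas l) = 0"
  shows "\<phi> x = 0"
proof -
  interpret \<phi>: bounded_linear \<phi> by (rule \<phi>)
  obtain K where K: "K > 0" "\<And>x. norm (\<phi> x) \<le> norm x * K" using \<phi>.pos_bounded by blast
  have "norm (\<phi> x) \<le> 0 + e" if e: "e > 0" for e
  proof -
    have "e / K > 0" using e K(1) by simp
    then obtain F where F: "norm (x - (\<Sum>l\<in>F. cinner x (ebas l) *\<^sub>C ebas l)) \<le> e / K"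
      using ebas_approximation by blast
    have "\<phi> (x - (\<Sum>l\<in>F. cinner x (ebas l) *\<^sub>C ebas l)) = \<phi> x" by (simp only: \<phi>.diff \<phi>.sum z sum.neutral_const diff_zero)
    then have "norm (\<phi> x) \<le> norm (x - (\<Sum>l\<in>F. cinner x (ebas l) *\<^sub>C ebas l)) * K" using K(2) by metis
    also have "\<dots> \<le> e / K * K" using F K(1) by (intro mult_right_mono) auto
    finally show ?thesis using K(1) by simp
  qed
  from field_le_epsilon[OF this] show ?thesis by simp
qed

lemma kop_adjoint:
  assumes k: "kdecay C k" shows "is_adjoint (kop k) (kop (kadj k))"
proof -
  note k' = kdecay_kadj[OF k]
  note b = kop_h0_bounded[OF k] and b' = kop_h0_bounded[OF k']
  have cl: "clinear_op (on_ell2 (kop k))" by (rule h0_bounded_clinear[OF b])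
  have "cinner (on_ell2 (kop k) x) y - cinner x (on_ell2 (kop (kadj k)) y) = 0" for x y
  proof (rule functional_zero_on_basis[where \<phi>="\<lambda>x. cinner (on_ell2 (kop k) x) y - cinner x (on_ell2 (kop (kadj k)) y)"])
    show "bounded_linear (\<lambda>x. cinner (on_ell2 (kop k) x) y - cinner x (on_ell2 (kop (kadj k)) y))"
      by (intro bounded_linear_sub bounded_linear_cinner_left
          bounded_linear_compose[OF bounded_linear_cinner_left clinear_op_bl[OF cl]])
    fix c :: complex and l
    have "cinner (ebas l) (on_ell2 (kop (kadj k)) y) = cnj (Rep_ell2 (on_ell2 (kop (kadj k)) y) l)"
      using cinner_commute[of "ebas l"] by simp
    also have "\<dots> = cinner (kcol k l) y"
      using cinner_commute[of "kcol k l" y] by (simp add: Rep_on_ell2[OF b'] kop_cinner[OF k'])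
    finally show "cinner (on_ell2 (kop k) (c *\<^sub>C ebas l)) y - cinner (c *\<^sub>C ebas l) (on_ell2 (kop (kadj k)) y) = 0"
      by (simp add: clinear_op_scaleC[OF cl] cinner_scaleC_left on_kop_ebas[OF k])
  qed
  then show ?thesis using b b' by (simp add: is_adjoint_iff)
qed

text \<open>The left side is a partial trace of the projection onto the first \<open>N\<close>
  eigenvectors, whose rank is at most \<open>N\<close>. It supplies the factor \<open>sqrt N\<close>
  outside the ball.\<close>

lemma norm_eigenvector_sum:
  assumes pS: "positive_op S" and es: "eigensystem S \<mu> e" and G: "finite G"
  shows "(\<Sum>l\<in>G. \<Sum>n<N. (cmod (cinner (ebas l) (e n)))\<^sup>2) \<le> real N"
proof -
  have "(\<Sum>l\<in>G. \<Sum>n<N. (cmod (cinner (ebas l) (e n)))\<^sup>2) = (\<Sum>n<N. \<Sum>l\<in>G. (cmod (Rep_ell2 (e n) l))\<^sup>2)"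
    by (subst sum.swap) (simp add: cmod_cinner_commute[of "ebas _"])
  also have "\<dots> \<le> (\<Sum>n<N. 1)"
  proof (rule sum_mono)
    fix n
    show "(\<Sum>l\<in>G. (cmod (Rep_ell2 (e n) l))\<^sup>2) \<le> 1"
      using sum_le_norm_sq[OF G, of "e n"] es_norm[OF pS es, of n] by (auto split: if_splits)
  qed
  finally show ?thesis by simp
qed

text \<open>The trace of \<open>S\<close> over the first \<open>N\<close> eigenvectors is compared with the trace over
  the basis vectors in a ball: outside the ball one uses Cauchy-Schwarz and the decay of
  \<open>S (ebas l)\<close>, which balances \<open>sqrt N\<close> against \<open>1 / R ^ 2\<close>.\<close>
lemma eigensum_le_lattice_trace:
  assumes pS: "positive_op S" and es: "eigensystem S \<mu> e"
    and dec: "\<And>l. norm (S (ebas l)) \<le> D / (1 + lnorm l) ^ 4" and R: "1 \<le> R"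
  shows "(\<Sum>n<N. \<mu> n) \<le> (\<Sum>l | lnorm l \<le> R. inner (S (ebas l)) (ebas l)) + sqrt (real N) * sqrt (D\<^sup>2 * (2592 / R ^ 4))"
proof -
  define p where "p l = (\<Sum>n<N. (cmod (cinner (ebas l) (e n)))\<^sup>2)" for l
  define t where "t l = (\<Sum>n<N. \<mu> n * (cmod (cinner (ebas l) (e n)))\<^sup>2)" for l
  have p0: "0 \<le> p l" for l by (simp add: p_def sum_nonneg)
  have hs: "((\<lambda>l. \<mu> n * (cmod (cinner (ebas l) (e n)))\<^sup>2) has_sum \<mu> n) UNIV" for n
  proof -
    have "((\<lambda>l. \<mu> n * (cmod (Rep_ell2 (e n) l))\<^sup>2) has_sum \<mu> n * (norm (e n))\<^sup>2) UNIV"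
      by (intro has_sum_cmult_right has_sum_norm_sq)
    moreover have "\<mu> n * (norm (e n))\<^sup>2 = \<mu> n"
      using es_norm[OF pS es, of n] es_nonneg[OF pS es, of n] by (auto split: if_splits)
    ultimately show ?thesis by (simp add: cmod_cinner_commute[of "ebas _"])
  qed
  have hst: "(t has_sum (\<Sum>n<N. \<mu> n)) UNIV"
    unfolding t_def by (induction N) (auto intro!: has_sum_add hs)
  have t_le: "t l \<le> inner (S (ebas l)) (ebas l)" for l
    unfolding t_def by (rule quad_ge[OF pS es]) simp
  \<comment> \<open>One factor \<open>\<mu> n\<close> is moved into the inner product as
    \<open>S (ebas l)\<close>. Cauchy-Schwarz over \<open>n\<close> and Bessel then bring in the
    norm of \<open>S (ebas l)\<close>, which decays.\<close>
  have t_le2: "t l \<le> \<bar>norm (S (ebas l))\<bar> * \<bar>sqrt (p l)\<bar>" for l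
  proof -
    have "t l = (\<Sum>n<N. \<bar>cmod (cinner (S (ebas l)) (e n))\<bar> * \<bar>cmod (cinner (ebas l) (e n))\<bar>)"
      unfolding t_def
    proof (rule sum.cong[OF refl])
      fix n
      have "cinner (S (ebas l)) (e n) = \<mu> n * cinner (ebas l) (e n)"
        using op_sa[OF pS es, of "ebas l" "e n"] by (simp add: es_eig[OF pS es] scaleR_conv_scaleC cinner_scaleC_right)
      then show "\<mu> n * (cmod (cinner (ebas l) (e n)))\<^sup>2 = \<bar>cmod (cinner (S (ebas l)) (e n))\<bar> * \<bar>cmod (cinner (ebas l) (e n))\<bar>"
        using es_nonneg[OF pS es, of n] by (simp add: norm_mult power2_eq_square)
    qed
    also have "\<dots> \<le> L2_set (\<lambda>n. cmod (cinner (S (ebas l)) (e n))) {..<N} * L2_set (\<lambda>n. cmod (cinner (ebas l) (e n))) {..<N}"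
      by (rule L2_set_mult_ineq)
    also have "\<dots> \<le> norm (S (ebas l)) * sqrt (p l)"
    proof (rule mult_mono)
      show "L2_set (\<lambda>n. cmod (cinner (S (ebas l)) (e n))) {..<N} \<le> norm (S (ebas l))"
        unfolding L2_set_def using es_Bessel[OF pS es, of "{..<N}" "S (ebas l)"] by (simp add: real_le_lsqrt sum_nonneg)
      show "L2_set (\<lambda>n. cmod (cinner (ebas l) (e n))) {..<N} \<le> sqrt (p l)" by (simp add: L2_set_def p_def)
    qed auto
    also have "\<dots> \<le> \<bar>norm (S (ebas l))\<bar> * \<bar>sqrt (p l)\<bar>" using p0 by simp
    finally show ?thesis .
  qed
  let ?B = "{l. lnorm l \<le> R}"
  have finB: "finite ?B" by (rule finite_lattice_ball[OF R])
  have pos: "0 \<le> inner (S x) x" for x by (rule op_pos[OF pS es])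
  show ?thesis
  proof (rule has_sum_le_finite_sums[OF hst])
    fix G :: "lat set" assume G: "finite G"
    have t0: "0 \<le> t l" for l unfolding t_def using es_nonneg[OF pS es] by (intro sum_nonneg) auto
    have "sum t G \<le> sum t (?B \<union> (G - ?B))" using finB G t0 by (intro sum_mono2) auto
    also have "\<dots> = sum t ?B + sum t (G - ?B)" using finB G by (intro sum.union_disjoint) auto
    also have "sum t ?B \<le> (\<Sum>l\<in>?B. inner (S (ebas l)) (ebas l))" by (intro sum_mono t_le)
    also have "sum t (G - ?B) \<le> sqrt (real N) * sqrt (D\<^sup>2 * (2592 / R ^ 4))"
    proof -
      have "sum t (G - ?B) \<le> (\<Sum>l\<in>G - ?B. \<bar>norm (S (ebas l))\<bar> * \<bar>sqrt (p l)\<bar>)" by (intro sum_mono t_le2)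
      also have "\<dots> \<le> L2_set (\<lambda>l. norm (S (ebas l))) (G - ?B) * L2_set (\<lambda>l. sqrt (p l)) (G - ?B)" by (rule L2_set_mult_ineq)
      also have "\<dots> \<le> sqrt (D\<^sup>2 * (2592 / R ^ 4)) * sqrt (real N)"
      proof (rule mult_mono)
        have "(\<Sum>l\<in>G - ?B. (cmod (complex_of_real (norm (S (ebas l)))))\<^sup>2) \<le> D\<^sup>2 * (\<Sum>l\<in>G - ?B. 1 / (1 + lnorm l) ^ 8)"
          by (rule pointwise_weight_sum) (use dec in simp)
        also have "\<dots> \<le> D\<^sup>2 * (2592 / R ^ 4)"
          by (intro mult_left_mono lattice_weight_tail R) (use G in auto)
        finally show "L2_set (\<lambda>l. norm (S (ebas l))) (G - ?B) \<le> sqrt (D\<^sup>2 * (2592 / R ^ 4))"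
          unfolding L2_set_def by (intro real_sqrt_le_mono) simp
        show "L2_set (\<lambda>l. sqrt (p l)) (G - ?B) \<le> sqrt (real N)"
          unfolding L2_set_def using norm_eigenvector_sum[OF pS es, of "G - ?B" N] G p0
          by (intro real_sqrt_le_mono) (simp add: p_def sum_nonneg)
      qed (auto simp: L2_set_nonneg)
      finally show ?thesis by (simp add: mult.commute)
    qed
    finally show "sum t G \<le> (\<Sum>l\<in>?B. inner (S (ebas l)) (ebas l)) + sqrt (real N) * sqrt (D\<^sup>2 * (2592 / R ^ 4))" by simp
  qed
qed

lemma lattice_trace_le_eigensum:
  assumes pS: "positive_op S" and es: "eigensystem S \<mu> e" and R: "1 \<le> R" "81 * R ^ 4 \<le> real N"
  shows "(\<Sum>l | lnorm l \<le> R. inner (S (ebas l)) (ebas l)) \<le> (\<Sum>n<N. \<mu> n)"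
proof -
  have fin: "finite {l. lnorm l \<le> R}" by (rule finite_lattice_ball[OF R(1)])
  have "(\<Sum>l | lnorm l \<le> R. inner (S (ebas l)) (ebas l)) = (\<Sum>f\<in>ebas ` {l. lnorm l \<le> R}. inner (S f) f)"
    by (subst sum.reindex) (auto intro: inj_on_subset[OF inj_ebas])
  also have "\<dots> \<le> (\<Sum>n<N. \<mu> n)"
  proof (rule Ky_Fan[OF pS es])
    have "real (card {l. lnorm l \<le> R}) \<le> real N" using card_lattice_ball[OF R(1)] R(2) by linarith
    then show "card (ebas ` {l. lnorm l \<le> R}) \<le> N" using card_image_le[OF fin, of ebas] by linarith
  qed (use fin ebas_orthonormal in auto)
  finally show ?thesis .
qed

text \<open>By \<open>card_lattice_ball\<close>, the ball of radius \<open>rad N\<close> has at most \<open>N\<close> lattice points.\<close>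
definition rad :: "nat \<Rightarrow> real" where
  "rad N = (real N / 81) powr (1/4)"

lemma rad_props:
  assumes "81 \<le> N" shows "1 \<le> rad N" "rad N ^ 4 = real N / 81"
proof -
  have "real N / 81 \<ge> 1" using assms by simp
  then show "1 \<le> rad N" unfolding rad_def by (intro ge_one_powr_ge_zero) auto
  show "rad N ^ 4 = real N / 81" using assms by (simp add: rad_def powr_power)
qed

lemma rad_at_top: "filterlim rad at_top sequentially"
proof -
  have "filterlim (\<lambda>x::real. exp (1/4 * ln x)) at_top at_top"
    by (rule filterlim_compose[OF exp_at_top filterlim_tendsto_pos_mult_at_top[OF tendsto_const _ ln_at_top]]) simp
  moreover have "\<forall>\<^sub>F x::real in at_top. exp (1/4 * ln x) = x powr (1/4)"
    using eventually_gt_at_top[of 0] by eventually_elim (simp add: powr_def)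
  ultimately have "filterlim (\<lambda>x::real. x powr (1/4)) at_top at_top"
    by (rule filterlim_cong[THEN iffD1, OF refl refl, rotated])
  moreover have "filterlim (\<lambda>N. real N / 81) at_top sequentially"
    using filterlim_tendsto_pos_mult_at_top[OF tendsto_const[of "1/81::real"] _ filterlim_real_sequentially] by simp
  ultimately show ?thesis unfolding rad_def[abs_def] by (rule filterlim_compose)
qed

lemma ln_rad: "1 \<le> N \<Longrightarrow> ln (rad N) = (ln (real N) - ln 81) / 4"
  by (simp add: rad_def ln_powr ln_div)

lemma ln_rad_ratio: "(\<lambda>N. ln (rad N) / ln (real N)) \<longlonglongrightarrow> 1/4"
proof -
  have "filterlim (\<lambda>N. ln (real N)) at_top sequentially"
    by (rule filterlim_compose[OF ln_at_top filterlim_real_sequentially])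
  from tendsto_inverse_0_at_top[OF this] have lim: "(\<lambda>N. inverse (ln (real N))) \<longlonglongrightarrow> 0" .
  have "(\<lambda>N. 1/4 - ln 81 / 4 * inverse (ln (real N))) \<longlonglongrightarrow> 1/4 - ln 81 / 4 * 0" by (intro tendsto_intros lim)
  then have "(\<lambda>N. 1/4 - ln 81 / 4 * inverse (ln (real N))) \<longlonglongrightarrow> 1/4" by simp
  moreover have "\<forall>\<^sub>F N in sequentially. 1/4 - ln 81 / 4 * inverse (ln (real N)) = ln (rad N) / ln (real N)"
    using eventually_ge_at_top[of 2]
  proof eventually_elim
    case (elim N)
    then have "ln (real N) \<noteq> 0" using ln_gt_zero[of "real N"] by simp
    then show ?case using elim by (simp add: ln_rad field_simps)
  qed
  ultimately show ?thesis by (rule Lim_transform_eventually)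
qed

lemma ball_lshell:
  assumes "1 \<le> R" shows "(\<Sum>l | lnorm l \<le> R. g l) = g 0 + (\<Sum>l\<in>lshell R. g l :: real)"
proof -
  have "{l. lnorm l \<le> R} = insert 0 (lshell R)" using assms by auto
  then show ?thesis using finite_lshell by simp
qed

lemma lattice_log_bound:
  obtains K where "\<forall>\<^sub>F N in sequentially. (\<Sum>l | lnorm l \<le> rad N. 1 / (1 + lnorm l) ^ 4) \<le> K * ln (real N)" "0 < K"
proof -
  define L where "L = 4 * integral (ball 0 1) (\<lambda>x::freq. 1::real)"
  have "((\<lambda>R. (\<Sum>l\<in>lshell R. 1 / lnorm l ^ 4) / ln R) \<longlongrightarrow> L) at_top"
    unfolding L_def by (rule lattice_log_asymptotics[where M=1]) auto
  from filterlim_compose[OF this rad_at_top]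
  have "(\<lambda>N. (\<Sum>l\<in>lshell (rad N). 1 / lnorm l ^ 4) / ln (rad N)) \<longlonglongrightarrow> L" .
  then have "\<forall>\<^sub>F N in sequentially. (\<Sum>l\<in>lshell (rad N). 1 / lnorm l ^ 4) / ln (rad N) < \<bar>L\<bar> + 1"
    by (rule order_tendstoD) simp
  then have "\<forall>\<^sub>F N in sequentially. (\<Sum>l | lnorm l \<le> rad N. 1 / (1 + lnorm l) ^ 4) \<le> (\<bar>L\<bar> + 2) * ln (real N)"
    using eventually_gt_at_top[of 81]
  proof eventually_elim
    case (elim N)
    have r: "1 \<le> rad N" using rad_props elim by simp
    have lnN: "1 \<le> ln (real N)"
      using ln_ge_iff[of "real N" 1] exp_le elim by simp
    have "0 < ln (81::real)" by simp
    moreover have "ln 81 < ln (real N)" using elim by simp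
    moreover have "4 * ln (rad N) = ln (real N) - ln 81" using elim ln_rad[of N] by simp
    ultimately have lr: "0 < ln (rad N)" "ln (rad N) \<le> ln (real N)" using lnN by linarith+
    have "(\<Sum>l | lnorm l \<le> rad N. 1 / (1 + lnorm l) ^ 4) = 1 + (\<Sum>l\<in>lshell (rad N). 1 / (1 + lnorm l) ^ 4)"
      by (subst ball_lshell[OF r]) simp
    also have "(\<Sum>l\<in>lshell (rad N). 1 / (1 + lnorm l) ^ 4) \<le> (\<Sum>l\<in>lshell (rad N). 1 / lnorm l ^ 4)"
    proof (intro sum_mono frac_le power_mono)
      fix l assume "l \<in> lshell (rad N)"
      then show "0 < lnorm l ^ 4" using lnorm_ge_1[of l] by simp
    qed auto
    also have "\<dots> \<le> (\<bar>L\<bar> + 1) * ln (rad N)" using elim(1) lr by (simp add: divide_less_eq)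
    also have "\<dots> \<le> (\<bar>L\<bar> + 1) * ln (real N)" using lr by (intro mult_left_mono) auto
    finally show ?case using lnN by (simp add: algebra_simps)
  qed
  then show ?thesis by (rule that) simp
qed

text \<open>The kernel need not be positive, so the upper estimate is applied to the modulus
  \<open>S\<close>, for which only the norms on basis vectors are known. They also bound the
  diagonal of \<open>S\<close>, and the weights \<open>1 / (1 + lnorm l) ^ 4\<close> sum to order
  \<open>ln N\<close>.\<close>

lemma kop_L1inf:
  assumes k: "kdecay C k" shows "L1inf (kop k)"
proof -
  note cp = kop_h0_compact[OF k]
  obtain S e where S: "positive_op S" "eigensystem S (singvals (kop k)) e" "\<And>x. norm (S x) = norm (on_ell2 (kop k) x)"
  proof (rule singvals_compact[OF cp kop_adjoint[OF k]])
    fix S e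
    assume "positive_op S" "eigensystem S (singvals (kop k)) e" "\<And>x. norm (S x) = norm (on_ell2 (kop k) x)"
    then show thesis by (rule that)
  qed
  define D where "D = 51 * C"
  have D0: "0 \<le> D" using kdecay_nonneg[OF k] by (simp add: D_def)
  have dec: "norm (S (ebas l)) \<le> D / (1 + lnorm l) ^ 4" for l
    by (simp add: S(3) on_kop_ebas[OF k] D_def norm_kcol[OF k])
  have one: "norm (ebas l) = 1" for l by (rule orthonormal_norm[OF ebas_orthonormal[of "{l}"]]) simp
  obtain K where K: "\<forall>\<^sub>F N in sequentially. (\<Sum>l | lnorm l \<le> rad N. 1 / (1 + lnorm l) ^ 4) \<le> K * ln (real N)" "0 < K"
    using lattice_log_bound .
  \<comment> \<open>\<open>209952 = 81 * 2592\<close> is what remains of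
    \<open>N * 2592 / rad N ^ 4\<close>, so the contribution outside the ball does not grow with
    \<open>N\<close>.\<close>
  define E where "E = sqrt (D\<^sup>2 * 209952)"
  have "\<forall>\<^sub>F N in sequentially. norm (partial_trace (kop k) N) \<le> (D * K + E) * norm (ln (real N))"
    using K(1) eventually_gt_at_top[of 81]
  proof eventually_elim
    case (elim N)
    have r: "1 \<le> rad N" "rad N ^ 4 = real N / 81" using rad_props elim by simp_all
    have lnN: "1 \<le> ln (real N)"
      using ln_ge_iff[of "real N" 1] exp_le elim by simp
    have "partial_trace (kop k) N \<le> (\<Sum>l | lnorm l \<le> rad N. inner (S (ebas l)) (ebas l)) + sqrt (real N) * sqrt (D\<^sup>2 * (2592 / rad N ^ 4))"
      unfolding partial_trace_def by (rule eigensum_le_lattice_trace[OF S(1,2) dec r(1)])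
    also have "sqrt (real N) * sqrt (D\<^sup>2 * (2592 / rad N ^ 4)) = E"
      using elim by (simp add: E_def r(2) flip: real_sqrt_mult)
    also have "(\<Sum>l | lnorm l \<le> rad N. inner (S (ebas l)) (ebas l)) \<le> (\<Sum>l | lnorm l \<le> rad N. D * (1 / (1 + lnorm l) ^ 4))"
    proof (rule sum_mono)
      fix l
      show "inner (S (ebas l)) (ebas l) \<le> D * (1 / (1 + lnorm l) ^ 4)"
        using norm_cauchy_schwarz[of "S (ebas l)" "ebas l"] dec[of l] by (simp add: one)
    qed
    also have "\<dots> = D * (\<Sum>l | lnorm l \<le> rad N. 1 / (1 + lnorm l) ^ 4)" by (rule sum_distrib_left[symmetric])
    also have "\<dots> \<le> D * (K * ln (real N))" using elim(1) D0 by (rule mult_left_mono)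
    finally have "partial_trace (kop k) N \<le> D * (K * ln (real N)) + E" by simp
    also have "\<dots> \<le> (D * K + E) * ln (real N)"
      using mult_left_mono[OF lnN, of E] by (simp add: E_def algebra_simps)
    finally have "partial_trace (kop k) N \<le> (D * K + E) * ln (real N)" .
    moreover have "0 \<le> partial_trace (kop k) N"
      unfolding partial_trace_def using es_nonneg[OF S(1,2)] by (simp add: sum_nonneg)
    ultimately show ?case using lnN by simp
  qed
  then have "partial_trace (kop k) \<in> O(\<lambda>N. ln (real N))" by (rule bigoI)
  then show ?thesis using cp by (simp add: L1inf_def)
qed

lemma kop_trace_asymptotics:
  assumes k: "kdecay C k" and pos: "h0_positive (kop k)"
  shows "(\<lambda>N. (partial_trace (kop k) N - (\<Sum>l | lnorm l \<le> rad N. Re (k l l))) / ln (real N)) \<longlonglongrightarrow> 0"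
proof -
  obtain e where e: "eigensystem (on_ell2 (kop k)) (singvals (kop k)) e" "positive_op (on_ell2 (kop k))"
    using positive_compact_eigensystem[OF pos kop_h0_compact[OF k]] .
  define D where "D = 51 * C"
  define E where "E = sqrt (D\<^sup>2 * 209952)"
  have dec: "norm (on_ell2 (kop k) (ebas l)) \<le> D / (1 + lnorm l) ^ 4" for l
    by (simp add: on_kop_ebas[OF k] D_def norm_kcol[OF k])
  have diag: "inner (on_ell2 (kop k) (ebas l)) (ebas l) = Re (k l l)" for l
    by (simp add: inner_ell2_def on_kop_ebas[OF k] Rep_kcol[OF k])
  have "filterlim (\<lambda>N. ln (real N)) at_top sequentially"
    by (rule filterlim_compose[OF ln_at_top filterlim_real_sequentially])
  from tendsto_mult[OF tendsto_const[of E] tendsto_inverse_0_at_top[OF this]]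
  have lim: "(\<lambda>N. E * inverse (ln (real N))) \<longlonglongrightarrow> 0" by simp
  show ?thesis
  proof (rule Lim_null_comparison[OF _ lim])
    show "\<forall>\<^sub>F N in sequentially. norm ((partial_trace (kop k) N - (\<Sum>l | lnorm l \<le> rad N. Re (k l l))) / ln (real N)) \<le> E * inverse (ln (real N))"
      using eventually_gt_at_top[of 81]
    proof eventually_elim
      case (elim N)
      have r: "1 \<le> rad N" "rad N ^ 4 = real N / 81" using rad_props elim by simp_all
      have ln0: "0 < ln (real N)" using elim by simp
      have "(\<Sum>l | lnorm l \<le> rad N. Re (k l l)) \<le> partial_trace (kop k) N"
        unfolding partial_trace_def diag[symmetric] by (rule lattice_trace_le_eigensum[OF e(2,1) r(1)]) (simp add: r(2))
      moreover have "partial_trace (kop k) N \<le> (\<Sum>l | lnorm l \<le> rad N. Re (k l l)) + sqrt (real N) * sqrt (D\<^sup>2 * (2592 / rad N ^ 4))"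
        unfolding partial_trace_def diag[symmetric] by (rule eigensum_le_lattice_trace[OF e(2,1) dec r(1)])
      moreover have "sqrt (real N) * sqrt (D\<^sup>2 * (2592 / rad N ^ 4)) = E"
        using elim by (simp add: E_def r(2) flip: real_sqrt_mult)
      ultimately have "\<bar>partial_trace (kop k) N - (\<Sum>l | lnorm l \<le> rad N. Re (k l l))\<bar> \<le> E" by simp
      then show ?case using ln0 by (simp add: abs_divide divide_right_mono divide_inverse[symmetric])
    qed
  qed
qed

section \<open>Symbols on the noncommutative torus\<close>

lemma one_le_weight [simp]: "1 \<le> 1 + lnorm l" and weight_pos [simp]: "0 < 1 + lnorm l" and weight_ne [simp]: "1 + lnorm l \<noteq> 0"
  using lnorm_nonneg[of l] by linarith+

lemma rapid_bound:
  assumes "rapid a" obtains B where "0 \<le> B" "\<And>l. cmod (a l) \<le> B / (1 + lnorm l) ^ k"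
proof -
  obtain B where B: "\<And>l. (1 + lnorm l) ^ k * cmod (a l) \<le> B"
  proof -
    have "bdd_above (range (\<lambda>l. (1 + lnorm l) ^ k * cmod (a l)))" using assms unfolding rapid_def by (rule spec)
    then show ?thesis using that unfolding bdd_above_def by blast
  qed
  have "0 \<le> B" by (rule order_trans[OF _ B[of 0]]) simp
  moreover have "cmod (a l) \<le> B / (1 + lnorm l) ^ k" for l
    using B[of l] by (simp add: pos_le_divide_eq mult.commute)
  ultimately show ?thesis using that by blast
qed

lemma rapid_summable:
  assumes "rapid a" obtains A where "0 \<le> A" "\<And>M. finite M \<Longrightarrow> (\<Sum>m\<in>M. cmod (a m)) \<le> A"
proof -
  obtain B where B: "0 \<le> B" "\<And>l. cmod (a l) \<le> B / (1 + lnorm l) ^ 8" using rapid_bound[OF assms, of 8] by blast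
  have "(\<Sum>m\<in>M. cmod (a m)) \<le> B * 2593" if M: "finite M" for M
  proof -
    have "(\<Sum>m\<in>M. cmod (a m)) \<le> (\<Sum>m\<in>M. B * (1 / (1 + lnorm m) ^ 8))" using B(2) by (intro sum_mono) simp
    also have "\<dots> \<le> B * 2593" unfolding sum_distrib_left[symmetric] by (intro mult_left_mono lattice_weight_bound M B(1))
    finally show ?thesis .
  qed
  then show ?thesis using that[of "B * 2593"] B(1) by simp
qed

lemma norm_twist [simp]: "cmod (twist \<theta> a b) = 1"
proof -
  have "twist \<theta> a b = exp (\<i> * complex_of_real (2 * pi * (\<Sum>k\<in>UNIV. \<Sum>l\<in>UNIV. if k < l then \<theta> $ l $ k * of_int (a $ l) * of_int (b $ k) else 0)))"
    unfolding twist_def by (simp add: mult_ac)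
  then show ?thesis by (simp only: norm_exp_i_times)
qed

lemma twist_0 [simp]: "twist \<theta> a 0 = 1" "twist \<theta> 0 a = 1"
  by (simp_all add: twist_def cong: if_cong)

text \<open>Young's inequality for the twisted convolution: the phases have modulus 1, and
  Cauchy-Schwarz with \<open>sqrt (cmod (a m))\<close> on both sides reduces to shifts of
  \<open>x\<close>. The estimate is proved for finite sums and passes to the limit. It ensures that
  the supremum in \<open>cnorm\<close> is taken over a bounded set.\<close>

lemma lmult_bounded:
  fixes x :: ell2
  assumes A: "0 \<le> A" "\<And>M. finite M \<Longrightarrow> (\<Sum>m\<in>M. cmod (a m)) \<le> A"
  shows "l2norm (lmult \<theta> a (Rep_ell2 x)) \<le> A * norm x"
proof -
  define f where "f n m = a m * Rep_ell2 x (n - m) * twist \<theta> m (n - m)" for n m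
  have fs: "f n summable_on UNIV" for n
  proof (rule abs_summable_summable)
    have "(\<Sum>m\<in>M. norm (f n m)) \<le> A * norm x" if "finite M" for M
    proof -
      have "(\<Sum>m\<in>M. norm (f n m)) \<le> (\<Sum>m\<in>M. cmod (a m) * norm x)"
        by (intro sum_mono) (simp add: f_def norm_mult mult_left_mono cmod_Rep_le)
      then show ?thesis using mult_right_mono[OF A(2)[OF that], of "norm x"] by (simp add: sum_distrib_right)
    qed
    then show "(\<lambda>m. norm (f n m)) summable_on UNIV"
      by (intro nonneg_bounded_partial_sums_imp_summable_on[where C="A * norm x"] eventually_finite_subsets_at_top_weakI) auto
  qed
  have part: "(\<Sum>n\<in>G. (cmod (\<Sum>m\<in>M. f n m))\<^sup>2) \<le> (A * norm x)\<^sup>2" if G: "finite G" and M: "finite M" for G M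
  proof -
    have "(cmod (\<Sum>m\<in>M. f n m))\<^sup>2 \<le> A * (\<Sum>m\<in>M. cmod (a m) * (cmod (Rep_ell2 x (n - m)))\<^sup>2)" for n
    proof -
      have "cmod (\<Sum>m\<in>M. f n m) \<le> (\<Sum>m\<in>M. sqrt (cmod (a m)) * (sqrt (cmod (a m)) * cmod (Rep_ell2 x (n - m))))"
        by (rule order_trans[OF norm_sum]) (simp add: f_def norm_mult flip: mult.assoc)
      then have "(cmod (\<Sum>m\<in>M. f n m))\<^sup>2 \<le> (\<Sum>m\<in>M. sqrt (cmod (a m)) * (sqrt (cmod (a m)) * cmod (Rep_ell2 x (n - m))))\<^sup>2"
        by (intro power_mono) auto
      also have "\<dots> \<le> (\<Sum>m\<in>M. (sqrt (cmod (a m)))\<^sup>2) * (\<Sum>m\<in>M. (sqrt (cmod (a m)) * cmod (Rep_ell2 x (n - m)))\<^sup>2)"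
        by (rule Cauchy_Schwarz_ineq_sum)
      also have "\<dots> \<le> A * (\<Sum>m\<in>M. cmod (a m) * (cmod (Rep_ell2 x (n - m)))\<^sup>2)"
        using A(2)[OF M] by (simp add: power_mult_distrib mult_right_mono sum_nonneg)
      finally show ?thesis .
    qed
    then have "(\<Sum>n\<in>G. (cmod (\<Sum>m\<in>M. f n m))\<^sup>2) \<le> (\<Sum>n\<in>G. A * (\<Sum>m\<in>M. cmod (a m) * (cmod (Rep_ell2 x (n - m)))\<^sup>2))"
      by (intro sum_mono)
    also have "\<dots> = A * (\<Sum>n\<in>G. \<Sum>m\<in>M. cmod (a m) * (cmod (Rep_ell2 x (n - m)))\<^sup>2)"
      by (rule sum_distrib_left[symmetric])
    also have "(\<Sum>n\<in>G. \<Sum>m\<in>M. cmod (a m) * (cmod (Rep_ell2 x (n - m)))\<^sup>2) = (\<Sum>m\<in>M. \<Sum>n\<in>G. cmod (a m) * (cmod (Rep_ell2 x (n - m)))\<^sup>2)"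
      by (rule sum.swap)
    also have "\<dots> = (\<Sum>m\<in>M. cmod (a m) * (\<Sum>n\<in>G. (cmod (Rep_ell2 x (n - m)))\<^sup>2))"
      by (simp only: sum_distrib_left)
    finally have "(\<Sum>n\<in>G. (cmod (\<Sum>m\<in>M. f n m))\<^sup>2) \<le> A * (\<Sum>m\<in>M. cmod (a m) * (\<Sum>n\<in>G. (cmod (Rep_ell2 x (n - m)))\<^sup>2))" .
    also have "\<dots> \<le> A * (\<Sum>m\<in>M. cmod (a m) * (norm x)\<^sup>2)"
    proof (intro mult_left_mono sum_mono A(1))
      fix m
      have "(\<Sum>n\<in>G. (cmod (Rep_ell2 x (n - m)))\<^sup>2) = (\<Sum>n\<in>(\<lambda>n. n - m) ` G. (cmod (Rep_ell2 x n))\<^sup>2)"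
        by (subst sum.reindex) (auto simp: inj_on_def)
      then show "(\<Sum>n\<in>G. (cmod (Rep_ell2 x (n - m)))\<^sup>2) \<le> (norm x)\<^sup>2" using sum_le_norm_sq[of "(\<lambda>n. n - m) ` G" x] G by simp
    qed auto
    also have "\<dots> \<le> A * (A * (norm x)\<^sup>2)"
      unfolding sum_distrib_right[symmetric] by (intro mult_left_mono mult_right_mono A(1) A(2)[OF M]) auto
    finally show ?thesis by (simp add: power2_eq_square mult_ac)
  qed
  have lim: "(sum (f n) \<longlongrightarrow> lmult \<theta> a (Rep_ell2 x) n) (finite_subsets_at_top UNIV)" for n
    using infsum_tendsto[OF fs[of n]] by (simp add: lmult_def f_def[abs_def])
  have bound: "(\<Sum>n\<in>G. (cmod (lmult \<theta> a (Rep_ell2 x) n))\<^sup>2) \<le> (A * norm x)\<^sup>2" if G: "finite G" for G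
  proof (rule tendsto_upperbound)
    show "((\<lambda>M. \<Sum>n\<in>G. (cmod (sum (f n) M))\<^sup>2) \<longlongrightarrow> (\<Sum>n\<in>G. (cmod (lmult \<theta> a (Rep_ell2 x) n))\<^sup>2)) (finite_subsets_at_top UNIV)"
      by (intro tendsto_intros lim)
    show "\<forall>\<^sub>F M in finite_subsets_at_top UNIV. (\<Sum>n\<in>G. (cmod (sum (f n) M))\<^sup>2) \<le> (A * norm x)\<^sup>2"
      by (rule eventually_finite_subsets_at_top_weakI) (use part[OF G] in auto)
  qed simp
  then have mem: "lmult \<theta> a (Rep_ell2 x) \<in> l2" unfolding l2_iff_bdd by blast
  have "(norm (Abs_ell2 (lmult \<theta> a (Rep_ell2 x))))\<^sup>2 \<le> (A * norm x)\<^sup>2"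
    by (rule norm_sq_le_bounded_sums) (use bound mem in \<open>simp add: Abs_ell2_inverse\<close>)
  then have "norm (Abs_ell2 (lmult \<theta> a (Rep_ell2 x))) \<le> A * norm x"
    by (rule power2_le_imp_le) (use A(1) in simp)
  then show ?thesis by (simp add: norm_ell2.rep_eq Abs_ell2_inverse mem)
qed

text \<open>Multiplication by \<open>a\<close> sends the unit vector \<open>ebas 0\<close> to
  \<open>a\<close> itself, so \<open>cnorm\<close> dominates the \<open>l2\<close> norm and hence
  every coefficient. All symbol estimates enter the proof through this inequality.\<close>

lemma coeff_le_cnorm:
  assumes a: "rapid a" shows "cmod (a l) \<le> cnorm \<theta> a"
proof -
  obtain A where A: "0 \<le> A" "\<And>M. finite M \<Longrightarrow> (\<Sum>m\<in>M. cmod (a m)) \<le> A" using rapid_summable[OF a] by blast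
  have bdd: "bdd_above ((\<lambda>x. l2norm (lmult \<theta> a x)) ` {x\<in>l2. l2norm x \<le> 1})"
  proof (rule bdd_aboveI2)
    fix x assume x: "x \<in> {x\<in>l2. l2norm x \<le> 1}"
    then have "l2norm (lmult \<theta> a x) \<le> A * l2norm x"
      using lmult_bounded[OF A, of \<theta> "Abs_ell2 x"] by (simp add: Abs_ell2_inverse norm_ell2.rep_eq)
    also have "\<dots> \<le> A * 1" using x A(1) by (intro mult_left_mono) auto
    finally show "l2norm (lmult \<theta> a x) \<le> A" by simp
  qed
  have one: "norm (ebas 0) = 1" by (rule orthonormal_norm[OF ebas_orthonormal[of "{0}"]]) simp
  have "lmult \<theta> a (Rep_ell2 (ebas 0)) n = a n" for n
  proof -
    have "((\<lambda>m. a m * Rep_ell2 (ebas 0) (n - m) * twist \<theta> m (n - m)) has_sum (\<Sum>m\<in>{n}. a m * Rep_ell2 (ebas 0) (n - m) * twist \<theta> m (n - m))) UNIV"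
      by (rule has_sum_finite_neutralI[of "{n}"]) (auto simp: ebas.rep_eq)
    then show ?thesis by (simp add: lmult_def infsumI ebas.rep_eq)
  qed
  then have eq: "lmult \<theta> a (Rep_ell2 (ebas 0)) = a" by blast
  obtain B where B: "0 \<le> B" "\<And>l. cmod (a l) \<le> B / (1 + lnorm l) ^ 8" using rapid_bound[OF a, of 8] by blast
  have mem: "a \<in> l2" by (rule weighted_l2(1)[of a B 0]) (use B in simp_all)
  have "cmod (a l) \<le> l2norm a" using cmod_Rep_le[of "Abs_ell2 a" l] mem by (simp add: Abs_ell2_inverse norm_ell2.rep_eq)
  also have "\<dots> = l2norm (lmult \<theta> a (Rep_ell2 (ebas 0)))" by (simp only: eq)
  also have "\<dots> \<le> cnorm \<theta> a" unfolding cnorm_def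
    by (rule cSUP_upper[OF _ bdd]) (use one Rep_ell2 in \<open>simp add: norm_ell2.rep_eq\<close>)
  finally show ?thesis .
qed

lemma delta_0 [simp]: "delta 0 a = a"
  by (simp add: delta_def)

lemma delta_axis: "delta (axis k j) a = (\<lambda>l. of_int (l $ k) ^ j * a l)"
proof -
  have "(\<Prod>k'\<in>UNIV. (of_int (l $ k') :: complex) ^ (axis k j $ k')) = (\<Prod>k'\<in>UNIV. if k' = k then of_int (l $ k) ^ j else 1)" for l
    by (intro prod.cong refl) (auto simp: axis_def)
  then show ?thesis by (simp add: delta_def)
qed

lemma rapid_diff: "rapid a \<Longrightarrow> rapid b \<Longrightarrow> rapid (\<lambda>l. a l - b l)"
proof -
  assume a: "rapid a" and b: "rapid b"
  have "bdd_above (range (\<lambda>l. (1 + lnorm l) ^ k * cmod (a l - b l)))" for k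
  proof -
    obtain A where A: "\<And>l. cmod (a l) \<le> A / (1 + lnorm l) ^ k" using rapid_bound[OF a, of k] by blast
    obtain B where B: "\<And>l. cmod (b l) \<le> B / (1 + lnorm l) ^ k" using rapid_bound[OF b, of k] by blast
    have "(1 + lnorm l) ^ k * cmod (a l - b l) \<le> A + B" for l
    proof -
      have "cmod (a l - b l) \<le> A / (1 + lnorm l) ^ k + B / (1 + lnorm l) ^ k"
        by (intro order_trans[OF norm_triangle_ineq4] add_mono A B)
      then show ?thesis by (simp add: add_divide_distrib[symmetric] pos_le_divide_eq mult.commute)
    qed
    then show ?thesis by (intro bdd_aboveI2) 
  qed
  then show ?thesis by (simp add: rapid_def)
qed

lemma rapid_delta_axis:
  assumes a: "rapid a" shows "rapid (delta (axis k j) a)"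
proof -
  have "bdd_above (range (\<lambda>l. (1 + lnorm l) ^ i * cmod (delta (axis k j) a l)))" for i
  proof -
    obtain A where A: "\<And>l. cmod (a l) \<le> A / (1 + lnorm l) ^ (i + j)" using rapid_bound[OF a, of "i + j"] by blast
    have "(1 + lnorm l) ^ i * cmod (delta (axis k j) a l) \<le> A" for l
    proof -
      have "\<bar>real_of_int (l $ k)\<bar> \<le> 1 + lnorm l" using component_le_lnorm[of l k] by linarith
      then have "cmod (of_int (l $ k) ^ j) \<le> (1 + lnorm l) ^ j"
        by (simp add: norm_power power_mono)
      then have "(1 + lnorm l) ^ i * cmod (delta (axis k j) a l) \<le> (1 + lnorm l) ^ i * ((1 + lnorm l) ^ j * cmod (a l))"
        unfolding delta_axis norm_mult by (intro mult_left_mono mult_right_mono) auto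
      also have "\<dots> = (1 + lnorm l) ^ (i + j) * cmod (a l)" by (simp add: power_add mult_ac)
      also have "\<dots> \<le> A" using A[of l] by (simp add: pos_le_divide_eq mult.commute)
      finally show ?thesis .
    qed
    then show ?thesis by (intro bdd_aboveI2)
  qed
  then show ?thesis by (simp add: rapid_def)
qed

text \<open>With \<open>M\<close> the maximum of 1 and the absolute coordinates,
  \<open>1 + lnorm l\<close> is at most \<open>5 * M\<close>. Thus pure powers of single
  coordinates, that is \<open>delta\<close> along the axes, control the full weight.\<close>

lemma weight_power_le: "(1 + lnorm l) ^ 12 \<le> 5 ^ 12 * (1 + (\<Sum>k\<in>UNIV. \<bar>real_of_int (l $ k)\<bar> ^ 12))"
proof -
  define A where "A = insert 1 (range (\<lambda>k. \<bar>real_of_int (l $ k)\<bar>))"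
  define M where "M = Max A"
  have A: "finite A" "A \<noteq> {}" by (auto simp: A_def)
  have le: "a \<le> M" if "a \<in> A" for a unfolding M_def using A that by simp
  have M1: "1 \<le> M" by (rule le) (simp add: A_def)
  have "lnorm l \<le> (\<Sum>k\<in>UNIV. \<bar>real_of_int (l $ k)\<bar>)"
    using norm_le_l1_cart[of "ivec l"] by (simp add: lnorm_def ivec_def)
  also have "\<dots> \<le> (\<Sum>k\<in>(UNIV::4 set). M)" by (intro sum_mono le) (auto simp: A_def)
  finally have "1 + lnorm l \<le> 5 * M" using M1 by simp
  then have "(1 + lnorm l) ^ 12 \<le> (5 * M) ^ 12" by (intro power_mono) auto
  also have "\<dots> = 5 ^ 12 * M ^ 12" by (simp add: power_mult_distrib)
  also have "M ^ 12 \<le> 1 + (\<Sum>k\<in>UNIV. \<bar>real_of_int (l $ k)\<bar> ^ 12)"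
  proof -
    have "M \<in> A" unfolding M_def by (rule Max_in[OF A])
    then consider "M = 1" | k where "M = \<bar>real_of_int (l $ k)\<bar>" by (auto simp: A_def)
    then show ?thesis
    proof cases
      case 1
      then show ?thesis by (simp add: sum_nonneg)
    next
      case (2 k)
      have "\<bar>real_of_int (l $ k)\<bar> ^ 12 \<le> (\<Sum>k\<in>UNIV. \<bar>real_of_int (l $ k)\<bar> ^ 12)"
        by (rule member_le_sum) auto
      then show ?thesis using 2 by simp
    qed
  qed
  finally show ?thesis by simp
qed

definition symbol_kernel :: "real^4^4 \<Rightarrow> (freq \<Rightarrow> coeffs) \<Rightarrow> lat \<Rightarrow> lat \<Rightarrow> complex" where
  "symbol_kernel \<theta> \<rho> n l = \<rho> (ivec l) (n - l) * twist \<theta> (n - l) l"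

lemma Pop_eq_kop: "Pop \<theta> \<rho> = kop (symbol_kernel \<theta> \<rho>)"
  by (simp add: Pop_def kop_def symbol_kernel_def fun_eq_iff)

text \<open>Derivations in the algebra multiply coefficients by powers of the index, so bounds on
  \<open>delta\<close> give decay in \<open>m\<close>. The order 12 allows for the exponent 10 of
  \<open>kdecay\<close> and the two powers spent on the exchange of \<open>l\<close> for
  \<open>n\<close> in \<open>symbol_kernel_kdecay\<close>.\<close>

lemma symbol_coeff_bound:
  assumes "symbol \<theta> (-4) \<rho>"
  obtains C where "0 \<le> C" "\<And>\<xi> m. cmod (\<rho> \<xi> m) \<le> C / ((1 + lnorm m) ^ 12 * (1 + norm \<xi>) ^ 4)"
proof -
  obtain D where D: "smooth_family UNIV D" "D 0 = \<rho>"
    and est: "\<And>i j. \<exists>c. \<forall>\<xi>. cnorm \<theta> (delta i (D j \<xi>)) \<le> c * (1 + norm \<xi>) powr (- 4 - real (msize j))"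
    using assms unfolding symbol_def by blast
  have rap: "rapid (\<rho> \<xi>)" for \<xi> using D by (auto simp: smooth_family_def)
  have pw: "(1 + norm \<xi>) powr (- 4) = 1 / (1 + norm \<xi>) ^ 4" for \<xi> :: freq
  proof -
    have "1 + norm \<xi> > 0" using norm_ge_zero[of \<xi>] by linarith
    then show ?thesis by (simp add: powr_minus powr_numeral divide_inverse)
  qed
  have est0: "\<exists>c. \<forall>\<xi>. cnorm \<theta> (delta i (\<rho> \<xi>)) \<le> c * (1 / (1 + norm \<xi>) ^ 4)" for i
    using est[of i 0] by (simp add: D(2) msize_def pw)
  obtain c0 where c0: "\<And>\<xi>. cnorm \<theta> (\<rho> \<xi>) \<le> c0 * (1 / (1 + norm \<xi>) ^ 4)" using est0[of 0] by auto
  have "\<forall>k. \<exists>c. \<forall>\<xi>. cnorm \<theta> (delta (axis k 12) (\<rho> \<xi>)) \<le> c * (1 / (1 + norm \<xi>) ^ 4)" using est0 by blast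
  then obtain c where c: "\<And>k \<xi>. cnorm \<theta> (delta (axis k 12) (\<rho> \<xi>)) \<le> c k * (1 / (1 + norm \<xi>) ^ 4)" by metis
  define C where "C = 5 ^ 12 * (c0 + (\<Sum>k\<in>UNIV. c k))"
  have *: "(1 + lnorm m) ^ 12 * cmod (\<rho> \<xi> m) \<le> C * (1 / (1 + norm \<xi>) ^ 4)" for \<xi> m
  proof -
    have "cmod (\<rho> \<xi> m) \<le> c0 * (1 / (1 + norm \<xi>) ^ 4)" using coeff_le_cnorm[OF rap] c0 by (rule order_trans)
    moreover have "\<bar>real_of_int (m $ k)\<bar> ^ 12 * cmod (\<rho> \<xi> m) \<le> c k * (1 / (1 + norm \<xi>) ^ 4)" for k
    proof -
      have "cmod (delta (axis k 12) (\<rho> \<xi>) m) \<le> c k * (1 / (1 + norm \<xi>) ^ 4)"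
        by (rule order_trans[OF coeff_le_cnorm[OF rapid_delta_axis[OF rap]] c])
      then show ?thesis by (simp add: delta_axis norm_mult norm_power)
    qed
    ultimately have "cmod (\<rho> \<xi> m) + (\<Sum>k\<in>UNIV. \<bar>real_of_int (m $ k)\<bar> ^ 12 * cmod (\<rho> \<xi> m))
        \<le> c0 * (1 / (1 + norm \<xi>) ^ 4) + (\<Sum>k\<in>UNIV. c k * (1 / (1 + norm \<xi>) ^ 4))"
      by (intro add_mono sum_mono)
    then have s: "(1 + (\<Sum>k\<in>UNIV. \<bar>real_of_int (m $ k)\<bar> ^ 12)) * cmod (\<rho> \<xi> m) \<le> (c0 + (\<Sum>k\<in>UNIV. c k)) * (1 / (1 + norm \<xi>) ^ 4)"
      by (simp only: distrib_right sum_distrib_right mult_1)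
    have "(1 + lnorm m) ^ 12 * cmod (\<rho> \<xi> m) \<le> 5 ^ 12 * (1 + (\<Sum>k\<in>UNIV. \<bar>real_of_int (m $ k)\<bar> ^ 12)) * cmod (\<rho> \<xi> m)"
      by (intro mult_right_mono weight_power_le) simp
    also have "\<dots> \<le> C * (1 / (1 + norm \<xi>) ^ 4)" unfolding C_def mult.assoc by (intro mult_left_mono s[unfolded mult.assoc]) simp
    finally show ?thesis .
  qed
  have "0 \<le> (1 + lnorm 0) ^ 12 * cmod (\<rho> 0 0)" by simp
  also have "\<dots> \<le> C * (1 / (1 + norm (0::freq)) ^ 4)" by (rule *)
  finally have "0 \<le> C" by simp
  moreover have "cmod (\<rho> \<xi> m) \<le> C / ((1 + lnorm m) ^ 12 * (1 + norm \<xi>) ^ 4)" for \<xi> m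
  proof -
    have "0 < (1 + lnorm m) ^ 12" by simp
    from *[of m \<xi>] this have "cmod (\<rho> \<xi> m) \<le> C * (1 / (1 + norm \<xi>) ^ 4) / (1 + lnorm m) ^ 12"
      by (subst pos_le_divide_eq) (simp_all add: mult.commute)
    then show ?thesis by (simp add: mult.commute)
  qed
  ultimately show ?thesis using that by blast
qed

lemma symbol_kernel_kdecay:
  assumes "symbol \<theta> (-4) \<rho>" obtains C where "kdecay C (symbol_kernel \<theta> \<rho>)"
proof -
  obtain C where C: "0 \<le> C" "\<And>\<xi> m. cmod (\<rho> \<xi> m) \<le> C / ((1 + lnorm m) ^ 12 * (1 + norm \<xi>) ^ 4)"
    using symbol_coeff_bound[OF assms] by blast
  have "cmod (symbol_kernel \<theta> \<rho> n l) \<le> C / ((1 + lnorm (n - l)) ^ 10 * (1 + lnorm l) ^ 2 * (1 + lnorm n) ^ 2)" for n l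
  proof -
    have "(1 + lnorm n) ^ 2 \<le> ((1 + lnorm l) * (1 + lnorm (n - l))) ^ 2"
      using Peetre[of n l] by (intro power_mono) (auto simp: lnorm_minus_commute)
    then have "(1 + lnorm (n - l)) ^ 10 * (1 + lnorm l) ^ 2 * (1 + lnorm n) ^ 2
        \<le> (1 + lnorm (n - l)) ^ 10 * (1 + lnorm l) ^ 2 * ((1 + lnorm l) * (1 + lnorm (n - l))) ^ 2"
      by (intro mult_left_mono) auto
    also have "\<dots> = (1 + lnorm (n - l)) ^ 12 * (1 + lnorm l) ^ 4"
      by (simp add: power_mult_distrib eval_nat_numeral mult_ac)
    finally have le: "(1 + lnorm (n - l)) ^ 10 * (1 + lnorm l) ^ 2 * (1 + lnorm n) ^ 2 \<le> (1 + lnorm (n - l)) ^ 12 * (1 + lnorm l) ^ 4" .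
    have "cmod (symbol_kernel \<theta> \<rho> n l) = cmod (\<rho> (ivec l) (n - l))" by (simp add: symbol_kernel_def norm_mult)
    also have "\<dots> \<le> C / ((1 + lnorm (n - l)) ^ 12 * (1 + lnorm l) ^ 4)" using C(2)[of "ivec l" "n - l"] by (simp add: lnorm_def)
    also have "\<dots> \<le> C / ((1 + lnorm (n - l)) ^ 10 * (1 + lnorm l) ^ 2 * (1 + lnorm n) ^ 2)"
      by (rule divide_left_mono[OF le C(1)]) simp
    finally show ?thesis .
  qed
  then show ?thesis using that C(1) by (auto simp: kdecay_def)
qed


section \<open>Positive kernels and the limit of their diagonals\<close>

lemma kdecay_add:
  assumes "kdecay C k" "kdecay C' k'" shows "kdecay (C + C') (\<lambda>n l. k n l + k' n l)"
  unfolding kdecay_def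
proof (intro conjI allI)
  show "0 \<le> C + C'" using assms by (simp add: kdecay_def)
  fix n l
  let ?d = "(1 + lnorm (n - l)) ^ 10 * (1 + lnorm l) ^ 2 * (1 + lnorm n) ^ 2"
  have "cmod (k n l) \<le> C / ?d" "cmod (k' n l) \<le> C' / ?d" using assms unfolding kdecay_def by blast+
  then show "cmod (k n l + k' n l) \<le> (C + C') / ?d"
    unfolding add_divide_distrib by (intro order_trans[OF norm_triangle_ineq] add_mono)
qed

lemma kdecay_scale:
  assumes "kdecay C k" shows "kdecay (cmod c * C) (\<lambda>n l. c * k n l)"
  unfolding kdecay_def
proof (intro conjI allI)
  show "0 \<le> cmod c * C" using assms by (simp add: kdecay_def)
  fix n l
  let ?d = "(1 + lnorm (n - l)) ^ 10 * (1 + lnorm l) ^ 2 * (1 + lnorm n) ^ 2"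
  have "cmod (k n l) \<le> C / ?d" using assms unfolding kdecay_def by blast
  then have "cmod c * cmod (k n l) \<le> cmod c * (C / ?d)" by (rule mult_left_mono) simp
  then show "cmod (c * k n l) \<le> cmod c * C / ?d" by (simp only: norm_mult times_divide_eq_right)
qed

lemma kop_scale: "kop (\<lambda>n l. c * k n l) x = (\<lambda>n. c * kop k x n)"
  by (simp add: kop_def mult.assoc infsum_cmult_right')

lemma kop_add:
  assumes k: "kdecay C k" "kdecay C' k'" and x: "x \<in> l2"
  shows "kop (\<lambda>n l. k n l + k' n l) x = (\<lambda>n. kop k x n + kop k' x n)"
proof -
  have "(\<lambda>l. k n l * x l) summable_on UNIV" if "kdecay C k" for C k n
    using l2_summable_inner[OF x Rep_ell2[of "kcol (kadj k) n"]]
    by (simp add: Rep_kcol[OF kdecay_kadj[OF that]] kadj_def mult.commute)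
  from this[OF k(1)] this[OF k(2)] show ?thesis
    by (simp add: kop_def distrib_right infsum_add)
qed

definition kdiag :: "lat \<Rightarrow> lat \<Rightarrow> complex" where
  "kdiag n l = (if n = l then complex_of_real (1 / (1 + lnorm l) ^ 4) else 0)"

lemma kdecay_kdiag: "kdecay 1 kdiag"
  unfolding kdecay_def
proof (intro conjI allI)
  fix n l
  show "cmod (kdiag n l) \<le> 1 / ((1 + lnorm (n - l)) ^ 10 * (1 + lnorm l) ^ 2 * (1 + lnorm n) ^ 2)"
  proof (cases "n = l")
    case True
    then have "kdiag n l = complex_of_real (1 / (1 + lnorm l) ^ 4)" by (simp add: kdiag_def)
    then have "cmod (kdiag n l) = \<bar>1 / (1 + lnorm l) ^ 4\<bar>" by (simp only: norm_of_real)
    also have "\<dots> = 1 / (1 + lnorm l) ^ 4" by (rule abs_of_nonneg) simp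
    also have "(1 + lnorm l) ^ 4 = (1 + lnorm (n - l)) ^ 10 * (1 + lnorm l) ^ 2 * (1 + lnorm n) ^ 2"
      using True by (simp flip: power_add)
    finally show ?thesis by simp
  qed (simp add: kdiag_def)
qed simp

lemma quad_finite:
  assumes k: "kdecay C k"
  shows "cinner (on_ell2 (kop k) (\<Sum>l\<in>F. a l *\<^sub>C ebas l)) (\<Sum>n\<in>F. a n *\<^sub>C ebas n)
    = (\<Sum>n\<in>F. \<Sum>l\<in>F. k n l * a l * cnj (a n))"
proof -
  note cl = h0_bounded_clinear[OF kop_h0_bounded[OF k]]
  interpret T: bounded_linear "on_ell2 (kop k)" by (rule clinear_op_bl[OF cl])
  have coeff: "cinner (\<Sum>l\<in>F. a l *\<^sub>C kcol k l) (ebas n) = (\<Sum>l\<in>F. a l * k n l)" for n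
    by (simp only: cinner_sum_left cinner_scaleC_left) (simp add: Rep_kcol[OF k])
  have "cinner (on_ell2 (kop k) (\<Sum>l\<in>F. a l *\<^sub>C ebas l)) (\<Sum>n\<in>F. a n *\<^sub>C ebas n)
    = (\<Sum>n\<in>F. cnj (a n) * (\<Sum>l\<in>F. a l * k n l))"
    by (simp only: cinner_sum_right cinner_scaleC_right T.sum clinear_op_scaleC[OF cl] on_kop_ebas[OF k] coeff)
  also have "\<dots> = (\<Sum>n\<in>F. \<Sum>l\<in>F. k n l * a l * cnj (a n))"
    by (simp add: sum_distrib_left mult_ac)
  finally show ?thesis .
qed

lemma positive_on_finite_support:
  assumes bl: "bounded_linear S" and fin: "\<And>F a. finite F \<Longrightarrow> 0 \<le> inner (S (\<Sum>l\<in>F. a l *\<^sub>C ebas l)) (\<Sum>l\<in>F. a l *\<^sub>C ebas l)"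
  shows "0 \<le> inner (S x) x"
proof -
  have "\<exists>F. finite F \<and> norm (x - (\<Sum>l\<in>F. cinner x (ebas l) *\<^sub>C ebas l)) \<le> inverse (real (Suc n))" for n
  proof -
    have "0 < inverse (real (Suc n))" by simp
    from ebas_approximation[OF this, of x] show ?thesis by blast
  qed
  then obtain F where F: "\<And>n. finite (F n)" "\<And>n. norm (x - (\<Sum>l\<in>F n. cinner x (ebas l) *\<^sub>C ebas l)) \<le> inverse (real (Suc n))"
    by metis
  define y where "y n = (\<Sum>l\<in>F n. cinner x (ebas l) *\<^sub>C ebas l)" for n
  have "y \<longlonglongrightarrow> x"
  proof (rule LIM_zero_cancel, rule Lim_null_comparison[OF _ LIMSEQ_inverse_real_of_nat])
    show "\<forall>\<^sub>F n in sequentially. norm (y n - x) \<le> inverse (real (Suc n))"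
      using F(2) by (simp add: y_def norm_minus_commute)
  qed
  then have "(\<lambda>n. inner (S (y n)) (y n)) \<longlonglongrightarrow> inner (S x) x"
    by (intro tendsto_inner bounded_linear.tendsto[OF bl])
  then show ?thesis by (rule LIMSEQ_le_const) (use fin F(1) in \<open>auto simp: y_def\<close>)
qed

text \<open>A Schur test. In terms of \<open>u l = cmod (a l) / (1 + lnorm l) ^ 2\<close>, the form
  of \<open>k\<close> is at least \<open>- C\<close> times the sum of
  \<open>w n l * u l * u n\<close>. Splitting the products into squares and summing the weight
  \<open>w\<close> bounds this below by \<open>- 2593 * C\<close> times the sum of
  \<open>u l ^ 2\<close>, and the form of \<open>M * kdiag\<close> is precisely the opposite of that
  bound.\<close>

lemma kop_dominated_positive:
  assumes k: "kdecay C k" and herm: "kadj k = k"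
  defines "M \<equiv> complex_of_real (C * 2593)"
  shows "h0_positive (kop (\<lambda>n l. k n l + M * kdiag n l))" and "kdecay (C + cmod M * 1) (\<lambda>n l. k n l + M * kdiag n l)"
proof -
  let ?t = "\<lambda>n l. k n l + M * kdiag n l"
  show t: "kdecay (C + cmod M * 1) ?t" by (intro kdecay_add k kdecay_scale kdecay_kdiag)
  have herm': "kadj ?t = ?t"
    using fun_cong[OF fun_cong[OF herm]] by (auto simp: fun_eq_iff kadj_def M_def kdiag_def)
  note b = kop_h0_bounded[OF t]
  have C0: "0 \<le> C" by (rule kdecay_nonneg[OF k])
  have "0 \<le> inner (on_ell2 (kop ?t) x) x" for x
  proof (rule positive_on_finite_support)
    show "bounded_linear (on_ell2 (kop ?t))" by (rule clinear_op_bl[OF h0_bounded_clinear[OF b]])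
    fix F :: "lat set" and a :: "lat \<Rightarrow> complex" assume F: "finite F"
    define u where "u l = cmod (a l) / (1 + lnorm l) ^ 2" for l
    have u2: "(u l)\<^sup>2 = (cmod (a l))\<^sup>2 / (1 + lnorm l) ^ 4" for l
      by (simp add: u_def power_divide flip: power_mult)
    define w where "w n l = 1 / (1 + lnorm (n - l)) ^ 8" for n l
    have w_sym: "w n l = w l n" for n l by (simp add: w_def lnorm_minus_commute)
    have w0: "0 \<le> w n l" for n l by (simp add: w_def)
    have wsum: "(\<Sum>n\<in>F. w n l) \<le> 2593" for l unfolding w_def by (rule lattice_weight_bound_shift[OF F])
    have pt: "- Re (k n l * a l * cnj (a n)) \<le> C * w n l * ((u l)\<^sup>2 + (u n)\<^sup>2) / 2" for n l
    proof -
      have "- Re (k n l * a l * cnj (a n)) \<le> cmod (k n l * a l * cnj (a n))"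
        using abs_Re_le_cmod[of "k n l * a l * cnj (a n)"] by linarith
      also have "\<dots> = cmod (k n l) * (cmod (a l) * cmod (a n))" by (simp add: norm_mult)
      also have "\<dots> \<le> C / ((1 + lnorm (n - l)) ^ 10 * (1 + lnorm l) ^ 2 * (1 + lnorm n) ^ 2) * (cmod (a l) * cmod (a n))"
        using k by (intro mult_right_mono) (auto simp: kdecay_def)
      also have "\<dots> = C * (1 / (1 + lnorm (n - l)) ^ 10) * (u l * u n)" by (simp add: u_def)
      also have "\<dots> \<le> C * w n l * (u l * u n)"
      proof -
        have "(1 + lnorm (n - l)) ^ 8 \<le> (1 + lnorm (n - l)) ^ 10" by (rule power_increasing) auto
        then have "1 / (1 + lnorm (n - l)) ^ 10 \<le> w n l" unfolding w_def by (intro divide_left_mono) auto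
        then show ?thesis using C0 by (intro mult_right_mono mult_left_mono) (auto simp: u_def)
      qed
      also have "\<dots> \<le> C * w n l * (((u l)\<^sup>2 + (u n)\<^sup>2) / 2)"
        using sum_squares_bound[of "u l" "u n"] C0 w0 by (intro mult_left_mono) auto
      finally show ?thesis by simp
    qed
    have "(\<Sum>n\<in>F. \<Sum>l\<in>F. C * w n l * ((u l)\<^sup>2 + (u n)\<^sup>2) / 2) = C * (\<Sum>l\<in>F. (\<Sum>n\<in>F. w n l) * (u l)\<^sup>2)"
    proof -
      have "(\<Sum>n\<in>F. \<Sum>l\<in>F. C * w n l * ((u l)\<^sup>2 + (u n)\<^sup>2) / 2)
        = (\<Sum>n\<in>F. \<Sum>l\<in>F. C / 2 * (w n l * (u l)\<^sup>2)) + (\<Sum>n\<in>F. \<Sum>l\<in>F. C / 2 * (w n l * (u n)\<^sup>2))"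
        unfolding sum.distrib[symmetric] by (intro sum.cong refl) (simp add: field_simps)
      also have "(\<Sum>n\<in>F. \<Sum>l\<in>F. C / 2 * (w n l * (u n)\<^sup>2)) = (\<Sum>l\<in>F. \<Sum>n\<in>F. C / 2 * (w n l * (u l)\<^sup>2))"
        by (intro sum.cong refl) (simp add: w_sym)
      also have "(\<Sum>l\<in>F. \<Sum>n\<in>F. C / 2 * (w n l * (u l)\<^sup>2)) = (\<Sum>n\<in>F. \<Sum>l\<in>F. C / 2 * (w n l * (u l)\<^sup>2))"
        by (rule sum.swap)
      also have "(\<Sum>n\<in>F. \<Sum>l\<in>F. C / 2 * (w n l * (u l)\<^sup>2)) + (\<Sum>n\<in>F. \<Sum>l\<in>F. C / 2 * (w n l * (u l)\<^sup>2))
        = C * (\<Sum>n\<in>F. \<Sum>l\<in>F. w n l * (u l)\<^sup>2)"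
      proof -
        have "(\<Sum>n\<in>F. \<Sum>l\<in>F. C / 2 * (w n l * (u l)\<^sup>2)) = C / 2 * (\<Sum>n\<in>F. \<Sum>l\<in>F. w n l * (u l)\<^sup>2)"
          by (simp only: sum_distrib_left)
        then show ?thesis by simp
      qed
      also have "(\<Sum>n\<in>F. \<Sum>l\<in>F. w n l * (u l)\<^sup>2) = (\<Sum>l\<in>F. \<Sum>n\<in>F. w n l * (u l)\<^sup>2)" by (rule sum.swap)
      finally show ?thesis by (simp only: sum_distrib_right)
    qed
    also have "\<dots> \<le> C * (\<Sum>l\<in>F. 2593 * (u l)\<^sup>2)"
      using C0 wsum by (intro mult_left_mono sum_mono mult_right_mono) auto
    finally have up: "(\<Sum>n\<in>F. \<Sum>l\<in>F. C * w n l * ((u l)\<^sup>2 + (u n)\<^sup>2) / 2) \<le> C * (\<Sum>l\<in>F. 2593 * (u l)\<^sup>2)" .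
    have diag: "(\<Sum>n\<in>F. \<Sum>l\<in>F. Re (M * kdiag n l * a l * cnj (a n))) = C * (\<Sum>l\<in>F. 2593 * (u l)\<^sup>2)"
    proof -
      have "Re (M * kdiag n l * a l * cnj (a n)) = (if l = n then C * (2593 * (u n)\<^sup>2) else 0)" for n l
      proof (cases "l = n")
        case True
        have "M * kdiag n n * a n * cnj (a n) = complex_of_real (C * 2593 * (1 / (1 + lnorm n) ^ 4)) * (a n * cnj (a n))"
          by (simp add: M_def kdiag_def)
        also have "\<dots> = complex_of_real (C * (2593 * (u n)\<^sup>2))"
          unfolding complex_norm_square[symmetric] u2 by simp
        finally show ?thesis using True by simp
      qed (simp add: kdiag_def)
      then show ?thesis using F by (simp add: sum_distrib_left)
    qed
    have "inner (on_ell2 (kop ?t) (\<Sum>l\<in>F. a l *\<^sub>C ebas l)) (\<Sum>l\<in>F. a l *\<^sub>C ebas l) = (\<Sum>n\<in>F. \<Sum>l\<in>F. Re (?t n l * a l * cnj (a n)))"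
      unfolding inner_ell2_def quad_finite[OF t] by simp
    also have "\<dots> = (\<Sum>n\<in>F. \<Sum>l\<in>F. Re (k n l * a l * cnj (a n))) + (\<Sum>n\<in>F. \<Sum>l\<in>F. Re (M * kdiag n l * a l * cnj (a n)))"
      unfolding sum.distrib[symmetric] plus_complex.sel(1)[symmetric] by (simp only: distrib_right)
    also have "\<dots> = C * (\<Sum>l\<in>F. 2593 * (u l)\<^sup>2) - (\<Sum>n\<in>F. \<Sum>l\<in>F. - Re (k n l * a l * cnj (a n)))"
      unfolding diag by (simp only: sum_negf diff_minus_eq_add add.commute)
    also have "\<dots> \<ge> 0"
    proof -
      have "(\<Sum>n\<in>F. \<Sum>l\<in>F. - Re (k n l * a l * cnj (a n))) \<le> (\<Sum>n\<in>F. \<Sum>l\<in>F. C * w n l * ((u l)\<^sup>2 + (u n)\<^sup>2) / 2)"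
        by (intro sum_mono pt)
      with up show ?thesis by linarith
    qed
    finally show "0 \<le> inner (on_ell2 (kop ?t) (\<Sum>l\<in>F. a l *\<^sub>C ebas l)) (\<Sum>l\<in>F. a l *\<^sub>C ebas l)" .
  qed
  then show "h0_positive (kop ?t)"
    using b h0_bounded_clinear[OF b] kop_adjoint[OF t] unfolding herm' by (simp add: h0_positive_iff positive_op_def is_adjoint_iff)
qed

text \<open>A limit is assumed only for the difference of the diagonals; in the application, the
  diagonal operator added for positivity cancels there. The two eigenvalue sums are therefore
  subtracted before the logarithmic average is taken.\<close>

lemma trace_limit_diff:
  assumes \<omega>: "dixmier_state \<omega>" and k1: "kdecay C1 k1" "h0_positive (kop k1)" and k2: "kdecay C2 k2" "h0_positive (kop k2)"
    and lim: "(\<lambda>N. (\<Sum>l | lnorm l \<le> rad N. Re (k1 l l) - Re (k2 l l)) / ln (real N)) \<longlonglongrightarrow> L"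
  shows "trpos \<omega> (kop k1) - trpos \<omega> (kop k2) = complex_of_real L"
proof -
  let ?p = "\<lambda>N. partial_trace (kop k1) N - partial_trace (kop k2) N"
  have "(\<lambda>N. (partial_trace (kop k1) N - (\<Sum>l | lnorm l \<le> rad N. Re (k1 l l))) / ln (real N)
     - (partial_trace (kop k2) N - (\<Sum>l | lnorm l \<le> rad N. Re (k2 l l))) / ln (real N)
     + (\<Sum>l | lnorm l \<le> rad N. Re (k1 l l) - Re (k2 l l)) / ln (real N)) \<longlonglongrightarrow> 0 - 0 + L"
    by (intro tendsto_intros lim kop_trace_asymptotics[OF k1] kop_trace_asymptotics[OF k2])
  then have "(\<lambda>N. ?p N / ln (real N)) \<longlonglongrightarrow> L"
    by (simp add: sum_subtractf diff_divide_distrib add_divide_distrib)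
  then have "(log_avg ?p \<longlongrightarrow> L) at_top" by (rule log_avg_tendsto)
  then have "((\<lambda>t. dix_avg (kop k1) t - dix_avg (kop k2) t) \<longlongrightarrow> L) at_top"
    by (simp add: dix_avg_eq log_avg_diff[abs_def])
  then have lim': "((\<lambda>t. complex_of_real (dix_avg (kop k1) t) - complex_of_real (dix_avg (kop k2) t)) \<longlongrightarrow> complex_of_real L) at_top"
    using tendsto_of_real[of _ L at_top, where 'a=complex] by fastforce
  note m1 = dix_avg_Cb[OF k1(2) kop_L1inf[OF k1(1)]] and m2 = dix_avg_Cb[OF k2(2) kop_L1inf[OF k2(1)]]
  have mem: "(\<lambda>t. complex_of_real (dix_avg (kop k1) t) - complex_of_real (dix_avg (kop k2) t)) \<in> Cb"
    using Cb_lincomb[OF m2 m1, of "-1"] by (simp add: algebra_simps)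
  show ?thesis
    using dixmier_state_limit[OF \<omega> mem lim'] dixmier_state_diff[OF \<omega> m1 m2] by (simp add: trpos_def)
qed

text \<open>The error of order \<open>1 / lnorm l ^ 5\<close> is summable over the lattice, so
  together with the term at the origin it disappears after division by \<open>ln N\<close>. The
  limit \<open>1/4\<close> of \<open>ln (rad N) / ln N\<close> cancels the dimension 4 from
  \<open>lattice_log_asymptotics\<close> and leaves the ball integral.\<close>

lemma lattice_rad_limit:
  fixes h :: "freq \<Rightarrow> real"
  assumes cont: "continuous_on (UNIV - {0}) h" and hom: "\<And>t x. t > 0 \<Longrightarrow> x \<noteq> 0 \<Longrightarrow> h (t *\<^sub>R x) = h x"
    and bd: "\<And>x. x \<noteq> 0 \<Longrightarrow> \<bar>h x\<bar> \<le> M"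
    and g: "\<And>l. l \<noteq> 0 \<Longrightarrow> \<bar>g l - h (ivec l) / lnorm l ^ 4\<bar> \<le> c / lnorm l ^ 5"
  shows "(\<lambda>N. (\<Sum>l | lnorm l \<le> rad N. g l) / ln (real N)) \<longlonglongrightarrow> integral (ball 0 1) h"
proof -
  have c0: "0 \<le> c"
  proof -
    have "(axis 1 1 :: lat) \<noteq> 0" by (simp add: axis_eq_0_iff)
    from g[OF this] have "0 \<le> c / lnorm (axis 1 1) ^ 5" by linarith
    then show ?thesis using lnorm_ge_1[OF \<open>axis 1 1 \<noteq> 0\<close>] by (simp add: zero_le_divide_iff)
  qed
  define A where "A R = (\<Sum>l\<in>lshell R. h (ivec l) / lnorm l ^ 4)" for R
  define B where "B R = (\<Sum>l\<in>lshell R. g l - h (ivec l) / lnorm l ^ 4)" for R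
  have Bb: "\<bar>B R\<bar> \<le> c * 2592" for R
  proof -
    have "\<bar>B R\<bar> \<le> (\<Sum>l\<in>lshell R. c * (1 / lnorm l ^ (1 + 4)))"
      unfolding B_def using g by (intro order_trans[OF sum_abs] sum_mono) auto
    also have "\<dots> \<le> c * (2592 / 1 ^ 1)" unfolding sum_distrib_left[symmetric]
      by (intro mult_left_mono c0 lattice_tail finite_lshell) (auto intro: lnorm_ge_1)
    finally show ?thesis by simp
  qed
  have "((\<lambda>R. A R / ln R) \<longlongrightarrow> 4 * integral (ball 0 1) h) at_top"
    unfolding A_def by (rule lattice_log_asymptotics[OF cont hom bd])
  from filterlim_compose[OF this rad_at_top]
  have "(\<lambda>N. A (rad N) / ln (rad N)) \<longlonglongrightarrow> 4 * integral (ball 0 1) h" .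
  from tendsto_mult[OF this ln_rad_ratio]
  have "(\<lambda>N. A (rad N) / ln (rad N) * (ln (rad N) / ln (real N))) \<longlonglongrightarrow> integral (ball 0 1) h" by simp
  moreover have "\<forall>\<^sub>F N in sequentially. A (rad N) / ln (rad N) * (ln (rad N) / ln (real N)) = A (rad N) / ln (real N)"
    using eventually_gt_at_top[of 81]
  proof eventually_elim
    case (elim N)
    then have "ln 81 < ln (real N)" by simp
    moreover have "4 * ln (rad N) = ln (real N) - ln 81" using ln_rad[of N] elim by simp
    ultimately have "0 < ln (rad N)" by linarith
    then show ?case by simp
  qed
  ultimately have limA: "(\<lambda>N. A (rad N) / ln (real N)) \<longlonglongrightarrow> integral (ball 0 1) h" by (rule Lim_transform_eventually)
  have "filterlim (\<lambda>N. ln (real N)) at_top sequentially"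
    by (rule filterlim_compose[OF ln_at_top filterlim_real_sequentially])
  from tendsto_mult[OF tendsto_const[of "\<bar>g 0\<bar> + c * 2592"] tendsto_inverse_0_at_top[OF this]]
  have lim0: "(\<lambda>N. (\<bar>g 0\<bar> + c * 2592) * inverse (ln (real N))) \<longlonglongrightarrow> 0" by simp
  have limB: "(\<lambda>N. (g 0 + B (rad N)) / ln (real N)) \<longlonglongrightarrow> 0"
  proof (rule Lim_null_comparison[OF _ lim0])
    show "\<forall>\<^sub>F N in sequentially. norm ((g 0 + B (rad N)) / ln (real N)) \<le> (\<bar>g 0\<bar> + c * 2592) * inverse (ln (real N))"
      using eventually_gt_at_top[of 1]
    proof eventually_elim
      case (elim N)
      then have "0 < ln (real N)" by simp
      moreover have "\<bar>g 0 + B (rad N)\<bar> \<le> \<bar>g 0\<bar> + c * 2592" using Bb[of "rad N"] by linarith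
      ultimately show ?case by (simp add: abs_divide divide_right_mono flip: divide_inverse)
    qed
  qed
  have "\<forall>\<^sub>F N in sequentially. A (rad N) / ln (real N) + (g 0 + B (rad N)) / ln (real N) = (\<Sum>l | lnorm l \<le> rad N. g l) / ln (real N)"
    using eventually_ge_at_top[of 81]
  proof eventually_elim
    case (elim N)
    have "(\<Sum>l | lnorm l \<le> rad N. g l) = A (rad N) + (g 0 + B (rad N))"
      unfolding ball_lshell[OF rad_props(1)[OF elim]] A_def B_def by (simp add: sum_subtractf)
    then show ?case by (simp add: add_divide_distrib)
  qed
  from Lim_transform_eventually[OF tendsto_add[OF limA limB] this] show ?thesis by simp
qed

lemma smooth_family_continuous:
  assumes S: "smooth_family S D" shows "continuous_on S (\<lambda>\<xi>. D 0 \<xi> l)"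
  unfolding continuous_on_eq_continuous_at[OF S[unfolded smooth_family_def, THEN conjunct1]]
proof
  fix \<xi> assume \<xi>: "\<xi> \<in> S"
  have op: "open S" and rap: "\<And>\<eta>. \<eta> \<in> S \<Longrightarrow> rapid (D 0 \<eta>)" and ft: "frechet_tendsto (D 0) (D 0 \<xi>) (at \<xi>)"
    using S \<xi> by (auto simp: smooth_family_def)
  have lim: "((\<lambda>\<eta>. pk 0 (\<lambda>l. D 0 \<eta> l - D 0 \<xi> l)) \<longlongrightarrow> 0) (at \<xi>)" using ft by (simp add: frechet_tendsto_def)
  have "\<forall>\<^sub>F \<eta> in at \<xi>. norm (D 0 \<eta> l - D 0 \<xi> l) \<le> pk 0 (\<lambda>l. D 0 \<eta> l - D 0 \<xi> l)"
    using eventually_at_in_open'[OF op \<xi>]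
  proof eventually_elim
    case (elim \<eta>)
    have "bdd_above (range (\<lambda>l. (1 + lnorm l) ^ 0 * cmod (D 0 \<eta> l - D 0 \<xi> l)))"
      using rapid_diff[OF rap[OF elim] rap[OF \<xi>]] unfolding rapid_def by (rule spec)
    from cSUP_upper[OF UNIV_I this, of l] show ?case by (simp add: pk_def)
  qed
  then have "((\<lambda>\<eta>. D 0 \<eta> l - D 0 \<xi> l) \<longlongrightarrow> 0) (at \<xi>)" by (rule Lim_null_comparison[OF _ lim])
  then show "isCont (\<lambda>\<xi>. D 0 \<xi> l) \<xi>" by (simp add: isCont_def LIM_zero_iff)
qed

text \<open>\<open>h\<close> is the constant coefficient of the leading part on the sphere, extended
  with degree 0. Continuity on the compact sphere gives the bound \<open>M\<close>; the expansion
  cut after one term, without derivatives, leaves an error of order -5.\<close>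

lemma classical_symbol_leading:
  assumes "classical_symbol \<theta> (-4) \<rho> \<rho>s" and h_def: "h = (\<lambda>\<xi>. phi0 (\<rho>s 0 ((1 / norm \<xi>) *\<^sub>R \<xi>)))"
  obtains M c where "symbol \<theta> (-4) \<rho>" "continuous_on (UNIV - {0}) h"
    "\<And>t \<xi>. t > 0 \<Longrightarrow> \<xi> \<noteq> 0 \<Longrightarrow> h (t *\<^sub>R \<xi>) = h \<xi>" "\<And>\<xi>. \<xi> \<noteq> 0 \<Longrightarrow> cmod (h \<xi>) \<le> M"
    "\<And>l. l \<noteq> 0 \<Longrightarrow> cmod (\<rho> (ivec l) 0 - h (ivec l) / of_real (lnorm l ^ 4)) \<le> c / lnorm l ^ 5"
proof -
  have sym: "symbol \<theta> (-4) \<rho>" by (rule assms(1)[unfolded classical_symbol_def, THEN conjunct1])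
  from assms(1)[unfolded classical_symbol_def, THEN conjunct2]
  obtain D Ds where fam: "smooth_family UNIV D \<and> D 0 = \<rho> \<and>
      (\<forall>k. smooth_family (UNIV - {0}) (Ds k) \<and> (\<forall>\<xi>. \<xi> \<noteq> 0 \<longrightarrow> Ds k 0 \<xi> = \<rho>s k \<xi>)) \<and>
      (\<forall>k. \<forall>t>0. \<forall>\<xi>. \<xi> \<noteq> 0 \<longrightarrow> \<rho>s k (t *\<^sub>R \<xi>) = (\<lambda>l. complex_of_real (t powr (- 4 - real k)) * \<rho>s k \<xi> l)) \<and>
      (\<forall>N i j. \<exists>c. \<forall>\<xi>. 1 \<le> norm \<xi> \<longrightarrow> cnorm \<theta> (delta i (\<lambda>l. D j \<xi> l - (\<Sum>k<N. Ds k j \<xi> l))) \<le> c * (1 + norm \<xi>) powr (- 4 - real N - real (msize j)))"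
    by (elim exE)
  note D = fam[THEN conjunct1] fam[THEN conjunct2, THEN conjunct1]
  note Ds' = fam[THEN conjunct2, THEN conjunct2, THEN conjunct1]
  note hom' = fam[THEN conjunct2, THEN conjunct2, THEN conjunct2, THEN conjunct1]
  note est = fam[THEN conjunct2, THEN conjunct2, THEN conjunct2, THEN conjunct2]
  have Ds: "\<And>k. smooth_family (UNIV - {0}) (Ds k)" "\<And>k \<xi>. \<xi> \<noteq> 0 \<Longrightarrow> Ds k 0 \<xi> = \<rho>s k \<xi>"
    using Ds' by blast+
  have hom: "\<rho>s k (t *\<^sub>R \<xi>) = (\<lambda>l. complex_of_real (t powr (- 4 - real k)) * \<rho>s k \<xi> l)" if "t > 0" "\<xi> \<noteq> 0" for k t \<xi>
    using hom' that by blast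
  have cs: "continuous_on (UNIV - {0}) (\<lambda>\<xi>. \<rho>s 0 \<xi> 0)"
    by (rule continuous_on_cong[THEN iffD1, OF refl _ smooth_family_continuous[OF Ds(1)[of 0], of 0]]) (simp add: Ds(2))
  have cont: "continuous_on (UNIV - {0}) h"
    unfolding h_def phi0_def by (rule continuous_on_compose2[OF cs]) (auto intro!: continuous_intros)
  have homh: "h (t *\<^sub>R \<xi>) = h \<xi>" if "t > 0" "\<xi> \<noteq> 0" for t \<xi>
    using that by (simp add: h_def)
  have "compact (h ` sphere 0 1)"
    by (intro compact_continuous_image continuous_on_subset[OF cont]) auto
  then have "bounded (h ` sphere 0 1)" by (rule compact_imp_bounded)
  then obtain M where "\<forall>z\<in>h ` sphere 0 1. cmod z \<le> M" unfolding bounded_iff by blast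
  then have M: "cmod (h \<xi>) \<le> M" if "norm \<xi> = 1" for \<xi> using that by auto
  have bd: "cmod (h \<xi>) \<le> M" if "\<xi> \<noteq> 0" for \<xi>
    using M[of "(1 / norm \<xi>) *\<^sub>R \<xi>"] homh[of "1 / norm \<xi>" \<xi>] that by simp
  from est[THEN spec, of 1, THEN spec, of 0, THEN spec, of 0]
  obtain c where "\<forall>\<xi>. 1 \<le> norm \<xi> \<longrightarrow> cnorm \<theta> (delta 0 (\<lambda>l. D 0 \<xi> l - (\<Sum>k<1. Ds k 0 \<xi> l))) \<le> c * (1 + norm \<xi>) powr (- 4 - real 1 - real (msize 0))" ..
  note c = this[rule_format]
  have lead: "cmod (\<rho> (ivec l) 0 - h (ivec l) / of_real (lnorm l ^ 4)) \<le> \<bar>c\<bar> / lnorm l ^ 5" if l: "l \<noteq> 0" for l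
  proof -
    let ?\<xi> = "ivec l"
    have n1: "1 \<le> norm ?\<xi>" using lnorm_ge_1[OF l] by (simp add: lnorm_def)
    have ne: "?\<xi> \<noteq> 0" using l by simp
    have rap: "rapid (\<lambda>l. \<rho> ?\<xi> l - \<rho>s 0 ?\<xi> l)"
    proof (rule rapid_diff)
      show "rapid (\<rho> ?\<xi>)" using D by (auto simp: smooth_family_def)
      have "rapid (Ds 0 0 ?\<xi>)" using Ds(1)[of 0] ne by (auto simp: smooth_family_def)
      then show "rapid (\<rho>s 0 ?\<xi>)" using Ds(2)[OF ne] by simp
    qed
    have "\<rho>s 0 ?\<xi> = \<rho>s 0 (norm ?\<xi> *\<^sub>R ((1 / norm ?\<xi>) *\<^sub>R ?\<xi>))" using ne by simp
    also have "\<dots> = (\<lambda>m. complex_of_real (norm ?\<xi> powr (- 4 - real 0)) * \<rho>s 0 ((1 / norm ?\<xi>) *\<^sub>R ?\<xi>) m)"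
      by (rule hom) (use ne in auto)
    finally have "\<rho>s 0 ?\<xi> 0 = complex_of_real (norm ?\<xi> powr (- 4)) * h ?\<xi>" by (simp add: h_def phi0_def)
    also have "norm ?\<xi> powr (- 4) = 1 / lnorm l ^ 4"
      using n1 ne l by (simp add: powr_minus powr_numeral lnorm_def divide_inverse)
    finally have e: "\<rho>s 0 ?\<xi> 0 = h ?\<xi> / of_real (lnorm l ^ 4)" by simp
    have "cmod (\<rho> ?\<xi> 0 - \<rho>s 0 ?\<xi> 0) \<le> cnorm \<theta> (\<lambda>l. \<rho> ?\<xi> l - \<rho>s 0 ?\<xi> l)" by (rule coeff_le_cnorm[OF rap])
    also have "\<dots> \<le> c * (1 + norm ?\<xi>) powr (- 5)"
      using c[OF n1] by (simp add: D(2) Ds(2)[OF ne] msize_def)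
    also have "\<dots> \<le> \<bar>c\<bar> * (1 / lnorm l ^ 5)"
    proof (rule mult_mono)
      have "(1 + norm ?\<xi>) powr (- 5) = 1 / (1 + norm ?\<xi>) ^ 5"
        using n1 by (simp add: powr_minus powr_numeral divide_inverse)
      also have "\<dots> \<le> 1 / norm ?\<xi> ^ 5" using n1 ne by (intro frac_le power_mono) (auto simp del: ivec_eq_0_iff)
      finally show "(1 + norm ?\<xi>) powr (- 5) \<le> 1 / lnorm l ^ 5" by (simp add: lnorm_def)
    qed auto
    finally show ?thesis unfolding e by simp
  qed
  show ?thesis by (rule that[OF sym cont homh bd lead])
qed

theorem theorem4p6:
  fixes \<theta> :: "real^4^4" and \<rho> :: "freq \<Rightarrow> coeffs" and \<rho>s :: "nat \<Rightarrow> freq \<Rightarrow> coeffs"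
  assumes "skew4 \<theta>"
    and "\<forall>k l. \<theta> $ k $ l \<noteq> 0 \<longrightarrow> \<theta> $ k $ l \<notin> \<rat>"
    and "classical_symbol \<theta> (-4) \<rho> \<rho>s"
  shows "L1inf (Pop \<theta> \<rho>) \<and> dix_measurable (Pop \<theta> \<rho>) \<and> ncint (Pop \<theta> \<rho>) = res (\<rho>s 0) / 4"
proof -
  define h where "h = (\<lambda>\<xi>. phi0 (\<rho>s 0 ((1 / norm \<xi>) *\<^sub>R \<xi>)))"
  obtain M c where sym: "symbol \<theta> (-4) \<rho>" and cont: "continuous_on (UNIV - {0}) h"
    and hom: "\<And>t \<xi>. t > 0 \<Longrightarrow> \<xi> \<noteq> 0 \<Longrightarrow> h (t *\<^sub>R \<xi>) = h \<xi>" and bd: "\<And>\<xi>. \<xi> \<noteq> 0 \<Longrightarrow> cmod (h \<xi>) \<le> M"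
    and lead: "\<And>l. l \<noteq> 0 \<Longrightarrow> cmod (\<rho> (ivec l) 0 - h (ivec l) / of_real (lnorm l ^ 4)) \<le> c / lnorm l ^ 5"
  proof (rule classical_symbol_leading[OF assms(3) h_def])
    fix M c
    assume a: "symbol \<theta> (-4) \<rho>" "continuous_on (UNIV - {0}) h"
      "\<And>t \<xi>. t > 0 \<Longrightarrow> \<xi> \<noteq> 0 \<Longrightarrow> h (t *\<^sub>R \<xi>) = h \<xi>" "\<And>\<xi>. \<xi> \<noteq> 0 \<Longrightarrow> cmod (h \<xi>) \<le> M"
      "\<And>l. l \<noteq> 0 \<Longrightarrow> cmod (\<rho> (ivec l) 0 - h (ivec l) / of_real (lnorm l ^ 4)) \<le> c / lnorm l ^ 5"
    show thesis by (rule that[OF a])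
  qed
  let ?k = "symbol_kernel \<theta> \<rho>"
  obtain C where k: "kdecay C ?k" using symbol_kernel_kdecay[OF sym] .
  have L1: "L1inf (Pop \<theta> \<rho>)" unfolding Pop_eq_kop by (rule kop_L1inf[OF k])
  define kR where "kR n l = (1/2) * ?k n l + (1/2) * kadj ?k n l" for n l
  define kI where "kI n l = (-\<i>/2) * ?k n l + (\<i>/2) * kadj ?k n l" for n l
  have kdR: "kdecay C kR"
    using kdecay_add[OF kdecay_scale[OF k, of "1/2"] kdecay_scale[OF kdecay_kadj[OF k], of "1/2"]] by (simp add: kR_def[abs_def])
  have kdI: "kdecay C kI"
    using kdecay_add[OF kdecay_scale[OF k, of "-\<i>/2"] kdecay_scale[OF kdecay_kadj[OF k], of "\<i>/2"]] by (simp add: kI_def[abs_def] norm_divide norm_mult)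
  have hermR: "kadj kR = kR" and hermI: "kadj kI = kI"
    by (auto simp: fun_eq_iff kadj_def kR_def kI_def)
  define B where "B = complex_of_real (C * 2593)"
  define t1 where "t1 n l = kR n l + B * kdiag n l" for n l
  \<comment> \<open>The diagonal operator is written as a perturbation of the zero kernel, so that
    \<open>kop_dominated_positive\<close> provides its positivity with the same constant
    \<open>B\<close>.\<close>
  define t2 where "t2 n l = 0 * kR n l + B * kdiag n l" for n l
  define t3 where "t3 n l = kI n l + B * kdiag n l" for n l
  have kd0: "kdecay C (\<lambda>n l. 0 * kR n l)" using kdecay_nonneg[OF k] by (simp add: kdecay_def)
  have herm0: "kadj (\<lambda>n l. 0 * kR n l) = (\<lambda>n l. 0 * kR n l)" by (simp add: kadj_def fun_eq_iff)
  note P1 = kop_dominated_positive[OF kdR hermR, folded B_def, folded t1_def]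
    and P2 = kop_dominated_positive[OF kd0 herm0, folded B_def, folded t2_def]
    and P3 = kop_dominated_positive[OF kdI hermI, folded B_def, folded t3_def]
  have dec: "Pop \<theta> \<rho> x = (\<lambda>l. kop t1 x l - kop t2 x l + \<i> * (kop t3 x l - kop t2 x l))" if x: "x \<in> l2" for x
  proof -
    have Bd: "kdecay (cmod B * 1) (\<lambda>n l. B * kdiag n l)" by (rule kdecay_scale[OF kdecay_kdiag])
    have "kop t1 x n - kop t2 x n = kop kR x n" "kop t3 x n - kop t2 x n = kop kI x n" for n
      using kop_add[OF kdR Bd x] kop_add[OF kdI Bd x] kop_add[OF kd0 Bd x] kop_scale[of 0 kR x]
      by (simp_all add: t1_def[abs_def] t2_def[abs_def] t3_def[abs_def])
    moreover have "kop kR x n + \<i> * kop kI x n = kop ?k x n" for n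
    proof -
      have "kop kR x n = (1/2) * kop ?k x n + (1/2) * kop (kadj ?k) x n"
        using kop_add[OF kdecay_scale[OF k, of "1/2"] kdecay_scale[OF kdecay_kadj[OF k], of "1/2"] x]
        unfolding kop_scale kR_def[symmetric] by (simp add: fun_eq_iff)
      moreover have "kop kI x n = (-\<i>/2) * kop ?k x n + (\<i>/2) * kop (kadj ?k) x n"
        using kop_add[OF kdecay_scale[OF k, of "-\<i>/2"] kdecay_scale[OF kdecay_kadj[OF k], of "\<i>/2"] x]
        unfolding kop_scale kI_def[symmetric] by (simp add: fun_eq_iff)
      moreover have "(1/2) * a + (1/2) * b + \<i> * ((-\<i>/2) * a + (\<i>/2) * b) = a" for a b :: complex
        by (simp add: complex_eq_iff)
      ultimately show ?thesis by simp
    qed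
    ultimately show ?thesis by (simp add: Pop_eq_kop fun_eq_iff)
  qed
  define I where "I = integral (ball 0 1) h"
  have kdiag_eq: "?k l l = \<rho> (ivec l) 0" for l by (simp add: symbol_kernel_def)
  have contR: "continuous_on (UNIV - {0}) (\<lambda>\<xi>. Re (h \<xi>))" and contI: "continuous_on (UNIV - {0}) (\<lambda>\<xi>. Im (h \<xi>))"
    using cont by (auto intro: continuous_intros)
  have bdR: "\<bar>Re (h \<xi>)\<bar> \<le> M" and bdI: "\<bar>Im (h \<xi>)\<bar> \<le> M" if "\<xi> \<noteq> 0" for \<xi>
    using bd[OF that] abs_Re_le_cmod[of "h \<xi>"] abs_Im_le_cmod[of "h \<xi>"] by linarith+
  have homR: "Re (h (t *\<^sub>R \<xi>)) = Re (h \<xi>)" and homI: "Im (h (t *\<^sub>R \<xi>)) = Im (h \<xi>)" if "t > 0" "\<xi> \<noteq> 0" for t \<xi>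
    using hom[OF that] by simp_all
  have leadR: "\<bar>Re (\<rho> (ivec l) 0) - Re (h (ivec l)) / lnorm l ^ 4\<bar> \<le> c / lnorm l ^ 5"
    and leadI: "\<bar>Im (\<rho> (ivec l) 0) - Im (h (ivec l)) / lnorm l ^ 4\<bar> \<le> c / lnorm l ^ 5" if "l \<noteq> 0" for l
    using order_trans[OF abs_Re_le_cmod lead[OF that]] order_trans[OF abs_Im_le_cmod lead[OF that]]
    by (simp_all add: Re_divide_of_real Im_divide_of_real del: of_real_power)
  have intR: "(\<lambda>\<xi>. Re (h \<xi>)) integrable_on ball 0 1" by (rule lattice_Riemann_sum(2)[OF contR homR bdR])
  have intI: "(\<lambda>\<xi>. Im (h \<xi>)) integrable_on ball 0 1" by (rule lattice_Riemann_sum(2)[OF contI homI bdI])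
  define IR II where "IR = integral (ball 0 1) (\<lambda>\<xi>. Re (h \<xi>))" and "II = integral (ball 0 1) (\<lambda>\<xi>. Im (h \<xi>))"
  have I: "I = complex_of_real IR + \<i> * complex_of_real II"
  proof -
    have "((\<lambda>\<xi>. complex_of_real (Re (h \<xi>)) + \<i> * complex_of_real (Im (h \<xi>))) has_integral complex_of_real IR + \<i> * complex_of_real II) (ball 0 1)"
      unfolding IR_def II_def
      by (intro has_integral_add has_integral_mult_right has_integral_of_real integrable_integral intR intI)
    moreover have "(\<lambda>\<xi>. complex_of_real (Re (h \<xi>)) + \<i> * complex_of_real (Im (h \<xi>))) = h"
      by (simp add: fun_eq_iff complex_eq_iff)
    ultimately show ?thesis unfolding I_def by (simp only: integral_unique)
  qed
  have pos1: "h0_positive (kop t1) \<and> L1inf (kop t1)" and pos2: "h0_positive (kop t2) \<and> L1inf (kop t2)"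
    and pos3: "h0_positive (kop t3) \<and> L1inf (kop t3)"
    using P1(1) P2(1) P3(1) kop_L1inf[OF P1(2)] kop_L1inf[OF P2(2)] kop_L1inf[OF P3(2)] by simp_all
  have trace: "dixmier_trace \<omega> (Pop \<theta> \<rho>) = I" if \<omega>: "dixmier_state \<omega>" for \<omega>
  proof -
    have d: "dixmier_trace \<omega> (Pop \<theta> \<rho>) = trpos \<omega> (kop t1) - trpos \<omega> (kop t2) + \<i> * (trpos \<omega> (kop t3) - trpos \<omega> (kop t2))"
      by (rule dixmier_trace_eqI[OF \<omega> _ dec]) (use pos1 pos2 pos3 in auto)
    \<comment> \<open>The diagonal of \<open>B * kdiag\<close> cancels, and the twist is 1 on the
      diagonal, so the real and imaginary parts of the constant coefficient of the symbol
      remain.\<close>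
    have diag: "Re (t1 l l) - Re (t2 l l) = Re (\<rho> (ivec l) 0)" "Re (t3 l l) - Re (t2 l l) = Im (\<rho> (ivec l) 0)" for l
      by (simp_all add: t1_def t2_def t3_def kR_def kI_def kadj_def kdiag_eq)
    have "trpos \<omega> (kop t1) - trpos \<omega> (kop t2) = IR"
      unfolding IR_def
      by (rule trace_limit_diff[OF \<omega> P1(2,1) P2(2,1)], unfold diag) (rule lattice_rad_limit[OF contR homR bdR leadR])
    moreover have "trpos \<omega> (kop t3) - trpos \<omega> (kop t2) = II"
      unfolding II_def
      by (rule trace_limit_diff[OF \<omega> P3(2,1) P2(2,1)], unfold diag) (rule lattice_rad_limit[OF contI homI bdI leadI])
    ultimately
    show ?thesis by (simp add: d I)
  qed
  have "dix_measurable (Pop \<theta> \<rho>)" using L1 trace by (simp add: dix_measurable_def)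
  moreover have "ncint (Pop \<theta> \<rho>) = I"
    unfolding ncint_def by (rule trace[OF someI_ex[OF dixmier_state_exists]])
  \<comment> \<open>\<open>sphere3_integral\<close> is 4 times the ball integral of the radial
    extension, which is exactly \<open>h\<close>.\<close>
  moreover have "res (\<rho>s 0) / 4 = I" by (simp add: res_def sphere3_integral_def I_def h_def)
  ultimately show ?thesis using L1 by simp
qed

end
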